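(* Let $H$ and $G$ be two amenable unimodular locally compact second countable compactly generated groups. If there exists a regular embedding from $H$ to $G$, then for every $p\in[1,\infty)$, $$j_{p,G}\preccurlyeq j_{p,H}.$$
   Context: Conventions. Fix compact symmetric generating subsets $S_H\subset H$, $S_G\subset G$, and left-invariant proper metrics $d_H,d_G$ compatible with the topologies and quasi-isometric to the corresponding word metrics. Haar measures $\lambda_H,\lambda_G$ are fixed. Regular embedding. A metric space is balanced if for all $r_1>r_2>0$ there is $N$ such that every $r_1$-ball is covered by at most $N$ $r_2$-balls; $(H,d_H)$ and $(G,d_G)$ are balanced. A map $f\colon X\to Y$ between balanced metric spaces is a regular embedding if there are $r,r'>0$, $L>0$, $N\in\mathbb N$ such that $d(f(x),f(x'))\le L d(x,x')+L$ for all $x,x'\in X$, and the preimage of every $r$-ball of $Y$ can be covered by at most $N$ $r'$-balls of $X$. Isoperimetric profile. For $f\in L^p(G,\lambda_G)$ put $\|\nabla_G^r f\|_p=\sup_{t\in S_G}\|f-\rho(t)f\|_p$, where $(\rho(t)f)(g)=f(gt)$. For $A\subset G$ of finite measure, $J_{p,G}(A)=\sup\|f\|_p/\|\nabla_G^r f\|_p\in[0,+\infty]$, the supremum being over nonzero $f\in L^p(G)$ vanishing outside $A$ (ratio $+\infty$ if the gradient vanishes), and $j_{p,G}(v)=\sup_{\lambda_G(A)\le v}J_{p,G}(A)$. (Since $G$ is unimodular, the left regular representation gives the same profile.) Similarly for $H$. For nondecreasing functions $a,b$, $a\preccurlyeq b$ means there is $C>0$ with $a(v)=O(b(Cv))$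 as $v\to\infty$. *)

theory Defs
  imports "HOL-Analysis.Analysis"
begin

text \<open>
  Topological groups are types of class \<^class>\<open>topological_group_add\<close>. The library has no
  multiplicative group class, so the group law is written \<open>+\<close>; it is not assumed to be
  commutative.
\<close>

section \<open>Generating sets and word metrics\<close>

definition generates :: "'g::group_add set \<Rightarrow> bool" where
  "generates S \<longleftrightarrow> (\<forall>g. \<exists>xs. set xs \<subseteq> S \<union> uminus ` S \<and> sum_list xs = g)"

definition compact_symmetric_generating :: "'g::topological_group_add set \<Rightarrow> bool" where
  "compact_symmetric_generating S \<longleftrightarrow> compact S \<and> uminus ` S = S \<and> generates S"

text \<open>Word lengths and word metrics are used for symmetric generating sets only.\<close>

definition word_length :: "'g::group_add set \<Rightarrow> 'g \<Rightarrow> nat" where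
  "word_length S g = (LEAST n. \<exists>xs. length xs = n \<and> set xs \<subseteq> S \<and> sum_list xs = g)"

definition word_metric :: "'g::group_add set \<Rightarrow> 'g \<Rightarrow> 'g \<Rightarrow> real" where
  "word_metric S x y = real (word_length S (- x + y))"

section \<open>Metrics on groups\<close>

definition left_invariant_metric :: "('g::group_add \<Rightarrow> 'g \<Rightarrow> real) \<Rightarrow> bool" where
  "left_invariant_metric d \<longleftrightarrow>
     Metric_space UNIV d \<and> (\<forall>g x y. d (g + x) (g + y) = d x y)"

text \<open>
  Properness may be tested with the topology of the group because the metric is also
  required to induce that topology.
\<close>

definition compatible_metric :: "('g::topological_space \<Rightarrow> 'g \<Rightarrow> real) \<Rightarrow> bool" where
  "compatible_metric d \<longleftrightarrow> Metric_space.mtopology UNIV d = euclidean"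

definition proper_metric :: "('g::topological_space \<Rightarrow> 'g \<Rightarrow> real) \<Rightarrow> bool" where
  "proper_metric d \<longleftrightarrow> (\<forall>x r. compact (Metric_space.mcball UNIV d x r))"

text \<open>Two metrics on the same set are quasi-isometric if the identity is a quasi-isometry.\<close>

definition quasi_isometric_metrics :: "('a \<Rightarrow> 'a \<Rightarrow> real) \<Rightarrow> ('a \<Rightarrow> 'a \<Rightarrow> real) \<Rightarrow> bool" where
  "quasi_isometric_metrics d d' \<longleftrightarrow>
     (\<exists>a\<ge>1. \<exists>b\<ge>0. \<forall>x y. d' x y / a - b \<le> d x y \<and> d x y \<le> a * d' x y + b)"

definition admissible_metric :: "'g::topological_group_add set \<Rightarrow> ('g \<Rightarrow> 'g \<Rightarrow> real) \<Rightarrow> bool" where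
  "admissible_metric S d \<longleftrightarrow>
     left_invariant_metric d \<and> proper_metric d \<and> compatible_metric d \<and>
     quasi_isometric_metrics d (word_metric S)"

section \<open>Regular embeddings\<close>

definition covered_by_balls :: "('a \<Rightarrow> 'a \<Rightarrow> real) \<Rightarrow> nat \<Rightarrow> real \<Rightarrow> 'a set \<Rightarrow> bool" where
  "covered_by_balls d N r B \<longleftrightarrow>
     (\<exists>C. finite C \<and> card C \<le> N \<and> B \<subseteq> (\<Union>c\<in>C. Metric_space.mball UNIV d c r))"

definition balanced :: "('a \<Rightarrow> 'a \<Rightarrow> real) \<Rightarrow> bool" where
  "balanced d \<longleftrightarrow>
     (\<forall>r\<^sub>1 r\<^sub>2. 0 < r\<^sub>2 \<and> r\<^sub>2 < r\<^sub>1 \<longrightarrow>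
       (\<exists>N. \<forall>x. covered_by_balls d N r\<^sub>2 (Metric_space.mball UNIV d x r\<^sub>1)))"

definition regular_embedding ::
    "('x \<Rightarrow> 'x \<Rightarrow> real) \<Rightarrow> ('y \<Rightarrow> 'y \<Rightarrow> real) \<Rightarrow> ('x \<Rightarrow> 'y) \<Rightarrow> bool" where
  "regular_embedding d\<^sub>X d\<^sub>Y f \<longleftrightarrow>
     Metric_space UNIV d\<^sub>X \<and> balanced d\<^sub>X \<and> Metric_space UNIV d\<^sub>Y \<and> balanced d\<^sub>Y \<and>
     (\<exists>r>0. \<exists>r'>0. \<exists>L>0. \<exists>N.
        (\<forall>x x'. d\<^sub>Y (f x) (f x') \<le> L * d\<^sub>X x x' + L) \<and>
        (\<forall>y. covered_by_balls d\<^sub>X N r' (f -` Metric_space.mball UNIV d\<^sub>Y y r)))"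

section \<open>Haar measures, unimodularity, amenability\<close>

text \<open>
  On a locally compact second countable group every Borel measure that is finite on compact
  sets is Radon, so regularity is not required separately.
\<close>

definition left_haar_measure :: "'g::topological_group_add measure \<Rightarrow> bool" where
  "left_haar_measure \<mu> \<longleftrightarrow>
     sets \<mu> = sets borel \<and>
     (\<forall>K. compact K \<longrightarrow> emeasure \<mu> K < \<infinity>) \<and>
     emeasure \<mu> UNIV \<noteq> 0 \<and>
     (\<forall>g. distr \<mu> borel (\<lambda>x. g + x) = \<mu>)"

definition right_invariant_measure :: "'g::topological_group_add measure \<Rightarrow> bool" where
  "right_invariant_measure \<mu> \<longleftrightarrow> (\<forall>g. distr \<mu> borel (\<lambda>x. x + g) = \<mu>)"

definition unimodular :: "'g::topological_group_add itself \<Rightarrow> bool" where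
  "unimodular _ \<longleftrightarrow>
     (\<forall>\<mu> :: 'g measure. left_haar_measure \<mu> \<longrightarrow> right_invariant_measure \<mu>)"

definition ess_bounded :: "'g measure \<Rightarrow> ('g \<Rightarrow> real) set" where
  "ess_bounded \<mu> = {f \<in> borel_measurable \<mu>. \<exists>c. AE x in \<mu>. \<bar>f x\<bar> \<le> c}"

text \<open>
  A left-invariant mean on the space of essentially bounded functions. Positivity is required
  for almost everywhere nonnegative functions, hence \<open>m\<close> agrees on functions that are equal
  almost everywhere. The values of \<open>m\<close> outside \<^term>\<open>ess_bounded \<mu>\<close> are irrelevant.
\<close>

definition left_invariant_mean ::
    "'g::topological_group_add measure \<Rightarrow> (('g \<Rightarrow> real) \<Rightarrow> real) \<Rightarrow> bool" where
  "left_invariant_mean \<mu> m \<longleftrightarrow>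
     (\<forall>f\<in>ess_bounded \<mu>. \<forall>h\<in>ess_bounded \<mu>. m (\<lambda>x. f x + h x) = m f + m h) \<and>
     (\<forall>f\<in>ess_bounded \<mu>. \<forall>c. m (\<lambda>x. c * f x) = c * m f) \<and>
     (\<forall>f\<in>ess_bounded \<mu>. (AE x in \<mu>. 0 \<le> f x) \<longrightarrow> 0 \<le> m f) \<and>
     m (\<lambda>_. 1) = 1 \<and>
     (\<forall>f\<in>ess_bounded \<mu>. \<forall>g. m (\<lambda>x. f (g + x)) = m f)"

text \<open>
  Left Haar measures exist and are unique up to scaling, so quantifying over all of them
  amounts to considering any single one; the same applies to \<^const>\<open>unimodular\<close>.
\<close>

definition amenable :: "'g::topological_group_add itself \<Rightarrow> bool" where
  "amenable _ \<longleftrightarrow>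
     (\<forall>\<mu> :: 'g measure. left_haar_measure \<mu> \<longrightarrow> (\<exists>m. left_invariant_mean \<mu> m))"

section \<open>Isoperimetric profiles\<close>

definition in_Lp :: "'g measure \<Rightarrow> real \<Rightarrow> ('g \<Rightarrow> real) \<Rightarrow> bool" where
  "in_Lp \<mu> p f \<longleftrightarrow> f \<in> borel_measurable \<mu> \<and> integrable \<mu> (\<lambda>x. \<bar>f x\<bar> powr p)"

definition Lp_norm :: "'g measure \<Rightarrow> real \<Rightarrow> ('g \<Rightarrow> real) \<Rightarrow> real" where
  "Lp_norm \<mu> p f = (\<integral>x. \<bar>f x\<bar> powr p \<partial>\<mu>) powr (1 / p)"

definition right_gradient_norm ::
    "'g::group_add measure \<Rightarrow> 'g set \<Rightarrow> real \<Rightarrow> ('g \<Rightarrow> real) \<Rightarrow> ennreal" where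
  "right_gradient_norm \<mu> S p f = (SUP t\<in>S. ennreal (Lp_norm \<mu> p (\<lambda>g. f g - f (g + t))))"

text \<open>The numerator below is positive, so the quotient is \<open>\<infinity>\<close> if the gradient vanishes.\<close>

definition J_set :: "'g::group_add measure \<Rightarrow> 'g set \<Rightarrow> real \<Rightarrow> 'g set \<Rightarrow> ennreal" where
  "J_set \<mu> S p A =
     (SUP f \<in> {f. in_Lp \<mu> p f \<and> \<not> (AE x in \<mu>. f x = 0) \<and> (\<forall>x. x \<notin> A \<longrightarrow> f x = 0)}.
        ennreal (Lp_norm \<mu> p f) / right_gradient_norm \<mu> S p f)"

definition isoperimetric_profile ::
    "'g::group_add measure \<Rightarrow> 'g set \<Rightarrow> real \<Rightarrow> real \<Rightarrow> ennreal" where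
  "isoperimetric_profile \<mu> S p v =
     (SUP A \<in> {A \<in> sets \<mu>. emeasure \<mu> A \<le> ennreal v}. J_set \<mu> S p A)"

text \<open>The domination \<open>a(v) = O(b(C v))\<close> for functions with values in \<open>[0, \<infinity>]\<close>.\<close>

definition asymp_dominated :: "(real \<Rightarrow> ennreal) \<Rightarrow> (real \<Rightarrow> ennreal) \<Rightarrow> bool"
    (infix "\<preceq>\<^sub>a" 50) where
  "a \<preceq>\<^sub>a b \<longleftrightarrow>
     (\<exists>C>0. \<exists>K>0. eventually (\<lambda>v. a v \<le> ennreal K * b (C * v)) at_top)"

lemma mono_isoperimetric_profile: "mono (isoperimetric_profile \<mu> S p)"
  unfolding isoperimetric_profile_def
  by (intro monoI SUP_subset_mono) (auto intro: order_trans ennreal_leI)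

end

theory Submission
  imports Defs "HOL-Probability.Probability"
begin

text \<open>
  Let \<open>\<phi>\<close> be a regular embedding, \<open>f\<close> a function on \<open>G\<close>, and \<open>k\<close> an almost right invariant
  positive density on \<open>H\<close>. The functions \<open>F\<^sub>y h = k h powr (1/p) * f (y + \<phi> h)\<close> on \<open>H\<close>
  satisfy, after integration over \<open>y\<close> in \<open>G\<close>, the same inequality between gradient and norm as
  \<open>f\<close>, up to constants and an arbitrarily small error. Hence some \<open>F\<^sub>y\<close> satisfies it as well.

  Two difficulties have to be removed. The group \<open>G\<close> need not be discrete, so \<open>f\<close> is first
  replaced by its local averages, cut off where the support of \<open>f\<close> is locally sparse; if this
  destroys \<open>f\<close>, then the quotient of norm and gradient was bounded anyway. The density \<open>k\<close>
  comes from amenability: \<open>k\<close> is the square of an almost norm-preserved \<open>L\<^sup>2\<close> function under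
  averaging by a symmetric kernel with exponential tails. If averaging had norm less than one, the
  logarithm of a Neumann series would be a Lipschitz function with a uniform drift, which
  contradicts the existence of an invariant mean.
\<close>

section \<open>Groups with a Haar measure and a proper metric\<close>

text \<open>Left translation by \<open>y\<close> commutes with the right gradient, and right
  invariance makes the integral over \<open>y\<close> of a function of \<open>y + \<phi> h\<close>
  independent of \<open>h\<close>. So \<open>\<phi>\<close> needs no equivariance; only the size of
  its displacements counts. A generator of \<open>H\<close> moves \<open>\<phi> h\<close> by a
  bounded amount that varies with \<open>h\<close>, whereas gradients on \<open>G\<close> are known
  only in integrated form, for one fixed displacement at a time. This is the obstacle in the
  nondiscrete case: a bound is required that holds at one point for all displacements in a ball, and
  averaging supplies it. The same type of kernel serves on both groups: a law \<nu> that a left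
  shift by \<open>x\<close> changes by a factor of at most exp(a |x|), which forces full support. On
  \<open>G\<close> this controls the oscillation of averages, on \<open>H\<close> it gives a Harnack
  inequality. Its decay can be chosen to beat both the volume growth and the exponential growth of
  gradients along words.\<close>

lemma borel_measurable_uminus_group [measurable (raw)]:
  fixes g :: "'a \<Rightarrow> 'b::{second_countable_topology, topological_group_add}"
  assumes "g \<in> borel_measurable M"
  shows "(\<lambda>x. - g x) \<in> borel_measurable M"
  by (rule borel_measurable_continuous_on[OF _ assms]) (intro continuous_intros)

lemma borel_measurable_diff_group [measurable (raw)]:
  fixes f g :: "'a \<Rightarrow> 'b::{second_countable_topology, topological_group_add}"
  assumes "f \<in> borel_measurable M" "g \<in> borel_measurable M"
  shows "(\<lambda>x. f x - g x) \<in> borel_measurable M"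
  unfolding diff_conv_add_uminus using assms by measurable

locale haar_group =
  fixes S :: "'g::{topological_group_add, t2_space, second_countable_topology} set"
    and d :: "'g \<Rightarrow> 'g \<Rightarrow> real" and \<mu> :: "'g measure"
  assumes generating: "compact_symmetric_generating S"
    and admissible: "admissible_metric S d"
    and haar: "left_haar_measure \<mu>"
    and right_inv: "right_invariant_measure \<mu>"
begin

sublocale Metric_space UNIV d
  using admissible by (simp add: admissible_metric_def left_invariant_metric_def)

section \<open>The left invariant metric and its topology\<close>

definition len :: "'g \<Rightarrow> real" where "len x = d 0 x"

abbreviation B :: "'g \<Rightarrow> real \<Rightarrow> 'g set" where "B \<equiv> mball"

lemma dist_left: "d (g + x) (g + y) = d x y"
  using admissible by (simp add: admissible_metric_def left_invariant_metric_def)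

lemma dist_len: "d x y = len (- x + y)"
  using dist_left[of "- x" x y] by (simp add: len_def)

lemma len_nonneg [simp]: "0 \<le> len x" by (simp add: len_def)

lemma len_uminus [simp]: "len (- x) = len x"
  using dist_len[of x 0] commute[of x 0] by (simp add: len_def)

lemma len_add: "len (x + y) \<le> len x + len y"
  using triangle[of 0 x "x + y"] by (simp add: dist_len[of x] flip: len_def add.assoc)

lemma len_diff: "len (x - y) \<le> len x + len y"
  using len_add[of x "- y"] by simp

lemma open_iff_ball: "open U \<longleftrightarrow> (\<forall>x\<in>U. \<exists>r>0. B x r \<subseteq> U)"
proof -
  have "mtopology = euclidean"
    using admissible by (simp add: admissible_metric_def compatible_metric_def)
  then show ?thesis by (metis open_openin openin_mtopology subset_UNIV)
qed

lemma open_ball [simp]: "open (B x r)"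
proof -
  have "mtopology = euclidean"
    using admissible by (simp add: admissible_metric_def compatible_metric_def)
  then show ?thesis using openin_mball by (metis open_openin)
qed

lemma ball_sets [measurable, simp]: "B x r \<in> sets borel" by simp

lemma compact_cball: "compact (mcball x r)"
  using admissible by (simp add: admissible_metric_def proper_metric_def)

lemma len_measurable [measurable]: "len \<in> borel_measurable borel"
proof (rule borel_measurableI_less)
  fix r
  have "{x \<in> space borel. len x < r} = B 0 r" by (auto simp: len_def)
  then show "{x \<in> space borel. len x < r} \<in> sets borel" by simp
qed

lemma dist_measurable [measurable (raw)]:
  assumes [measurable]: "f \<in> borel_measurable M" "g \<in> borel_measurable M"
  shows "(\<lambda>x. d (f x) (g x)) \<in> borel_measurable M"
proof -
  have "(\<lambda>x. len (- f x + g x)) \<in> borel_measurable M" by measurable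
  then show ?thesis by (subst measurable_cong[OF dist_len])
qed

lemma Lipschitz_measurable:
  fixes v :: "'g \<Rightarrow> real"
  assumes "\<And>x y. \<bar>v x - v y\<bar> \<le> a * d x y"
  shows "v \<in> borel_measurable borel"
proof (rule borel_measurableI_less)
  fix r
  have "open {x. v x < r}"
    unfolding open_iff_ball
  proof safe
    fix x assume "v x < r"
    \<comment> \<open>The denominator is positive and larger than \<open>a\<close>, whatever the
      sign of \<open>a\<close>.\<close>
    define e where "e = (r - v x) / (\<bar>a\<bar> + 1)"
    have "e > 0" using \<open>v x < r\<close> by (simp add: e_def)
    moreover have "B x e \<subseteq> {x. v x < r}"
    proof safe
      fix y assume "y \<in> B x e"
      then have "d y x < e" by (simp add: commute)
      have "v y - v x \<le> a * d y x" using assms[of y x] by linarith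
      also have "\<dots> \<le> (\<bar>a\<bar> + 1) * d y x" by (intro mult_right_mono) auto
      also have "\<dots> < (\<bar>a\<bar> + 1) * e" using \<open>d y x < e\<close> by (intro mult_strict_left_mono) auto
      also have "\<dots> = r - v x" by (simp add: e_def)
      finally show "v y < r" by simp
    qed
    ultimately show "\<exists>e>0. B x e \<subseteq> {x. v x < r}" by blast
  qed
  then show "{x \<in> space borel. v x < r} \<in> sets borel" by simp
qed

section \<open>Invariance, finiteness and positivity of the Haar measure\<close>

lemma sets_mu [measurable_cong, simp]: "sets \<mu> = sets borel"
  using haar by (simp add: left_haar_measure_def)

lemma space_mu [simp]: "space \<mu> = UNIV"
  using sets_eq_imp_space_eq[OF sets_mu] by simp

lemma nn_integral_left:
  assumes [measurable]: "f \<in> borel_measurable borel"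
  shows "(\<integral>\<^sup>+x. f (g + x) \<partial>\<mu>) = (\<integral>\<^sup>+x. f x \<partial>\<mu>)"
proof -
  have "(\<integral>\<^sup>+x. f x \<partial>\<mu>) = (\<integral>\<^sup>+x. f x \<partial>distr \<mu> borel (\<lambda>x. g + x))"
    using haar by (simp add: left_haar_measure_def)
  also have "\<dots> = (\<integral>\<^sup>+x. f (g + x) \<partial>\<mu>)" by (subst nn_integral_distr) auto
  finally show ?thesis by simp
qed

lemma nn_integral_right:
  assumes [measurable]: "f \<in> borel_measurable borel"
  shows "(\<integral>\<^sup>+x. f (x + g) \<partial>\<mu>) = (\<integral>\<^sup>+x. f x \<partial>\<mu>)"
proof -
  have "(\<integral>\<^sup>+x. f x \<partial>\<mu>) = (\<integral>\<^sup>+x. f x \<partial>distr \<mu> borel (\<lambda>x. x + g))"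
    using right_inv by (simp add: right_invariant_measure_def)
  also have "\<dots> = (\<integral>\<^sup>+x. f (x + g) \<partial>\<mu>)" by (subst nn_integral_distr) auto
  finally show ?thesis by simp
qed

lemma emeasure_left:
  assumes "A \<in> sets borel"
  shows "emeasure \<mu> ((\<lambda>x. g + x) -` A) = emeasure \<mu> A"
proof -
  have "emeasure \<mu> A = emeasure (distr \<mu> borel (\<lambda>x. g + x)) A"
    using haar by (simp add: left_haar_measure_def)
  then show ?thesis using assms by (subst (asm) emeasure_distr) auto
qed

lemma ball_translate: "(\<lambda>x. g + x) -` B y r = B (- g + y) r"
  by (auto simp: dist_len add.assoc minus_add)

lemma emeasure_ball: "emeasure \<mu> (B y r) = emeasure \<mu> (B 0 r)"
  using emeasure_left[of "B y r" y] by (simp add: ball_translate)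

lemma emeasure_cball_finite: "emeasure \<mu> (mcball x r) < \<infinity>"
  using haar compact_cball by (simp add: left_haar_measure_def)

lemma emeasure_ball_finite: "emeasure \<mu> (B x r) < \<infinity>"
proof -
  have "emeasure \<mu> (B x r) \<le> emeasure \<mu> (mcball x r)"
    by (intro emeasure_mono mball_subset_mcball) (auto intro: borel_compact compact_cball)
  then show ?thesis using emeasure_cball_finite order_le_less_trans by blast
qed

text \<open>The centres of a countable subcover, by the Lindelof property. Enumerating them by
  natural numbers makes "the first centre close to \<open>x\<close>" a measurable function of
  \<open>x\<close>, which is how uncountable choices are avoided later.\<close>

lemma ex_countable_net:
  assumes "r > 0"
  shows "\<exists>c :: nat \<Rightarrow> 'g. \<forall>x. \<exists>n. d (c n) x < r"
proof -
  obtain F where F: "F \<subseteq> range (\<lambda>x. B x r)" "countable F" "\<Union>F = \<Union>(range (\<lambda>x. B x r))"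
    by (rule Lindelof[of "range (\<lambda>x. B x r)"]) auto
  have "\<Union>(range (\<lambda>x. B x r)) = UNIV" using assms by auto
  with F obtain C where C: "countable C" "F = (\<lambda>x. B x r) ` C"
    by (metis countable_subset_image)
  have "C \<noteq> {}" using C F \<open>\<Union>(range (\<lambda>x. B x r)) = UNIV\<close> by auto
  show ?thesis
  proof (rule exI[of _ "from_nat_into C"], rule allI)
    fix x
    have "x \<in> \<Union>F" using F \<open>\<Union>(range (\<lambda>x. B x r)) = UNIV\<close> by simp
    then obtain y where "y \<in> C" "d y x < r" using C by auto
    then show "\<exists>n. d (from_nat_into C n) x < r"
      using from_nat_into_surj[OF C(1)] by metis
  qed
qed

sublocale sigma_finite_measure \<mu>
proof -
  obtain c :: "nat \<Rightarrow> 'g" where c: "\<forall>x. \<exists>n. d (c n) x < 1" using ex_countable_net[of 1] by auto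
  show "sigma_finite_measure \<mu>"
  proof (rule sigma_finite_measure.intro, intro exI conjI)
    show "countable (range (\<lambda>n. B (c n) 1))" by simp
    show "\<Union>(range (\<lambda>n. B (c n) 1)) = space \<mu>" using c by auto
    show "\<forall>a\<in>range (\<lambda>n. B (c n) 1). emeasure \<mu> a \<noteq> \<infinity>"
      using emeasure_ball_finite by (auto simp: less_top)
  qed auto
qed

text \<open>All balls of one radius have the same measure and countably many of them cover the
  group, so a null ball would make the whole measure zero.\<close>

lemma emeasure_ball_pos:
  assumes "r > 0"
  shows "emeasure \<mu> (B x r) > 0"
proof (rule ccontr)
  assume "\<not> ?thesis"
  then have z: "emeasure \<mu> (B y r) = 0" for y using emeasure_ball by (metis not_gr_zero)
  obtain c :: "nat \<Rightarrow> 'g" where c: "\<forall>x. \<exists>n. d (c n) x < r" using ex_countable_net[OF assms] by auto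
  have "UNIV = (\<Union>n. B (c n) r)" using c by auto
  moreover have "emeasure \<mu> (\<Union>n. B (c n) r) = 0"
    by (rule emeasure_UN_eq_0) (auto simp: z)
  ultimately show False using haar by (simp add: left_haar_measure_def)
qed

section \<open>Word length compared with the metric\<close>

lemma word_exists: "\<exists>xs. set xs \<subseteq> S \<and> sum_list xs = g"
  using generating by (auto simp: compact_symmetric_generating_def generates_def)

lemma word_length_witness:
  "\<exists>xs. length xs = word_length S g \<and> set xs \<subseteq> S \<and> sum_list xs = g"
  unfolding word_length_def
  by (rule LeastI_ex) (use word_exists in blast)

lemma word_length_le: "set xs \<subseteq> S \<Longrightarrow> word_length S (sum_list xs) \<le> length xs"
  unfolding word_length_def by (rule Least_le) auto

lemma word_length_bounds:
  obtains \<alpha> \<beta> where "\<alpha> \<ge> 1" "\<beta> \<ge> 0" "\<And>x. real (word_length S x) \<le> \<alpha> * (len x + \<beta>)"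
    "\<And>x. len x \<le> \<alpha> * real (word_length S x) + \<beta>"
proof -
  obtain a b where ab: "a \<ge> 1" "b \<ge> 0"
    and 1: "\<And>x y. word_metric S x y / a - b \<le> d x y" 
    and 2: "\<And>x y. d x y \<le> a * word_metric S x y + b"
    using admissible unfolding admissible_metric_def quasi_isometric_metrics_def by metis
  show thesis
  proof (rule that[OF ab])
    fix x
    show "real (word_length S x) \<le> a * (len x + b)"
      using 1[of 0 x] ab by (simp add: word_metric_def len_def field_simps)
    show "len x \<le> a * real (word_length S x) + b"
      using 2[of 0 x] by (simp add: word_metric_def len_def)
  qed
qed

lemma generators_bounded: "\<exists>R>0. \<forall>t\<in>S. len t \<le> R"
proof -
  obtain \<alpha> \<beta> where ab: "\<alpha> \<ge> 1" "\<beta> \<ge> 0" and 2: "\<And>x. len x \<le> \<alpha> * real (word_length S x) + \<beta>"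
    using word_length_bounds by metis
  show ?thesis
  proof (intro exI[of _ "\<alpha> + \<beta>"] conjI ballI)
    fix t assume "t \<in> S"
    then have "word_length S t \<le> 1" using word_length_le[of "[t]"] by simp
    then have "\<alpha> * real (word_length S t) \<le> \<alpha> * 1" using ab by (intro mult_left_mono) auto
    then show "len t \<le> \<alpha> + \<beta>" using 2[of t] by simp
  qed (use ab in auto)
qed

end

section \<open>Symmetric kernels with exponential tails\<close>

lemma le_suminf: "f n \<le> suminf f" for f :: "nat \<Rightarrow> ennreal"
  using sum_le_suminf[of f "{n}"] by simp

context haar_group
begin

text \<open>This is \<open>B 0 1 + S + ... + S\<close> with \<open>n\<close> summands
  \<open>S\<close>: the products of \<open>n\<close> generators, thickened by a ball so as to be
  open, hence measurable. Writing it as a union of preimages makes openness immediate.\<close>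

primrec wide :: "nat \<Rightarrow> 'g set" where
  "wide 0 = B 0 1"
| "wide (Suc n) = (\<Union>s\<in>S. (\<lambda>x. x - s) -` wide n)"

lemma open_wide [simp]: "open (wide n)"
proof (induction n)
  case (Suc n)
  have "continuous_on UNIV (\<lambda>x::'g. x - s)" for s
    unfolding diff_conv_add_uminus by (intro continuous_intros)
  then show ?case using Suc by (auto intro!: open_UN open_vimage)
qed simp

lemma sum_list_wide: "set xs \<subseteq> S \<Longrightarrow> sum_list xs \<in> wide (length xs)"
  by (induction xs rule: rev_induct) (auto, metis add_diff_cancel)

text \<open>Letters are appended on the right, so a covering of \<open>B 0 1 + S\<close> by left translates of
  \<open>B 0 1\<close> propagates to all \<open>wide n\<close>.\<close>

lemma wide_growth: "\<exists>M\<ge>1. \<forall>n. emeasure \<mu> (wide n) \<le> ennreal (M ^ n) * emeasure \<mu> (B 0 1)"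
proof -
  have "compact ((\<lambda>(v, s). v + s) ` (mcball 0 1 \<times> S))"
    using generating unfolding compact_symmetric_generating_def case_prod_beta
    by (intro compact_continuous_image compact_Times compact_cball continuous_intros) auto
  then obtain F where F: "finite F" "(\<lambda>(v, s). v + s) ` (mcball 0 1 \<times> S) \<subseteq> (\<Union>f\<in>F. B f 1)"
    by (rule compactE_image[where C = UNIV and f = "\<lambda>f. B f 1"]) (auto, metis mdist_zero UNIV_I zero_less_one)
  have step: "\<exists>f\<in>F. - f + x \<in> wide n" if "x \<in> wide (Suc n)" for n x
    using that
  proof (induction n arbitrary: x)
    case 0
    then obtain s where s: "s \<in> S" "x - s \<in> B 0 1" by auto
    have "x \<in> (\<lambda>(v, s). v + s) ` (mcball 0 1 \<times> S)"
      by (rule image_eqI[of _ _ "(x - s, s)"]) (use s mball_subset_mcball in auto)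
    then obtain f where "f \<in> F" "x \<in> B f 1" using F by blast
    moreover have "d 0 (- f + x) = d f x" by (simp add: dist_len[of f] len_def)
    ultimately show ?case using \<open>f \<in> F\<close> by (intro bexI[of _ f]) auto
  next
    case (Suc n)
    then obtain s where s: "s \<in> S" "x - s \<in> wide (Suc n)" by auto
    then obtain f where "f \<in> F" "- f + (x - s) \<in> wide n" using Suc.IH by blast
    then show ?case using s(1) by (auto simp: add_diff_eq)
  qed
  have le: "emeasure \<mu> (wide (Suc n)) \<le> ennreal (real (card F)) * emeasure \<mu> (wide n)" for n
  proof -
    have op: "open ((\<lambda>x. - f + x) -` wide n)" for f
      by (intro open_vimage continuous_intros) auto
    have "emeasure \<mu> (wide (Suc n)) \<le> emeasure \<mu> (\<Union>f\<in>F. (\<lambda>x. - f + x) -` wide n)"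
      using step by (intro emeasure_mono) (auto simp del: wide.simps intro!: borel_open open_UN op)
    also have "\<dots> \<le> (\<Sum>f\<in>F. emeasure \<mu> ((\<lambda>x. - f + x) -` wide n))"
      using F(1) by (intro emeasure_subadditive_finite) (auto intro!: borel_open op)
    also have "\<dots> = (\<Sum>f\<in>F. emeasure \<mu> (wide n))"
      by (intro sum.cong emeasure_left) (auto intro!: borel_open)
    finally show ?thesis by (simp add: ennreal_of_nat_eq_real_of_nat)
  qed
  show ?thesis
  proof (intro exI[of _ "real (card F) + 1"] conjI allI)
    fix n
    show "emeasure \<mu> (wide n) \<le> ennreal ((real (card F) + 1) ^ n) * emeasure \<mu> (B 0 1)"
    proof (induction n)
      case (Suc n)
      have "emeasure \<mu> (wide (Suc n)) \<le> ennreal (real (card F) + 1) * emeasure \<mu> (wide n)"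
        using le[of n] by (rule order_trans) (intro mult_right_mono ennreal_leI, auto)
      also have "\<dots> \<le> ennreal (real (card F) + 1) * (ennreal ((real (card F) + 1) ^ n) * emeasure \<mu> (B 0 1))"
        using Suc by (intro mult_left_mono) auto
      finally show ?case by (simp add: ennreal_mult mult.assoc)
    qed simp
  qed simp
qed

text \<open>Volume grows at most exponentially in the word length, and the word length is at most
  linear in \<open>len\<close>, so a sufficiently fast exponential decay is integrable. The integral
  is compared with a geometric series over the sets \<open>wide n\<close>.\<close>

lemma exp_len_integrable:
  obtains a\<^sub>0 where "a\<^sub>0 \<ge> 0" "\<And>a. a \<ge> a\<^sub>0 \<Longrightarrow> (\<integral>\<^sup>+x. ennreal (exp (- a * len x)) \<partial>\<mu>) < \<infinity>"
proof -
  obtain M where M: "M \<ge> 1" "\<And>n. emeasure \<mu> (wide n) \<le> ennreal (M ^ n) * emeasure \<mu> (B 0 1)"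
    using wide_growth by metis
  obtain \<alpha> \<beta> where ab: "\<alpha> \<ge> 1" "\<beta> \<ge> 0" "\<And>x. real (word_length S x) \<le> \<alpha> * (len x + \<beta>)"
    using word_length_bounds by metis
  \<comment> \<open>One more letter costs a factor \<open>q\<close>, at most exp(-a/\<alpha>), and
    gains a factor \<open>M\<close> in volume; this choice makes the ratio \<open>q * M\<close> at
    most 1/2.\<close>
  define a\<^sub>0 where "a\<^sub>0 = \<alpha> * ln (2 * M)"
  have "a\<^sub>0 \<ge> 0" unfolding a\<^sub>0_def using M ab by (intro mult_nonneg_nonneg) auto
  moreover have "(\<integral>\<^sup>+x. ennreal (exp (- a * len x)) \<partial>\<mu>) < \<infinity>" if "a \<ge> a\<^sub>0" for a
  proof -
    have "a \<ge> 0" using that \<open>a\<^sub>0 \<ge> 0\<close> by simp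
    define q where "q = exp (- a / \<alpha>)"
    have "ln (2 * M) \<le> a / \<alpha>" using that ab by (simp add: a\<^sub>0_def field_simps)
    then have "q \<le> exp (- ln (2 * M))" by (simp add: q_def)
    also have "\<dots> = 1 / (2 * M)" using M by (simp add: exp_minus field_simps)
    finally have qM: "q * M \<le> 1 / 2" using M by (simp add: field_simps)
    have q0: "q \<ge> 0" by (simp add: q_def)
    have qn: "q ^ n = exp (- a * real n / \<alpha>)" for n
      by (simp add: q_def flip: exp_of_nat_mult)
    have le: "ennreal (exp (- a * len x)) \<le> (\<Sum>n. ennreal (exp (a * \<beta>) * q ^ n) * indicator (wide n) x)" for x
    proof -
      let ?n = "word_length S x"
      have "x \<in> wide ?n" using word_length_witness[of x] sum_list_wide by metis
      have "real ?n / \<alpha> \<le> len x + \<beta>" using ab(3)[of x] ab(1) by (simp add: field_simps)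
      then have "a * (real ?n / \<alpha>) \<le> a * (len x + \<beta>)" using \<open>a \<ge> 0\<close> by (intro mult_left_mono)
      then have "exp (- a * len x) \<le> exp (a * \<beta>) * q ^ ?n"
        unfolding qn by (simp add: algebra_simps flip: exp_add)
      then have "ennreal (exp (- a * len x)) \<le> ennreal (exp (a * \<beta>) * q ^ ?n) * indicator (wide ?n) x"
        using \<open>x \<in> wide ?n\<close> by (simp add: ennreal_leI)
      also have "\<dots> \<le> (\<Sum>n. ennreal (exp (a * \<beta>) * q ^ n) * indicator (wide n) x)"
        by (rule le_suminf)
      finally show ?thesis .
    qed
    have [measurable]: "wide n \<in> sets borel" for n by (simp del: wide.simps)
    have "(\<integral>\<^sup>+x. ennreal (exp (- a * len x)) \<partial>\<mu>)
        \<le> (\<integral>\<^sup>+x. (\<Sum>n. ennreal (exp (a * \<beta>) * q ^ n) * indicator (wide n) x) \<partial>\<mu>)"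
      by (intro nn_integral_mono le)
    also have "\<dots> = (\<Sum>n. \<integral>\<^sup>+x. ennreal (exp (a * \<beta>) * q ^ n) * indicator (wide n) x \<partial>\<mu>)"
      by (rule nn_integral_suminf) measurable
    also have "\<dots> = (\<Sum>n. ennreal (exp (a * \<beta>) * q ^ n) * emeasure \<mu> (wide n))"
      by (simp add: nn_integral_cmult_indicator)
    also have "\<dots> \<le> (\<Sum>n. ennreal (exp (a * \<beta>) * (1 / 2) ^ n) * emeasure \<mu> (B 0 1))"
    proof (rule suminf_le)
      fix n
      have "ennreal (exp (a * \<beta>) * q ^ n) * emeasure \<mu> (wide n)
          \<le> ennreal (exp (a * \<beta>) * q ^ n) * (ennreal (M ^ n) * emeasure \<mu> (B 0 1))"
        by (intro mult_left_mono M) auto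
      also have "\<dots> = ennreal (exp (a * \<beta>) * (q * M) ^ n) * emeasure \<mu> (B 0 1)"
        using M q0 by (simp add: power_mult_distrib ennreal_mult mult.assoc)
      also have "\<dots> \<le> ennreal (exp (a * \<beta>) * (1 / 2) ^ n) * emeasure \<mu> (B 0 1)"
        using qM q0 M by (intro mult_right_mono ennreal_leI mult_left_mono power_mono) auto
      finally show "ennreal (exp (a * \<beta>) * q ^ n) * emeasure \<mu> (wide n)
          \<le> ennreal (exp (a * \<beta>) * (1 / 2) ^ n) * emeasure \<mu> (B 0 1)" .
    qed auto
    also have "\<dots> = (\<Sum>n. ennreal (exp (a * \<beta>) * (1 / 2) ^ n)) * emeasure \<mu> (B 0 1)"
      by simp
    also have "(\<Sum>n. ennreal (exp (a * \<beta>) * (1 / 2) ^ n)) = ennreal (\<Sum>n. exp (a * \<beta>) * (1 / 2) ^ n)"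
      by (intro suminf_ennreal2 summable_mult summable_geometric) auto
    also have "ennreal (\<Sum>n. exp (a * \<beta>) * (1 / 2) ^ n) * emeasure \<mu> (B 0 1) < \<infinity>"
      using emeasure_ball_finite[of 0 1] by (auto simp: ennreal_mult_less_top)
    finally show ?thesis .
  qed
  ultimately show thesis using that by blast
qed

end

text \<open>The axioms are relations between nonnegative integrals, so a density of \<nu> never has
  to be handled. Quasi-invariance controls a change of base point; symmetry makes integrals of odd
  functions vanish; domination, with the shift \<open>x\<close> built in, turns an integral bound
  over the group into a bound at every point.\<close>

locale smoothing = haar_group S d \<mu>
  for S :: "'g::{topological_group_add, t2_space, second_countable_topology} set"
    and d :: "'g \<Rightarrow> 'g \<Rightarrow> real" and \<mu> :: "'g measure" +
  fixes \<nu> :: "'g measure" and a c :: real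
  assumes prob: "prob_space \<nu>"
    and sets_nu [measurable_cong, simp]: "sets \<nu> = sets borel"
    and a_nonneg: "0 \<le> a" and c_nonneg: "0 \<le> c"
    and quasi_invariant: "F \<in> borel_measurable borel \<Longrightarrow>
          (\<integral>\<^sup>+s. F (x + s) \<partial>\<nu>) \<le> ennreal (exp (a * len x)) * (\<integral>\<^sup>+s. F s \<partial>\<nu>)"
    and symmetric: "F \<in> borel_measurable borel \<Longrightarrow> (\<integral>\<^sup>+s. F (- s) \<partial>\<nu>) = (\<integral>\<^sup>+s. F s \<partial>\<nu>)"
    and dominated: "F \<in> borel_measurable borel \<Longrightarrow>
          (\<integral>\<^sup>+s. F (x + s) \<partial>\<nu>) \<le> ennreal c * (\<integral>\<^sup>+s. F s \<partial>\<mu>)"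

context haar_group
begin

text \<open>The normalized density exp(-a |x|) is quasi-invariant by the triangle inequality and
  bounded by 1/Z. The parameter \<open>b\<close> prescribes an exponential moment, so that the
  kernel can be adapted to whatever growth it has to integrate.\<close>

lemma ex_smoothing:
  obtains \<nu> a c where "smoothing S d \<mu> \<nu> a c" "(\<integral>\<^sup>+s. ennreal (exp (b * len s)) \<partial>\<nu>) < \<infinity>"
proof -
  obtain a\<^sub>0 where a0: "a\<^sub>0 \<ge> 0" "\<And>a. a \<ge> a\<^sub>0 \<Longrightarrow> (\<integral>\<^sup>+x. ennreal (exp (- a * len x)) \<partial>\<mu>) < \<infinity>"
    using exp_len_integrable by metis
  define a where "a = a\<^sub>0 + \<bar>b\<bar>"
  have a: "a \<ge> 0" "a \<ge> a\<^sub>0" "a - b \<ge> a\<^sub>0" using a0 by (auto simp: a_def)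
  define I where "I = (\<integral>\<^sup>+x. ennreal (exp (- a * len x)) \<partial>\<mu>)"
  have "I < \<infinity>" using a0 a by (simp add: I_def)
  have "I \<noteq> 0"
  proof
    assume "I = 0"
    then have "AE x in \<mu>. ennreal (exp (- a * len x)) = 0"
      unfolding I_def by (subst (asm) nn_integral_0_iff_AE) measurable
    then have "AE x in \<mu>. False" by simp
    then have "emeasure \<mu> UNIV = 0" by (simp add: AE_iff_null null_sets_def)
    then show False using haar by (simp add: left_haar_measure_def)
  qed
  define Z where "Z = enn2real I"
  have Z: "I = ennreal Z" "Z > 0"
    using \<open>I < \<infinity>\<close> \<open>I \<noteq> 0\<close> by (auto simp: Z_def enn2real_positive_iff less_top zero_less_iff_neq_zero)
  define \<kappa> where "\<kappa> x = ennreal (exp (- a * len x) / Z)" for x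
  have [measurable]: "\<kappa> \<in> borel_measurable borel" unfolding \<kappa>_def by measurable
  define \<nu>\<^sub>0 where "\<nu>\<^sub>0 = density \<mu> \<kappa>"
  have sets0 [measurable_cong, simp]: "sets \<nu>\<^sub>0 = sets borel" by (simp add: \<nu>\<^sub>0_def)
  have space0: "space \<nu>\<^sub>0 = UNIV" by (simp add: \<nu>\<^sub>0_def)
  have int0: "(\<integral>\<^sup>+s. F s \<partial>\<nu>\<^sub>0) = (\<integral>\<^sup>+s. \<kappa> s * F s \<partial>\<mu>)" if [measurable]: "F \<in> borel_measurable borel" for F
    unfolding \<nu>\<^sub>0_def by (subst nn_integral_density) auto
  have "emeasure \<nu>\<^sub>0 UNIV = 1"
  proof -
    have "emeasure \<nu>\<^sub>0 UNIV = (\<integral>\<^sup>+s. ennreal (exp (- a * len s)) * ennreal (1 / Z) \<partial>\<mu>)"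
      unfolding \<nu>\<^sub>0_def \<kappa>_def using Z by (subst emeasure_density) (auto simp flip: ennreal_mult)
    also have "\<dots> = I * ennreal (1 / Z)" unfolding I_def by (rule nn_integral_multc) measurable
    also have "\<dots> = 1" using Z by (simp flip: ennreal_mult)
    finally show ?thesis .
  qed
  then interpret p0: prob_space \<nu>\<^sub>0 by (intro prob_spaceI) (simp add: space0)
  interpret pp: pair_prob_space \<nu>\<^sub>0 \<nu>\<^sub>0 ..
  have quasi0: "(\<integral>\<^sup>+s. F (x + s) \<partial>\<nu>\<^sub>0) \<le> ennreal (exp (a * len x)) * (\<integral>\<^sup>+s. F s \<partial>\<nu>\<^sub>0)"
    if [measurable]: "F \<in> borel_measurable borel" for F x
  proof -
    have "(\<integral>\<^sup>+s. F (x + s) \<partial>\<nu>\<^sub>0) = (\<integral>\<^sup>+s. \<kappa> (- x + (x + s)) * F (x + s) \<partial>\<mu>)"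
      by (subst int0) (auto simp flip: add.assoc)
    also have "\<dots> = (\<integral>\<^sup>+s. \<kappa> (- x + s) * F s \<partial>\<mu>)"
      by (rule nn_integral_left[of "\<lambda>s. \<kappa> (- x + s) * F s"]) measurable
    also have "\<dots> \<le> (\<integral>\<^sup>+s. ennreal (exp (a * len x)) * (\<kappa> s * F s) \<partial>\<mu>)"
    proof (intro nn_integral_mono)
      fix s
      have "len s \<le> len x + len (- x + s)" using len_add[of x "- x + s"] by (simp flip: add.assoc)
      then have "a * len s \<le> a * (len x + len (- x + s))" using a by (intro mult_left_mono)
      then have "exp (- a * len (- x + s)) \<le> exp (a * len x) * exp (- a * len s)"
        by (simp add: algebra_simps flip: exp_add)
      then have "exp (- a * len (- x + s)) / Z \<le> exp (a * len x) * (exp (- a * len s) / Z)"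
        using Z by (simp add: field_simps)
      then have "\<kappa> (- x + s) \<le> ennreal (exp (a * len x)) * \<kappa> s"
        unfolding \<kappa>_def using Z by (simp flip: ennreal_mult)
      then show "\<kappa> (- x + s) * F s \<le> ennreal (exp (a * len x)) * (\<kappa> s * F s)"
        by (metis mult.assoc mult_right_mono zero_le)
    qed
    also have "\<dots> = ennreal (exp (a * len x)) * (\<integral>\<^sup>+s. F s \<partial>\<nu>\<^sub>0)"
      by (subst nn_integral_cmult) (auto simp: int0)
    finally show ?thesis .
  qed
  have dom0: "(\<integral>\<^sup>+s. F s \<partial>\<nu>\<^sub>0) \<le> ennreal (1 / Z) * (\<integral>\<^sup>+s. F s \<partial>\<mu>)"
    if [measurable]: "F \<in> borel_measurable borel" for F
  proof -
    have "\<kappa> s \<le> ennreal (1 / Z)" for s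
      unfolding \<kappa>_def using Z a by (intro ennreal_leI divide_right_mono) auto
    then have "(\<integral>\<^sup>+s. F s \<partial>\<nu>\<^sub>0) \<le> (\<integral>\<^sup>+s. ennreal (1 / Z) * F s \<partial>\<mu>)"
      by (subst int0) (auto intro!: nn_integral_mono mult_right_mono)
    then show ?thesis by (subst (asm) nn_integral_cmult) auto
  qed
  \<comment> \<open>Taking the law of a difference makes the kernel symmetric without using that the Haar
    measure is invariant under inversion.\<close>
  define \<nu> where "\<nu> = distr (\<nu>\<^sub>0 \<Otimes>\<^sub>M \<nu>\<^sub>0) borel (\<lambda>(t, s). s - t)"
  have int: "(\<integral>\<^sup>+s. F s \<partial>\<nu>) = (\<integral>\<^sup>+t. \<integral>\<^sup>+s. F (s - t) \<partial>\<nu>\<^sub>0 \<partial>\<nu>\<^sub>0)"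
    if [measurable]: "F \<in> borel_measurable borel" for F
  proof -
    have "(\<integral>\<^sup>+s. F s \<partial>\<nu>) = (\<integral>\<^sup>+z. F (case z of (t, s) \<Rightarrow> s - t) \<partial>(\<nu>\<^sub>0 \<Otimes>\<^sub>M \<nu>\<^sub>0))"
      unfolding \<nu>_def by (subst nn_integral_distr) auto
    also have "\<dots> = (\<integral>\<^sup>+t. \<integral>\<^sup>+s. F (s - t) \<partial>\<nu>\<^sub>0 \<partial>\<nu>\<^sub>0)"
      by (subst p0.nn_integral_fst[symmetric]) auto
    finally show ?thesis .
  qed
  have "smoothing S d \<mu> \<nu> a (1 / Z)"
  proof (intro smoothing.intro smoothing_axioms.intro haar_group_axioms)
    show "prob_space \<nu>" unfolding \<nu>_def by (rule pp.prob_space_distr) measurable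
    show "sets \<nu> = sets borel" by (simp add: \<nu>_def)
    fix F :: "'g \<Rightarrow> ennreal" and x
    assume [measurable]: "F \<in> borel_measurable borel"
    \<comment> \<open>The order in the difference \<open>s - t\<close> matters: a shift from the
      left reaches only \<open>s\<close>, so the rate \<open>a\<close> is not doubled.\<close>
    have "(\<integral>\<^sup>+s. F (x + s) \<partial>\<nu>) = (\<integral>\<^sup>+t. \<integral>\<^sup>+s. F (x + s - t) \<partial>\<nu>\<^sub>0 \<partial>\<nu>\<^sub>0)"
      by (subst int) (auto simp: add_diff_eq)
    also have "\<dots> \<le> (\<integral>\<^sup>+t. ennreal (exp (a * len x)) * (\<integral>\<^sup>+s. F (s - t) \<partial>\<nu>\<^sub>0) \<partial>\<nu>\<^sub>0)"
      using quasi0[of "\<lambda>s. F (s - t)" for t] by (intro nn_integral_mono) simp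
    also have "\<dots> = ennreal (exp (a * len x)) * (\<integral>\<^sup>+s. F s \<partial>\<nu>)"
      by (subst nn_integral_cmult) (auto simp: int)
    finally show "(\<integral>\<^sup>+s. F (x + s) \<partial>\<nu>) \<le> ennreal (exp (a * len x)) * (\<integral>\<^sup>+s. F s \<partial>\<nu>)" .
    have "(\<integral>\<^sup>+s. F (- s) \<partial>\<nu>) = (\<integral>\<^sup>+t. \<integral>\<^sup>+s. F (t - s) \<partial>\<nu>\<^sub>0 \<partial>\<nu>\<^sub>0)"
      by (subst int) auto
    also have "\<dots> = (\<integral>\<^sup>+s. \<integral>\<^sup>+t. F (t - s) \<partial>\<nu>\<^sub>0 \<partial>\<nu>\<^sub>0)"
      by (rule pp.Fubini') measurable
    also have "\<dots> = (\<integral>\<^sup>+s. F s \<partial>\<nu>)" by (subst int) auto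
    finally show "(\<integral>\<^sup>+s. F (- s) \<partial>\<nu>) = (\<integral>\<^sup>+s. F s \<partial>\<nu>)" .
    have "(\<integral>\<^sup>+s. F (x + s) \<partial>\<nu>) = (\<integral>\<^sup>+t. \<integral>\<^sup>+s. F (x + (s - t)) \<partial>\<nu>\<^sub>0 \<partial>\<nu>\<^sub>0)"
      by (subst int) auto
    also have "\<dots> \<le> (\<integral>\<^sup>+t. ennreal (1 / Z) * (\<integral>\<^sup>+s. F s \<partial>\<mu>) \<partial>\<nu>\<^sub>0)"
    proof (rule nn_integral_mono)
      fix t
      have "(\<integral>\<^sup>+s. F (x + (s - t)) \<partial>\<nu>\<^sub>0) \<le> ennreal (1 / Z) * (\<integral>\<^sup>+s. F (x + (s - t)) \<partial>\<mu>)"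
        by (rule dom0) measurable
      \<comment> \<open>Unimodularity enters here: the term \<open>- t\<close> stands on the right
        of the integration variable.\<close>
      also have "(\<integral>\<^sup>+s. F (x + (s - t)) \<partial>\<mu>) = (\<integral>\<^sup>+s. F (x + s) \<partial>\<mu>)"
        using nn_integral_right[of "\<lambda>s. F (x + s)" "- t"] by simp
      also have "\<dots> = (\<integral>\<^sup>+s. F s \<partial>\<mu>)" by (rule nn_integral_left) measurable
      finally show "(\<integral>\<^sup>+s. F (x + (s - t)) \<partial>\<nu>\<^sub>0) \<le> ennreal (1 / Z) * (\<integral>\<^sup>+s. F s \<partial>\<mu>)" .
    qed
    also have "\<dots> = ennreal (1 / Z) * (\<integral>\<^sup>+s. F s \<partial>\<mu>)" by (simp add: p0.emeasure_space_1)
    finally show "(\<integral>\<^sup>+s. F (x + s) \<partial>\<nu>) \<le> ennreal (1 / Z) * (\<integral>\<^sup>+s. F s \<partial>\<mu>)" .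
  qed (use a Z in auto)
  moreover have "(\<integral>\<^sup>+s. ennreal (exp (b * len s)) \<partial>\<nu>) < \<infinity>"
  proof -
    have "(\<integral>\<^sup>+s. ennreal (exp (\<bar>b\<bar> * len s)) \<partial>\<nu>\<^sub>0) = (\<integral>\<^sup>+s. ennreal (1 / Z) * ennreal (exp (- a\<^sub>0 * len s)) \<partial>\<mu>)"
      using Z by (subst int0) (auto simp: \<kappa>_def a_def algebra_simps simp flip: ennreal_mult exp_add
        intro!: nn_integral_cong)
    also have "\<dots> = ennreal (1 / Z) * (\<integral>\<^sup>+s. ennreal (exp (- a\<^sub>0 * len s)) \<partial>\<mu>)"
      by (rule nn_integral_cmult) measurable
    also have "\<dots> < \<infinity>" using a0(2)[of a\<^sub>0] by (auto simp: ennreal_mult_less_top)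
    finally have fin: "(\<integral>\<^sup>+s. ennreal (exp (\<bar>b\<bar> * len s)) \<partial>\<nu>\<^sub>0) < \<infinity>" (is "?J < _") .
    have "(\<integral>\<^sup>+s. ennreal (exp (b * len s)) \<partial>\<nu>) \<le> (\<integral>\<^sup>+s. ennreal (exp (\<bar>b\<bar> * len s)) \<partial>\<nu>)"
      by (intro nn_integral_mono ennreal_leI) (auto intro: mult_right_mono)
    also have "\<dots> = (\<integral>\<^sup>+t. \<integral>\<^sup>+s. ennreal (exp (\<bar>b\<bar> * len (s - t))) \<partial>\<nu>\<^sub>0 \<partial>\<nu>\<^sub>0)"
      by (subst int) auto
    also have "\<dots> \<le> (\<integral>\<^sup>+t. \<integral>\<^sup>+s. ennreal (exp (\<bar>b\<bar> * len t)) * ennreal (exp (\<bar>b\<bar> * len s)) \<partial>\<nu>\<^sub>0 \<partial>\<nu>\<^sub>0)"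
    proof (intro nn_integral_mono)
      fix s t
      have "\<bar>b\<bar> * len (s - t) \<le> \<bar>b\<bar> * (len s + len t)" by (intro mult_left_mono len_diff) auto
      then show "ennreal (exp (\<bar>b\<bar> * len (s - t))) \<le> ennreal (exp (\<bar>b\<bar> * len t)) * ennreal (exp (\<bar>b\<bar> * len s))"
        by (simp add: algebra_simps flip: ennreal_mult exp_add)
    qed
    also have "\<dots> = (\<integral>\<^sup>+t. ennreal (exp (\<bar>b\<bar> * len t)) * ?J \<partial>\<nu>\<^sub>0)"
      by (subst nn_integral_cmult) auto
    also have "\<dots> = ?J * ?J" by (subst nn_integral_multc) auto
    also have "\<dots> < \<infinity>" using fin by (auto simp: ennreal_mult_less_top)
    finally show ?thesis .
  qed
  ultimately show thesis using that by blast
qed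

end

section \<open>Inequalities for powers\<close>

text \<open>Extended values free monotonicity, Fubini and translations of integrals from
  integrability conditions. Since \<open>powr\<close> is 0 at base 0, the value at 0 is 0 for every
  exponent.\<close>

definition pw :: "real \<Rightarrow> real \<Rightarrow> ennreal" where
  "pw p x = ennreal (\<bar>x\<bar> powr p)"

lemma pw_measurable [measurable (raw)]:
  "f \<in> borel_measurable M \<Longrightarrow> (\<lambda>x. pw p (f x)) \<in> borel_measurable M"
  unfolding pw_def by measurable

lemma pw_0 [simp]: "pw p 0 = 0" by (simp add: pw_def)

lemma pw_minus: "pw p (x - y) = pw p (y - x)" by (simp add: pw_def abs_minus_commute)

lemma pw_mono: "0 \<le> p \<Longrightarrow> \<bar>x\<bar> \<le> \<bar>y\<bar> \<Longrightarrow> pw p x \<le> pw p y"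
  by (auto simp: pw_def intro!: ennreal_leI powr_mono2)

lemma pw_mult: "pw p (x * y) = pw p x * pw p y"
  by (simp add: pw_def abs_mult powr_mult flip: ennreal_mult)

lemma pw_add_le:
  assumes "0 \<le> p"
  shows "pw p (x + y) \<le> ennreal (2 powr p) * (pw p x + pw p y)"
proof -
  define m where "m = max \<bar>x\<bar> \<bar>y\<bar>"
  have "pw p (x + y) \<le> pw p (2 * m)" using assms by (intro pw_mono) (auto simp: m_def)
  also have "\<dots> = ennreal (2 powr p) * pw p m" by (simp add: pw_mult) (simp add: pw_def)
  also have "pw p m \<le> pw p x + pw p y" by (auto simp: m_def max_def pw_def)
  finally show ?thesis by (simp add: mult_left_mono)
qed

lemma pw_sub_le:
  assumes "0 \<le> p"
  shows "pw p (x - y) \<le> ennreal (2 powr p) * (pw p x + pw p y)"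
  using pw_add_le[OF assms, of x "- y"] by (simp add: pw_def)

text \<open>The fractions x/(x+y) and y/(x+y) lie in the unit interval, where the p-th power is at
  most the identity, and they add up to 1.\<close>

lemma powr_superadditive:
  fixes x y p :: real
  assumes "0 \<le> x" "0 \<le> y" "1 \<le> p"
  shows "x powr p + y powr p \<le> (x + y) powr p"
proof (cases "x + y = 0")
  case False
  have *: "z powr p \<le> z / (x + y) * (x + y) powr p" if "0 \<le> z" "z \<le> x + y" for z
  proof -
    have "z powr p = (z / (x + y)) powr p * (x + y) powr p"
      using False by (simp flip: powr_mult)
    also have "\<dots> \<le> (z / (x + y)) powr 1 * (x + y) powr p"
      using that assms False by (intro mult_right_mono powr_mono') (auto simp: field_simps)
    finally show ?thesis using that assms by simp
  qed
  have "x powr p + y powr p \<le> (x / (x + y) + y / (x + y)) * (x + y) powr p"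
    using *[of x] *[of y] assms by (simp add: distrib_right)
  also have "x / (x + y) + y / (x + y) = 1" using False by (simp flip: add_divide_distrib)
  finally show ?thesis by simp
qed (use assms in \<open>simp add: add_nonneg_eq_0_iff\<close>)

text \<open>Superadditivity applied to the smaller number and the difference. It bounds the p-th
  power of the variation of \<open>k powr (1/p)\<close> by the variation of \<open>k\<close> itself,
  so one density serves all exponents.\<close>

lemma powr_diff_le:
  fixes x y p :: real
  assumes "0 \<le> x" "0 \<le> y" "1 \<le> p"
  shows "\<bar>x - y\<bar> powr p \<le> \<bar>x powr p - y powr p\<bar>"
  using powr_superadditive[of "x - y" y p] powr_superadditive[of "y - x" x p] assms
  by (cases "x \<le> y") (auto simp: abs_if)

text \<open>The graph of the p-th power lies above its tangent at \<open>b\<close>. It is obtained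
  from Young's inequality; p = 1 is split off because the conjugate exponent would be
  infinite.\<close>

lemma powr_tangent:
  fixes x b p :: real
  assumes "0 \<le> x" "0 \<le> b" "1 \<le> p"
  shows "p * b powr (p - 1) * x \<le> x powr p + (p - 1) * b powr p"
proof (cases "p = 1")
  case False
  then have p: "p > 1" using assms by simp
  define q where "q = p / (p - 1)"
  have q: "q > 1" "1 / p + 1 / q = 1" "(p - 1) * q = p"
    using p by (auto simp: q_def field_simps)
  have "x * b powr (p - 1) \<le> x powr p / p + (b powr (p - 1)) powr q / q"
    using p q assms by (intro Youngs_inequality) auto
  also have "(b powr (p - 1)) powr q = b powr p" by (simp add: powr_powr q)
  also have "b powr p / q = b powr p * (p - 1) / p" by (simp add: q_def)
  finally show ?thesis using p by (simp add: field_simps)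
qed (use assms in auto)

text \<open>Jensen's inequality: integrate the tangent inequality taken at the mean \<open>b\<close>
  of the absolute value. An infinite right-hand side is allowed.\<close>

lemma (in prob_space) pw_integral_le:
  assumes "integrable M X" "1 \<le> p"
  shows "pw p (\<integral>x. X x \<partial>M) \<le> (\<integral>\<^sup>+x. pw p (X x) \<partial>M)"
proof (cases "(\<integral>\<^sup>+x. pw p (X x) \<partial>M) < \<infinity>")
  case True
  then have int: "integrable M (\<lambda>x. \<bar>X x\<bar> powr p)"
    using assms by (intro integrableI_bounded) (auto simp: pw_def)
  define b where "b = (\<integral>x. \<bar>X x\<bar> \<partial>M)"
  have "b \<ge> 0" by (simp add: b_def)
  have "(\<integral>x. p * b powr (p - 1) * \<bar>X x\<bar> \<partial>M) \<le> (\<integral>x. \<bar>X x\<bar> powr p + (p - 1) * b powr p \<partial>M)"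
    using assms int \<open>b \<ge> 0\<close> by (intro integral_mono powr_tangent) auto
  also have "\<dots> = (\<integral>x. \<bar>X x\<bar> powr p \<partial>M) + (p - 1) * b powr p"
    using int by (simp add: prob_space)
  also have "(\<integral>x. p * b powr (p - 1) * \<bar>X x\<bar> \<partial>M) = p * b powr (p - 1) * b"
    by (simp add: b_def)
  also have "\<dots> = p * b powr p" using \<open>b \<ge> 0\<close> by (cases "b = 0") (auto simp: powr_diff)
  finally have "b powr p \<le> (\<integral>x. \<bar>X x\<bar> powr p \<partial>M)" by (simp add: algebra_simps)
  then have "pw p b \<le> (\<integral>\<^sup>+x. pw p (X x) \<partial>M)"
    unfolding pw_def using \<open>b \<ge> 0\<close> int by (subst nn_integral_eq_integral) (auto intro: ennreal_leI)
  moreover have "pw p (\<integral>x. X x \<partial>M) \<le> pw p b"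
    using assms by (intro pw_mono) (auto simp: b_def integral_abs_bound)
  ultimately show ?thesis by simp
qed (simp add: not_less top_unique)

section \<open>Local averages\<close>

context smoothing
begin

sublocale nu: prob_space \<nu> by (rule prob)

sublocale mu_nu: pair_sigma_finite \<mu> \<nu> ..

lemma space_nu [simp]: "space \<nu> = UNIV"
  using sets_eq_imp_space_eq[OF sets_nu] by simp

text \<open>Averages are real-valued because differences of them are taken. The integral is 0 where
  the shifted function is not integrable, hence the integrability assumptions on \<open>f\<close>
  below.\<close>

definition avg :: "('g \<Rightarrow> real) \<Rightarrow> 'g \<Rightarrow> real" where
  "avg f g = (\<integral>s. f (g + s) \<partial>\<nu>)"

lemma avg_measurable [measurable (raw)]:
  assumes [measurable]: "f \<in> borel_measurable borel"
  shows "avg f \<in> borel_measurable borel"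
  unfolding avg_def by measurable

lemma nn_integral_avg:
  assumes [measurable]: "F \<in> borel_measurable borel"
  shows "(\<integral>\<^sup>+g. \<integral>\<^sup>+s. F (g + s) \<partial>\<nu> \<partial>\<mu>) = (\<integral>\<^sup>+g. F g \<partial>\<mu>)"
proof -
  have "(\<integral>\<^sup>+g. \<integral>\<^sup>+s. F (g + s) \<partial>\<nu> \<partial>\<mu>) = (\<integral>\<^sup>+s. \<integral>\<^sup>+g. F (g + s) \<partial>\<mu> \<partial>\<nu>)"
    by (rule mu_nu.Fubini'[symmetric]) measurable
  also have "\<dots> = (\<integral>\<^sup>+g. F g \<partial>\<mu>)" by (simp add: nn_integral_right nu.emeasure_space_1[simplified])
  finally show ?thesis .
qed

text \<open>An absolute value is at most 1 plus its p-th power, and \<open>dominated\<close> bounds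
  the integral of the latter for every base point \<open>g\<close>, not only almost every
  one.\<close>

lemma integrable_shift:
  assumes [measurable]: "f \<in> borel_measurable borel"
    and fin: "(\<integral>\<^sup>+x. pw p (f x) \<partial>\<mu>) < \<infinity>" and p: "1 \<le> p"
  shows "integrable \<nu> (\<lambda>s. f (g + s))"
proof (rule integrableI_bounded)
  have "ennreal (norm (f (g + s))) \<le> 1 + pw p (f (g + s))" for s
  proof (cases "\<bar>f (g + s)\<bar> \<le> 1")
    case False
    then have "\<bar>f (g + s)\<bar> powr 1 \<le> \<bar>f (g + s)\<bar> powr p" using p by (intro powr_mono) auto
    then have "ennreal (norm (f (g + s))) \<le> pw p (f (g + s))" by (auto simp: pw_def intro: ennreal_leI)
    then show ?thesis by (rule order_trans) simp
  qed (auto intro: add_increasing2 simp: ennreal_le_1)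
  then have "(\<integral>\<^sup>+s. ennreal (norm (f (g + s))) \<partial>\<nu>) \<le> (\<integral>\<^sup>+s. 1 + pw p (f (g + s)) \<partial>\<nu>)"
    by (intro nn_integral_mono)
  also have "\<dots> = 1 + (\<integral>\<^sup>+s. pw p (f (g + s)) \<partial>\<nu>)"
    by (subst nn_integral_add) (auto simp: nu.emeasure_space_1[simplified])
  also have "\<dots> \<le> 1 + ennreal c * (\<integral>\<^sup>+s. pw p (f s) \<partial>\<mu>)"
    by (intro add_left_mono dominated) measurable
  also have "\<dots> < \<infinity>" using fin by (auto simp: ennreal_mult_less_top)
  finally show "(\<integral>\<^sup>+s. ennreal (norm (f (g + s))) \<partial>\<nu>) < \<infinity>" .
qed measurable

text \<open>A constant may be subtracted before the quasi-invariance of the kernel is used; this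
  bounds the oscillation of the averages by a local mean deviation.\<close>

lemma avg_oscillation:
  assumes [measurable]: "f \<in> borel_measurable borel"
    and int: "\<And>g. integrable \<nu> (\<lambda>s. f (g + s))"
  shows "\<bar>avg f (g + x) - avg f g\<bar> \<le> exp (a * len x) * (\<integral>s. \<bar>f (g + s) - avg f g\<bar> \<partial>\<nu>)"
proof -
  let ?c = "avg f g"
  have "avg f (g + x) - ?c = (\<integral>s. f (g + (x + s)) - ?c \<partial>\<nu>)"
    using int[of "g + x"] by (simp add: avg_def add.assoc nu.prob_space[simplified])
  then have "ennreal \<bar>avg f (g + x) - ?c\<bar> \<le> (\<integral>\<^sup>+s. ennreal \<bar>f (g + (x + s)) - ?c\<bar> \<partial>\<nu>)"
    using integral_norm_bound_ennreal[of \<nu> "\<lambda>s. f (g + (x + s)) - ?c"] int[of "g + x"]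
    by (simp add: add.assoc)
  also have "\<dots> \<le> ennreal (exp (a * len x)) * (\<integral>\<^sup>+s. ennreal \<bar>f (g + s) - ?c\<bar> \<partial>\<nu>)"
    by (rule quasi_invariant) measurable
  also have "(\<integral>\<^sup>+s. ennreal \<bar>f (g + s) - ?c\<bar> \<partial>\<nu>) = ennreal (\<integral>s. \<bar>f (g + s) - ?c\<bar> \<partial>\<nu>)"
    using int by (intro nn_integral_eq_integral) auto
  finally show ?thesis by (simp flip: ennreal_mult)
qed

text \<open>Both points are averaged, so the value of \<open>f\<close> at \<open>g\<close> itself
  does not occur. This is what makes the quantity comparable at neighbouring base points.\<close>

definition spread :: "real \<Rightarrow> ('g \<Rightarrow> real) \<Rightarrow> 'g \<Rightarrow> ennreal" where
  "spread p f g = (\<integral>\<^sup>+s. \<integral>\<^sup>+s'. pw p (f (g + s) - f (g + s')) \<partial>\<nu> \<partial>\<nu>)"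

lemma pw_avg_oscillation:
  assumes [measurable]: "f \<in> borel_measurable borel"
    and int: "\<And>g. integrable \<nu> (\<lambda>s. f (g + s))" and p: "1 \<le> p"
  shows "pw p (avg f g - avg f (g + x)) \<le> pw p (exp (a * len x)) * spread p f g"
proof -
  let ?J = "\<integral>s. \<bar>f (g + s) - avg f g\<bar> \<partial>\<nu>"
  have "pw p (avg f g - avg f (g + x)) \<le> pw p (exp (a * len x) * ?J)"
    using avg_oscillation[OF assms(1) int, of g x] p
    by (intro pw_mono) (auto simp: abs_minus_commute abs_mult)
  also have "\<dots> = pw p (exp (a * len x)) * pw p ?J" by (rule pw_mult)
  also have "pw p ?J \<le> (\<integral>\<^sup>+s. pw p \<bar>f (g + s) - avg f g\<bar> \<partial>\<nu>)"
    using int p by (intro nu.pw_integral_le) auto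
  also have "\<dots> \<le> spread p f g"
    unfolding spread_def
  proof (intro nn_integral_mono)
    fix s
    have "f (g + s) - avg f g = (\<integral>s'. f (g + s) - f (g + s') \<partial>\<nu>)"
      using int by (simp add: avg_def nu.prob_space[simplified])
    then show "pw p \<bar>f (g + s) - avg f g\<bar> \<le> (\<integral>\<^sup>+s'. pw p (f (g + s) - f (g + s')) \<partial>\<nu>)"
      using nu.pw_integral_le[of "\<lambda>s'. f (g + s) - f (g + s')" p] int p by (simp add: pw_def)
  qed
  finally show ?thesis by (simp add: mult_left_mono)
qed

text \<open>Quasi-invariance is applied once in each of the two variables, hence the doubled
  rate.\<close>

lemma spread_shift:
  assumes [measurable]: "f \<in> borel_measurable borel"
  shows "spread p f (g + x) \<le> ennreal (exp (2 * a * len x)) * spread p f g"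
proof -
  let ?e = "ennreal (exp (a * len x))"
  have "spread p f (g + x) = (\<integral>\<^sup>+s. \<integral>\<^sup>+s'. pw p (f (g + (x + s)) - f (g + (x + s'))) \<partial>\<nu> \<partial>\<nu>)"
    by (simp add: spread_def add.assoc)
  also have "\<dots> \<le> (\<integral>\<^sup>+s. ?e * (\<integral>\<^sup>+s'. pw p (f (g + (x + s)) - f (g + s')) \<partial>\<nu>) \<partial>\<nu>)"
    by (intro nn_integral_mono quasi_invariant) measurable
  also have "\<dots> = ?e * (\<integral>\<^sup>+s. \<integral>\<^sup>+s'. pw p (f (g + (x + s)) - f (g + s')) \<partial>\<nu> \<partial>\<nu>)"
    by (rule nn_integral_cmult) measurable
  also have "\<dots> \<le> ?e * (?e * spread p f g)"
    using quasi_invariant[of "\<lambda>s. \<integral>\<^sup>+s'. pw p (f (g + s) - f (g + s')) \<partial>\<nu>" x]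
    by (intro mult_left_mono) (auto simp: spread_def)
  also have "\<dots> = ennreal (exp (2 * a * len x)) * spread p f g"
    by (simp add: mult.assoc[symmetric] flip: ennreal_mult exp_add)
  finally show ?thesis .
qed

text \<open>By Fubini its integral over the group is the \<nu>-average of the p-th powers of the
  gradients in all directions \<open>s\<close>. In this form the gradient of \<open>f\<close> enters
  the pointwise estimates.\<close>

definition deviation :: "real \<Rightarrow> ('g \<Rightarrow> real) \<Rightarrow> 'g \<Rightarrow> ennreal" where
  "deviation p f g = (\<integral>\<^sup>+s. pw p (f g - f (g + s)) \<partial>\<nu>)"

lemma deviation_measurable [measurable (raw)]:
  assumes [measurable]: "f \<in> borel_measurable borel"
  shows "deviation p f \<in> borel_measurable borel"
  unfolding deviation_def by measurable

lemma spread_le_deviation: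
  assumes [measurable]: "f \<in> borel_measurable borel" and p: "1 \<le> p"
  shows "spread p f g \<le> ennreal (2 * 2 powr p) * deviation p f g"
proof -
  have "spread p f g \<le> (\<integral>\<^sup>+s. \<integral>\<^sup>+s'. ennreal (2 powr p) * (pw p (f g - f (g + s)) + pw p (f g - f (g + s'))) \<partial>\<nu> \<partial>\<nu>)"
    unfolding spread_def
  proof (intro nn_integral_mono)
    fix s s'
    show "pw p (f (g + s) - f (g + s')) \<le> ennreal (2 powr p) * (pw p (f g - f (g + s)) + pw p (f g - f (g + s')))"
      using pw_add_le[of p "f (g + s) - f g" "f g - f (g + s')"] p by (simp add: pw_minus[of p "f g" "f (g + s)"])
  qed
  also have "\<dots> = ennreal (2 powr p) * (deviation p f g + deviation p f g)"
    by (simp add: nn_integral_cmult nn_integral_add deviation_def nu.emeasure_space_1[simplified])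
  also have "\<dots> = ennreal (2 * 2 powr p) * deviation p f g"
    by (simp add: ennreal_mult mult_ac flip: mult_2)
  finally show ?thesis .
qed

lemma pw_avg_diff:
  assumes [measurable]: "f \<in> borel_measurable borel"
    and int: "\<And>g. integrable \<nu> (\<lambda>s. f (g + s))" and p: "1 \<le> p"
  shows "pw p (f g - avg f g) \<le> deviation p f g"
proof -
  have "f g - avg f g = (\<integral>s. f g - f (g + s) \<partial>\<nu>)"
    using int by (simp add: avg_def nu.prob_space[simplified])
  then show ?thesis
    unfolding deviation_def using nu.pw_integral_le[of "\<lambda>s. f g - f (g + s)" p] int p by simp
qed

end

section \<open>Growth of gradients along words\<close>

context haar_group
begin

text \<open>Telescoping along the word; right invariance moves each increment back to the base
  point. Each letter costs 2^p from the inequality for sums and 2 for the number of summands.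
  Exponential growth is harmless because the kernel has exponential moments.\<close>

lemma gradient_word:
  assumes [measurable]: "f \<in> borel_measurable borel" and p: "0 \<le> p" and \<gamma>: "0 \<le> \<gamma>"
    and grad: "\<And>t. t \<in> S \<Longrightarrow> (\<integral>\<^sup>+g. pw p (f g - f (g + t)) \<partial>\<mu>) \<le> ennreal \<gamma>"
  shows "set xs \<subseteq> S \<Longrightarrow> (\<integral>\<^sup>+g. pw p (f g - f (g + sum_list xs)) \<partial>\<mu>) \<le> ennreal ((2 * 2 powr p) ^ length xs * \<gamma>)"
proof (induction xs)
  case (Cons t xs)
  let ?y = "sum_list xs"
  let ?K = "2 powr p"
  have K1: "1 \<le> 2 * ?K" using p ge_one_powr_ge_zero[of 2 p] by simp
  have "(\<integral>\<^sup>+g. pw p (f g - f (g + (t + ?y))) \<partial>\<mu>)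
      \<le> (\<integral>\<^sup>+g. ennreal ?K * (pw p (f g - f (g + t)) + pw p (f (g + t) - f (g + t + ?y))) \<partial>\<mu>)"
  proof (intro nn_integral_mono)
    fix g
    show "pw p (f g - f (g + (t + ?y))) \<le> ennreal ?K * (pw p (f g - f (g + t)) + pw p (f (g + t) - f (g + t + ?y)))"
      using pw_add_le[OF p, of "f g - f (g + t)" "f (g + t) - f (g + t + ?y)"] by (simp add: add.assoc)
  qed
  also have "\<dots> = ennreal ?K * ((\<integral>\<^sup>+g. pw p (f g - f (g + t)) \<partial>\<mu>) + (\<integral>\<^sup>+g. pw p (f (g + t) - f (g + t + ?y)) \<partial>\<mu>))"
    by (simp add: nn_integral_cmult nn_integral_add)
  also have "(\<integral>\<^sup>+g. pw p (f (g + t) - f (g + t + ?y)) \<partial>\<mu>) = (\<integral>\<^sup>+g. pw p (f g - f (g + ?y)) \<partial>\<mu>)"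
    by (rule nn_integral_right[of "\<lambda>g. pw p (f g - f (g + ?y))"]) measurable
  also have "ennreal ?K * ((\<integral>\<^sup>+g. pw p (f g - f (g + t)) \<partial>\<mu>) + (\<integral>\<^sup>+g. pw p (f g - f (g + ?y)) \<partial>\<mu>))
      \<le> ennreal ?K * (ennreal \<gamma> + ennreal ((2 * ?K) ^ length xs * \<gamma>))"
    using Cons grad by (intro mult_left_mono add_mono) auto
  also have "\<dots> = ennreal (?K * (\<gamma> + (2 * ?K) ^ length xs * \<gamma>))"
    using \<gamma> by (subst ennreal_mult) auto
  also have "\<dots> \<le> ennreal ((2 * ?K) ^ length (t # xs) * \<gamma>)"
  proof (rule ennreal_leI)
    have "\<gamma> \<le> (2 * ?K) ^ length xs * \<gamma>"
      using mult_right_mono[OF one_le_power[OF K1, of "length xs"] \<gamma>] by (simp only: mult_1_left)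
    then have "\<gamma> + (2 * ?K) ^ length xs * \<gamma> \<le> 2 * ((2 * ?K) ^ length xs * \<gamma>)" by linarith
    then have "?K * (\<gamma> + (2 * ?K) ^ length xs * \<gamma>) \<le> ?K * (2 * ((2 * ?K) ^ length xs * \<gamma>))"
      by (rule mult_left_mono) simp
    then show "?K * (\<gamma> + (2 * ?K) ^ length xs * \<gamma>) \<le> (2 * ?K) ^ length (t # xs) * \<gamma>" by simp
  qed
  finally show ?case by simp
qed simp

text \<open>Word length is bounded by \<open>len\<close>, so a power of the cost per letter becomes
  an exponential of \<open>len\<close>. The rate \<open>b\<close> does not depend on
  \<open>f\<close>, so the kernel can be chosen before \<open>f\<close>.\<close>

lemma gradient_exp_growth:
  assumes p: "1 \<le> p"
  obtains C b where "0 \<le> C" "0 \<le> b"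
    "\<And>f \<gamma> s. f \<in> borel_measurable borel \<Longrightarrow> 0 \<le> \<gamma> \<Longrightarrow>
       (\<And>t. t \<in> S \<Longrightarrow> (\<integral>\<^sup>+g. pw p (f g - f (g + t)) \<partial>\<mu>) \<le> ennreal \<gamma>) \<Longrightarrow>
       (\<integral>\<^sup>+g. pw p (f g - f (g + s)) \<partial>\<mu>) \<le> ennreal (C * \<gamma>) * ennreal (exp (b * len s))"
proof -
  obtain \<alpha> \<beta> where ab: "\<alpha> \<ge> 1" "\<beta> \<ge> 0" "\<And>x. real (word_length S x) \<le> \<alpha> * (len x + \<beta>)"
    using word_length_bounds by metis
  define K where "K = 2 * 2 powr p"
  have K: "K \<ge> 1" using p ge_one_powr_ge_zero[of 2 p] by (simp add: K_def)
  define b where "b = ln K * \<alpha>"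
  show thesis
  proof (rule that[of "exp (b * \<beta>)" b])
    fix f :: "'g \<Rightarrow> real" and \<gamma> s
    assume f: "f \<in> borel_measurable borel" and \<gamma>: "0 \<le> \<gamma>"
      and grad: "\<And>t. t \<in> S \<Longrightarrow> (\<integral>\<^sup>+g. pw p (f g - f (g + t)) \<partial>\<mu>) \<le> ennreal \<gamma>"
    obtain xs where xs: "length xs = word_length S s" "set xs \<subseteq> S" "sum_list xs = s"
      using word_length_witness by blast
    have "(\<integral>\<^sup>+g. pw p (f g - f (g + s)) \<partial>\<mu>) \<le> ennreal (K ^ length xs * \<gamma>)"
      using gradient_word[OF f _ \<gamma> grad xs(2)] p xs(3) by (simp add: K_def)
    also have "K ^ length xs = exp (ln K * real (word_length S s))"
      using K by (simp add: xs exp_of_nat2_mult)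
    also have "\<dots> \<le> exp (b * \<beta>) * exp (b * len s)"
    proof -
      have "ln K * real (word_length S s) \<le> ln K * (\<alpha> * (len s + \<beta>))"
        using ab(3) K by (intro mult_left_mono) auto
      then show ?thesis by (simp add: b_def algebra_simps flip: exp_add)
    qed
    finally show "(\<integral>\<^sup>+g. pw p (f g - f (g + s)) \<partial>\<mu>) \<le> ennreal (exp (b * \<beta>) * \<gamma>) * ennreal (exp (b * len s))"
      using \<gamma> by (simp add: ennreal_leI mult_right_mono mult_ac flip: ennreal_mult)
  qed (use K ab in \<open>auto simp: b_def\<close>)
qed

end

section \<open>Cutting off averages where the support is sparse\<close>

context smoothing
begin

definition weight :: "'g set \<Rightarrow> 'g \<Rightarrow> ennreal" where
  "weight A g = (\<integral>\<^sup>+s. indicator A (g + s) \<partial>\<nu>)"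

lemma weight_measurable [measurable]:
  assumes [measurable]: "A \<in> sets borel"
  shows "weight A \<in> borel_measurable borel"
  unfolding weight_def by measurable

text \<open>Seen from \<open>g + x\<close>, the point \<open>g\<close> is a shift by
  \<open>- x\<close>. The inequality serves as a lower bound for the weight at nearby
  points.\<close>

lemma weight_shift:
  assumes [measurable]: "A \<in> sets borel"
  shows "weight A g \<le> ennreal (exp (a * len x)) * weight A (g + x)"
proof -
  have "weight A g = (\<integral>\<^sup>+s. indicator A (g + x + (- x + s)) \<partial>\<nu>)"
    by (simp add: weight_def add.assoc flip: add.assoc[of x])
  also have "\<dots> \<le> ennreal (exp (a * len (- x))) * weight A (g + x)"
    unfolding weight_def by (rule quasi_invariant[of "\<lambda>s. indicator A (g + x + s)"]) measurable
  finally show ?thesis by simp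
qed

text \<open>With probability at least 1/2 the second sample of \<open>spread\<close> falls outside
  \<open>A\<close>, where \<open>f\<close> vanishes; the difference is then the first value of
  \<open>f\<close> alone, and Jensen's inequality applies to the average.\<close>

lemma avg_le_spread:
  assumes [measurable]: "f \<in> borel_measurable borel" "A \<in> sets borel"
    and int: "\<And>g. integrable \<nu> (\<lambda>s. f (g + s))" and p: "1 \<le> p"
    and supp: "\<And>x. x \<notin> A \<Longrightarrow> f x = 0" and small: "\<not> 1 \<le> 2 * weight A g"
  shows "pw p (avg f g) \<le> 2 * spread p f g"
proof -
  let ?q = "\<integral>\<^sup>+s. indicator (- A) (g + s) \<partial>\<nu>"
  have [measurable]: "- A \<in> sets borel" using assms(2) by auto
  have "weight A g + ?q = (\<integral>\<^sup>+s. indicator A (g + s) + indicator (- A) (g + s) \<partial>\<nu>)"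
    unfolding weight_def by (subst nn_integral_add) auto
  also have "\<dots> = (\<integral>\<^sup>+s. 1 \<partial>\<nu>)" by (intro nn_integral_cong) (auto split: split_indicator)
  finally have sum: "weight A g + ?q = 1" by (simp add: nu.emeasure_space_1[simplified])
  have q: "1 \<le> 2 * ?q"
  proof (rule ccontr)
    assume "\<not> 1 \<le> 2 * ?q"
    then have "2 * weight A g + 2 * ?q < 1 + 1" using small by (intro add_strict_mono) auto
    then show False using sum by (simp flip: distrib_left)
  qed
  have "(\<integral>\<^sup>+s. pw p (f (g + s)) \<partial>\<nu>) * ?q = (\<integral>\<^sup>+s. \<integral>\<^sup>+s'. pw p (f (g + s)) * indicator (- A) (g + s') \<partial>\<nu> \<partial>\<nu>)"
    by (simp add: nn_integral_cmult nn_integral_multc)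
  also have "\<dots> \<le> spread p f g"
    unfolding spread_def by (intro nn_integral_mono) (auto split: split_indicator simp: supp)
  finally have le: "(\<integral>\<^sup>+s. pw p (f (g + s)) \<partial>\<nu>) * ?q \<le> spread p f g" .
  have "pw p (avg f g) \<le> (\<integral>\<^sup>+s. pw p (f (g + s)) \<partial>\<nu>) * 1"
    unfolding avg_def using nu.pw_integral_le[of "\<lambda>s. f (g + s)" p] int p by simp
  also have "\<dots> \<le> (\<integral>\<^sup>+s. pw p (f (g + s)) \<partial>\<nu>) * (2 * ?q)" by (intro mult_left_mono q) auto
  also have "\<dots> \<le> 2 * spread p f g" using mult_left_mono[OF le, of 2] by (simp add: mult_ac)
  finally show ?thesis .
qed

text \<open>\<open>u\<close> is the average of \<open>f\<close> where \<open>A\<close> has weight at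
  least 1/2, and 0 elsewhere. The jump at the cut-off is no worse than the oscillation of the
  average, since the average is already bounded by the spread where it is discarded. Without the
  cut-off the support would be the whole group, because \<nu> has full support.\<close>

lemma truncation:
  assumes p: "1 \<le> p" and R: "0 \<le> R"
  obtains K where "0 \<le> K"
    "\<And>f A. f \<in> borel_measurable borel \<Longrightarrow> A \<in> sets borel \<Longrightarrow> (\<integral>\<^sup>+x. pw p (f x) \<partial>\<mu>) < \<infinity> \<Longrightarrow>
      (\<And>x. x \<notin> A \<Longrightarrow> f x = 0) \<Longrightarrow>
      \<exists>u A'. u \<in> borel_measurable borel \<and> A' \<in> sets borel \<and>
        (\<forall>g x. len x \<le> R \<longrightarrow> pw p (u g - u (g + x)) \<le> ennreal K * deviation p f g) \<and>
        (\<integral>\<^sup>+x. pw p (f x) \<partial>\<mu>) \<le> ennreal K * ((\<integral>\<^sup>+x. pw p (u x) \<partial>\<mu>) + (\<integral>\<^sup>+x. deviation p f x \<partial>\<mu>)) \<and>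
        (\<integral>\<^sup>+x. pw p (u x) \<partial>\<mu>) \<le> (\<integral>\<^sup>+x. pw p (f x) \<partial>\<mu>) \<and>
        (\<forall>g x. u g \<noteq> 0 \<longrightarrow> len x \<le> R \<longrightarrow> g + x \<in> A') \<and>
        emeasure \<mu> A' \<le> ennreal K * emeasure \<mu> A"
proof -
  define c2 where "c2 = 2 powr p"
  define E where "E = exp (a * R)"
  define K1 where "K1 = c2 * (E powr p + 2 * E\<^sup>2)"
  \<comment> \<open>The summands are the constants for the gradient, for the deviation and for
    \<open>u\<close> in the norm estimate, and for the measure of \<open>A'\<close>.\<close>
  define K where "K = K1 * (2 * c2) + (c2 + c2 * c2 * (4 * c2)) + c2 * c2 + 2 * E"
  have nn: "c2 \<ge> 1" "E \<ge> 1" using p R a_nonneg ge_one_powr_ge_zero[of 2 p] by (auto simp: c2_def E_def)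
  have nn': "K1 \<ge> 0" using nn by (simp add: K1_def)
  show thesis
  proof (rule that[of K])
    show "0 \<le> K" using nn nn' by (simp add: K_def)
    fix f :: "'g \<Rightarrow> real" and A
    assume [measurable]: "f \<in> borel_measurable borel" "A \<in> sets borel"
      and fin: "(\<integral>\<^sup>+x. pw p (f x) \<partial>\<mu>) < \<infinity>" and supp: "\<And>x. x \<notin> A \<Longrightarrow> f x = 0"
    have int: "integrable \<nu> (\<lambda>s. f (g + s))" for g by (rule integrable_shift[OF _ fin p]) measurable
    define u where "u g = (if 1 \<le> 2 * weight A g then avg f g else 0)" for g
    \<comment> \<open>Moving by at most \<open>R\<close> changes weights by at most the factor
      \<open>E\<close>, so the threshold 1/2 is lowered to 1/(2E).\<close>
    define A' where "A' = {g \<in> UNIV. 1 \<le> ennreal (2 * E) * weight A g}"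
    have [measurable]: "u \<in> borel_measurable borel" unfolding u_def by measurable
    have Em [measurable]: "A' \<in> sets borel" unfolding A'_def by measurable
    have El: "exp (a * len x) \<le> E" if "len x \<le> R" for x
      using that a_nonneg by (auto simp: E_def intro: mult_left_mono)
    have osc: "pw p (u g - u (g + x)) \<le> ennreal K1 * spread p f g" if x: "len x \<le> R" for g x
    proof -
      let ?V = "spread p f g"
      have 1: "pw p (avg f g - avg f (g + x)) \<le> ennreal (E powr p) * ?V"
      proof -
        have "pw p (exp (a * len x)) \<le> ennreal (E powr p)"
          unfolding pw_def using El[OF x] p by (intro ennreal_leI powr_mono2) auto
        then show ?thesis
          using pw_avg_oscillation[OF _ int p, of g x] by (meson \<open>f \<in> borel_measurable borel\<close> mult_right_mono order_trans zero_le)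
      qed
      have 2: "2 * spread p f (g + x) \<le> ennreal (2 * E\<^sup>2) * ?V"
      proof -
        have "exp (2 * a * len x) = (exp (a * len x))\<^sup>2" by (simp add: power2_eq_square flip: exp_add)
        also have "\<dots> \<le> E\<^sup>2" using El[OF x] by (intro power_mono) auto
        finally have "spread p f (g + x) \<le> ennreal (E\<^sup>2) * ?V"
          using spread_shift[of f p g x] by (meson \<open>f \<in> borel_measurable borel\<close> ennreal_leI mult_right_mono order_trans zero_le)
        then have "2 * spread p f (g + x) \<le> 2 * (ennreal (E\<^sup>2) * ?V)" by (intro mult_left_mono) auto
        then show ?thesis by (simp add: ennreal_mult mult.assoc)
      qed
      have 3: "2 * ?V \<le> ennreal (2 * E\<^sup>2) * ?V"
        using one_le_power[OF nn(2), of 2] ennreal_leI[of 2 "2 * E\<^sup>2"] by (intro mult_right_mono) auto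
      \<comment> \<open>Common form of the cases: \<open>w\<close> is the jump of \<open>u\<close>,
        and \<open>z\<close> pays for an average discarded at one of the two points.\<close>
      have comb: "pw p w \<le> ennreal K1 * ?V"
        if "pw p w \<le> ennreal c2 * (pw p (avg f g - avg f (g + x)) + z)" "z \<le> ennreal (2 * E\<^sup>2) * ?V" for w z
      proof -
        have "pw p w \<le> ennreal c2 * (ennreal (E powr p) * ?V + ennreal (2 * E\<^sup>2) * ?V)"
          by (rule order_trans[OF that(1)]) (intro mult_left_mono add_mono that 1, auto)
        also have "\<dots> = ennreal K1 * ?V"
          unfolding K1_def using nn by (subst ennreal_mult) (auto simp: ennreal_plus distrib_right mult.assoc)
        finally show ?thesis .
      qed
      have zero: "pw p (avg f z) \<le> 2 * spread p f z" if "\<not> 1 \<le> 2 * weight A z" for z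
        by (rule avg_le_spread[OF _ _ int p supp that]) auto
      show ?thesis
      proof (cases "1 \<le> 2 * weight A g"; cases "1 \<le> 2 * weight A (g + x)")
        assume "1 \<le> 2 * weight A g" "1 \<le> 2 * weight A (g + x)"
        then show ?thesis
          using comb[of "avg f g - avg f (g + x)" 0] pw_add_le[of p "avg f g - avg f (g + x)" 0] p
          by (simp add: u_def c2_def)
      next
        assume *: "1 \<le> 2 * weight A g" "\<not> 1 \<le> 2 * weight A (g + x)"
        then show ?thesis
          using comb[of "avg f g" "pw p (avg f (g + x))"] zero[OF *(2)] 2
            pw_add_le[of p "avg f g - avg f (g + x)" "avg f (g + x)"] p
          by (auto simp: u_def c2_def)
      next
        assume *: "\<not> 1 \<le> 2 * weight A g" "1 \<le> 2 * weight A (g + x)"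
        then show ?thesis
          using comb[of "- avg f (g + x)" "pw p (- avg f g)"] zero[OF *(1)] 3
            pw_add_le[of p "avg f g - avg f (g + x)" "- avg f g"] p
          by (auto simp: u_def c2_def) (simp add: pw_def)
      qed (simp add: u_def)
    qed
    have sd: "spread p f g \<le> ennreal (2 * c2) * deviation p f g" for g
      unfolding c2_def by (rule spread_le_deviation) (use p in auto)
    have "pw p (u g - u (g + x)) \<le> ennreal K * deviation p f g" if x: "len x \<le> R" for g x
    proof -
      have "pw p (u g - u (g + x)) \<le> ennreal K1 * (ennreal (2 * c2) * deviation p f g)"
        by (rule order_trans[OF osc[OF x]]) (intro mult_left_mono sd, auto)
      also have "\<dots> = ennreal (K1 * (2 * c2)) * deviation p f g"
        using nn nn' by (simp add: ennreal_mult mult.assoc)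
      also have "\<dots> \<le> ennreal K * deviation p f g"
        using nn nn' by (intro mult_right_mono ennreal_leI) (auto simp: K_def)
      finally show ?thesis .
    qed
    moreover have "(\<integral>\<^sup>+x. pw p (f x) \<partial>\<mu>) \<le> ennreal K * ((\<integral>\<^sup>+x. pw p (u x) \<partial>\<mu>) + (\<integral>\<^sup>+x. deviation p f x \<partial>\<mu>))"
    proof -
      have "pw p (f g) \<le> ennreal K * (pw p (u g) + deviation p f g)" for g
      proof -
        have "pw p (f g) \<le> ennreal c2 * (pw p (f g - avg f g) + pw p (avg f g))"
          unfolding c2_def using pw_add_le[of p "f g - avg f g" "avg f g"] p by simp
        also have "pw p (avg f g) \<le> ennreal c2 * (pw p (avg f g - u g) + pw p (u g))"
          unfolding c2_def using pw_add_le[of p "avg f g - u g" "u g"] p by simp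
        also have "pw p (avg f g - u g) \<le> 2 * spread p f g"
          using avg_le_spread[OF _ _ int p supp, of A g] by (auto simp: u_def)
        also have "\<dots> \<le> 2 * (ennreal (2 * c2) * deviation p f g)" by (intro mult_left_mono sd) auto
        also have "pw p (f g - avg f g) \<le> deviation p f g" by (rule pw_avg_diff[OF _ int p]) measurable
        finally have "pw p (f g) \<le> ennreal c2 * (deviation p f g
             + ennreal c2 * (2 * (ennreal (2 * c2) * deviation p f g) + pw p (u g)))"
          by (simp add: mult_left_mono add_mono)
        also have "\<dots> = ennreal (c2 + c2 * c2 * (4 * c2)) * deviation p f g + ennreal (c2 * c2) * pw p (u g)"
          using nn by (simp add: ennreal_plus ennreal_mult distrib_left distrib_right mult_ac)
        also have "\<dots> \<le> ennreal K * deviation p f g + ennreal K * pw p (u g)"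
          using nn nn' by (intro add_mono mult_right_mono ennreal_leI) (auto simp: K_def)
        finally show ?thesis by (simp add: distrib_left add.commute)
      qed
      then have "(\<integral>\<^sup>+x. pw p (f x) \<partial>\<mu>) \<le> (\<integral>\<^sup>+g. ennreal K * (pw p (u g) + deviation p f g) \<partial>\<mu>)"
        by (intro nn_integral_mono)
      then show ?thesis by (simp add: nn_integral_cmult nn_integral_add)
    qed
    moreover have "(\<integral>\<^sup>+x. pw p (u x) \<partial>\<mu>) \<le> (\<integral>\<^sup>+x. pw p (f x) \<partial>\<mu>)"
    proof -
      have "(\<integral>\<^sup>+x. pw p (u x) \<partial>\<mu>) \<le> (\<integral>\<^sup>+x. \<integral>\<^sup>+s. pw p (f (x + s)) \<partial>\<nu> \<partial>\<mu>)"
        using nu.pw_integral_le[OF int p] by (intro nn_integral_mono) (auto simp: u_def avg_def)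
      also have "\<dots> = (\<integral>\<^sup>+x. pw p (f x) \<partial>\<mu>)" by (rule nn_integral_avg) measurable
      finally show ?thesis .
    qed
    moreover have "g + x \<in> A'" if "u g \<noteq> 0" and x: "len x \<le> R" for g x
    proof -
      have "1 \<le> 2 * weight A g" using that by (auto simp: u_def split: if_splits)
      also have "weight A g \<le> ennreal (exp (a * len x)) * weight A (g + x)" by (rule weight_shift) measurable
      also have "\<dots> \<le> ennreal E * weight A (g + x)" using El[OF x] by (intro mult_right_mono ennreal_leI) auto
      finally have "1 \<le> 2 * (ennreal E * weight A (g + x))" by (simp add: mult_left_mono)
      then show ?thesis using nn by (simp add: A'_def ennreal_mult mult.assoc)
    qed
    moreover have "emeasure \<mu> A' \<le> ennreal K * emeasure \<mu> A"
    proof -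
      \<comment> \<open>Markov's inequality; the total weight equals the measure of \<open>A\<close>
        because averaging preserves integrals.\<close>
      have "emeasure \<mu> A' \<le> ennreal (2 * E) * (\<integral>\<^sup>+g. weight A g * indicator UNIV g \<partial>\<mu>)"
        unfolding A'_def by (rule nn_integral_Markov_inequality) auto
      also have "(\<integral>\<^sup>+g. weight A g * indicator UNIV g \<partial>\<mu>) = emeasure \<mu> A"
        unfolding weight_def using nn_integral_avg[of "indicator A"] by simp
      also have "ennreal (2 * E) * emeasure \<mu> A \<le> ennreal K * emeasure \<mu> A"
        using nn nn' by (intro mult_right_mono ennreal_leI) (auto simp: K_def)
      finally show ?thesis .
    qed
    ultimately show "\<exists>u A'. u \<in> borel_measurable borel \<and> A' \<in> sets borel \<and>
        (\<forall>g x. len x \<le> R \<longrightarrow> pw p (u g - u (g + x)) \<le> ennreal K * deviation p f g) \<and>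
        (\<integral>\<^sup>+x. pw p (f x) \<partial>\<mu>) \<le> ennreal K * ((\<integral>\<^sup>+x. pw p (u x) \<partial>\<mu>) + (\<integral>\<^sup>+x. deviation p f x \<partial>\<mu>)) \<and>
        (\<integral>\<^sup>+x. pw p (u x) \<partial>\<mu>) \<le> (\<integral>\<^sup>+x. pw p (f x) \<partial>\<mu>) \<and>
        (\<forall>g x. u g \<noteq> 0 \<longrightarrow> len x \<le> R \<longrightarrow> g + x \<in> A') \<and>
        emeasure \<mu> A' \<le> ennreal K * emeasure \<mu> A"
      using \<open>u \<in> borel_measurable borel\<close> Em by blast
  qed
qed

end

context haar_group
begin

text \<open>The order of choices matters: the growth rate of gradients fixes the moment demanded of
  the kernel, the kernel fixes the truncation constants, and only then does \<open>f\<close> appear.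
  One \<open>V\<close> bounds the increments for all \<open>x\<close> of length at most
  \<open>R\<close>.\<close>

lemma smooth_truncation:
  assumes p: "1 \<le> p" and R: "0 \<le> R"
  obtains K where "0 < K"
    "\<And>f A \<gamma>. f \<in> borel_measurable borel \<Longrightarrow> A \<in> sets borel \<Longrightarrow> (\<integral>\<^sup>+x. pw p (f x) \<partial>\<mu>) < \<infinity> \<Longrightarrow>
      (\<And>x. x \<notin> A \<Longrightarrow> f x = 0) \<Longrightarrow> 0 \<le> \<gamma> \<Longrightarrow>
      (\<And>t. t \<in> S \<Longrightarrow> (\<integral>\<^sup>+g. pw p (f g - f (g + t)) \<partial>\<mu>) \<le> ennreal \<gamma>) \<Longrightarrow>
      \<exists>u V A'. u \<in> borel_measurable borel \<and> V \<in> borel_measurable borel \<and> A' \<in> sets borel \<and>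
        (\<forall>g x. len x \<le> R \<longrightarrow> pw p (u g - u (g + x)) \<le> V g) \<and>
        (\<integral>\<^sup>+x. V x \<partial>\<mu>) \<le> ennreal (K * \<gamma>) \<and>
        (\<integral>\<^sup>+x. pw p (f x) \<partial>\<mu>) \<le> ennreal K * ((\<integral>\<^sup>+x. pw p (u x) \<partial>\<mu>) + ennreal \<gamma>) \<and>
        (\<integral>\<^sup>+x. pw p (u x) \<partial>\<mu>) \<le> (\<integral>\<^sup>+x. pw p (f x) \<partial>\<mu>) \<and>
        (\<forall>g x. u g \<noteq> 0 \<longrightarrow> len x \<le> R \<longrightarrow> g + x \<in> A') \<and>
        emeasure \<mu> A' \<le> ennreal K * emeasure \<mu> A"
proof -
  obtain C b where bC: "0 \<le> C" "0 \<le> b" and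
    growth: "\<And>f \<gamma> s. f \<in> borel_measurable borel \<Longrightarrow> 0 \<le> \<gamma> \<Longrightarrow>
       (\<And>t. t \<in> S \<Longrightarrow> (\<integral>\<^sup>+g. pw p (f g - f (g + t)) \<partial>\<mu>) \<le> ennreal \<gamma>) \<Longrightarrow>
       (\<integral>\<^sup>+g. pw p (f g - f (g + s)) \<partial>\<mu>) \<le> ennreal (C * \<gamma>) * ennreal (exp (b * len s))"
    by (rule gradient_exp_growth[OF p]) blast
  obtain \<nu> a c where sm: "smoothing S d \<mu> \<nu> a c" and mom: "(\<integral>\<^sup>+s. ennreal (exp (b * len s)) \<partial>\<nu>) < \<infinity>"
    by (rule ex_smoothing)
  interpret smoothing S d \<mu> \<nu> a c by (rule sm)
  obtain K where K: "0 \<le> K" and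
    trunc: "\<And>f A. f \<in> borel_measurable borel \<Longrightarrow> A \<in> sets borel \<Longrightarrow> (\<integral>\<^sup>+x. pw p (f x) \<partial>\<mu>) < \<infinity> \<Longrightarrow>
      (\<And>x. x \<notin> A \<Longrightarrow> f x = 0) \<Longrightarrow>
      \<exists>u A'. u \<in> borel_measurable borel \<and> A' \<in> sets borel \<and>
        (\<forall>g x. len x \<le> R \<longrightarrow> pw p (u g - u (g + x)) \<le> ennreal K * deviation p f g) \<and>
        (\<integral>\<^sup>+x. pw p (f x) \<partial>\<mu>) \<le> ennreal K * ((\<integral>\<^sup>+x. pw p (u x) \<partial>\<mu>) + (\<integral>\<^sup>+x. deviation p f x \<partial>\<mu>)) \<and>
        (\<integral>\<^sup>+x. pw p (u x) \<partial>\<mu>) \<le> (\<integral>\<^sup>+x. pw p (f x) \<partial>\<mu>) \<and>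
        (\<forall>g x. u g \<noteq> 0 \<longrightarrow> len x \<le> R \<longrightarrow> g + x \<in> A') \<and>
        emeasure \<mu> A' \<le> ennreal K * emeasure \<mu> A"
    by (rule truncation[OF p R]) blast
  obtain m where m: "0 \<le> m" "(\<integral>\<^sup>+s. ennreal (exp (b * len s)) \<partial>\<nu>) = ennreal m"
    using mom by (cases "\<integral>\<^sup>+s. ennreal (exp (b * len s)) \<partial>\<nu>") auto
  \<comment> \<open>The first summand bounds the integral of \<open>V\<close>, the second the norm
    of \<open>f\<close>; the 1 makes the constant positive.\<close>
  define L where "L = K * (C * m) + K * (1 + C * m) + 1"
  have Cm: "0 \<le> C * m" using bC m by simp
  show thesis
  proof (rule that[of L])
    show "0 < L" using K Cm by (simp add: L_def add_nonneg_pos)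
    fix f :: "'g \<Rightarrow> real" and A and \<gamma> :: real
    assume [measurable]: "f \<in> borel_measurable borel" "A \<in> sets borel"
      and fin: "(\<integral>\<^sup>+x. pw p (f x) \<partial>\<mu>) < \<infinity>" and supp: "\<And>x. x \<notin> A \<Longrightarrow> f x = 0" and \<gamma>: "0 \<le> \<gamma>"
      and grad: "\<And>t. t \<in> S \<Longrightarrow> (\<integral>\<^sup>+g. pw p (f g - f (g + t)) \<partial>\<mu>) \<le> ennreal \<gamma>"
    have "(\<integral>\<^sup>+x. deviation p f x \<partial>\<mu>) = (\<integral>\<^sup>+s. \<integral>\<^sup>+g. pw p (f g - f (g + s)) \<partial>\<mu> \<partial>\<nu>)"
      unfolding deviation_def by (rule mu_nu.Fubini'[symmetric]) measurable
    also have "\<dots> \<le> (\<integral>\<^sup>+s. ennreal (C * \<gamma>) * ennreal (exp (b * len s)) \<partial>\<nu>)"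
      by (intro nn_integral_mono growth \<gamma> grad) auto
    also have "\<dots> = ennreal (C * \<gamma>) * ennreal m" by (simp add: nn_integral_cmult m)
    finally have dev: "(\<integral>\<^sup>+x. deviation p f x \<partial>\<mu>) \<le> ennreal (C * m * \<gamma>)"
      using bC m \<gamma> by (simp add: mult_ac flip: ennreal_mult)
    obtain u A' where u: "u \<in> borel_measurable borel" "A' \<in> sets borel"
        "\<forall>g x. len x \<le> R \<longrightarrow> pw p (u g - u (g + x)) \<le> ennreal K * deviation p f g"
        "(\<integral>\<^sup>+x. pw p (f x) \<partial>\<mu>) \<le> ennreal K * ((\<integral>\<^sup>+x. pw p (u x) \<partial>\<mu>) + (\<integral>\<^sup>+x. deviation p f x \<partial>\<mu>))"
        "(\<integral>\<^sup>+x. pw p (u x) \<partial>\<mu>) \<le> (\<integral>\<^sup>+x. pw p (f x) \<partial>\<mu>)"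
        "\<forall>g x. u g \<noteq> 0 \<longrightarrow> len x \<le> R \<longrightarrow> g + x \<in> A'"
        "emeasure \<mu> A' \<le> ennreal K * emeasure \<mu> A"
      using trunc[of f A] fin supp by auto
    have V: "(\<integral>\<^sup>+x. ennreal K * deviation p f x \<partial>\<mu>) \<le> ennreal (L * \<gamma>)"
    proof -
      have "(\<integral>\<^sup>+x. ennreal K * deviation p f x \<partial>\<mu>) \<le> ennreal K * ennreal (C * m * \<gamma>)"
        using dev by (simp add: nn_integral_cmult mult_left_mono)
      also have "\<dots> = ennreal (K * (C * m) * \<gamma>)"
        using K bC m \<gamma> by (subst ennreal_mult[symmetric]) (auto simp: mult.assoc)
      also have "\<dots> \<le> ennreal (L * \<gamma>)"
        using K Cm \<gamma> by (intro ennreal_leI mult_right_mono) (auto simp: L_def)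
      finally show ?thesis .
    qed
    have N: "(\<integral>\<^sup>+x. pw p (f x) \<partial>\<mu>) \<le> ennreal L * ((\<integral>\<^sup>+x. pw p (u x) \<partial>\<mu>) + ennreal \<gamma>)" (is "_ \<le> _ * (?u + _)")
    proof -
      have "(\<integral>\<^sup>+x. pw p (f x) \<partial>\<mu>) \<le> ennreal K * (?u + ennreal (C * m * \<gamma>))"
        by (rule order_trans[OF u(4)]) (intro mult_left_mono add_left_mono dev, auto)
      also have "\<dots> \<le> ennreal K * (ennreal (1 + C * m) * ?u + ennreal (1 + C * m) * ennreal \<gamma>)"
      proof (intro mult_left_mono add_mono)
        show "?u \<le> ennreal (1 + C * m) * ?u"
          using mult_right_mono[of 1 "ennreal (1 + C * m)" ?u] Cm by simp
        show "ennreal (C * m * \<gamma>) \<le> ennreal (1 + C * m) * ennreal \<gamma>"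
          using Cm \<gamma> by (subst ennreal_mult[symmetric]) (auto simp: distrib_right intro!: ennreal_leI)
      qed auto
      also have "\<dots> = ennreal (K * (1 + C * m)) * (?u + ennreal \<gamma>)"
        using K Cm by (simp add: ennreal_mult mult.assoc distrib_left distrib_right)
      also have "\<dots> \<le> ennreal L * (?u + ennreal \<gamma>)"
        using K Cm by (intro mult_right_mono ennreal_leI) (auto simp: L_def)
      finally show ?thesis .
    qed
    have "K \<le> L" using mult_nonneg_nonneg[OF K Cm] unfolding L_def distrib_left by linarith
    then have M: "emeasure \<mu> A' \<le> ennreal L * emeasure \<mu> A"
      by (intro order_trans[OF u(7)] mult_right_mono ennreal_leI) auto
    show "\<exists>u V A'. u \<in> borel_measurable borel \<and> V \<in> borel_measurable borel \<and> A' \<in> sets borel \<and>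
        (\<forall>g x. len x \<le> R \<longrightarrow> pw p (u g - u (g + x)) \<le> V g) \<and>
        (\<integral>\<^sup>+x. V x \<partial>\<mu>) \<le> ennreal (L * \<gamma>) \<and>
        (\<integral>\<^sup>+x. pw p (f x) \<partial>\<mu>) \<le> ennreal L * ((\<integral>\<^sup>+x. pw p (u x) \<partial>\<mu>) + ennreal \<gamma>) \<and>
        (\<integral>\<^sup>+x. pw p (u x) \<partial>\<mu>) \<le> (\<integral>\<^sup>+x. pw p (f x) \<partial>\<mu>) \<and>
        (\<forall>g x. u g \<noteq> 0 \<longrightarrow> len x \<le> R \<longrightarrow> g + x \<in> A') \<and>
        emeasure \<mu> A' \<le> ennreal L * emeasure \<mu> A"
      by (rule exI[of _ u], rule exI[of _ "\<lambda>g. ennreal K * deviation p f g"], rule exI[of _ A'])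
        (use u V N M in auto)
  qed
qed

end

section \<open>Invariant means and almost invariant densities\<close>

context smoothing
begin

lemma symmetric_distr: "distr \<nu> borel uminus = \<nu>"
proof (rule measure_eqI)
  fix A assume "A \<in> sets (distr \<nu> borel uminus)"
  then have [measurable]: "A \<in> sets borel" by simp
  have "emeasure (distr \<nu> borel uminus) A = (\<integral>\<^sup>+s. indicator A s \<partial>distr \<nu> borel uminus)"
    by simp
  also have "\<dots> = (\<integral>\<^sup>+s. indicator A (- s) \<partial>\<nu>)" by (rule nn_integral_distr) measurable
  also have "\<dots> = emeasure \<nu> A" by (subst symmetric) auto
  finally show "emeasure (distr \<nu> borel uminus) A = emeasure \<nu> A" .
qed simp

lemma integral_odd:
  fixes \<xi> :: "'g \<Rightarrow> real"
  assumes [measurable]: "\<xi> \<in> borel_measurable borel" and odd: "\<And>s. \<xi> (- s) = - \<xi> s"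
  shows "(\<integral>s. \<xi> s \<partial>\<nu>) = 0"
proof -
  have "(\<integral>s. \<xi> s \<partial>\<nu>) = (\<integral>s. \<xi> s \<partial>distr \<nu> borel uminus)" by (simp add: symmetric_distr)
  also have "\<dots> = (\<integral>s. \<xi> (- s) \<partial>\<nu>)" by (rule integral_distr) measurable
  also have "\<dots> = - (\<integral>s. \<xi> s \<partial>\<nu>)" by (simp add: odd)
  finally show ?thesis by simp
qed

lemma integrable_len:
  assumes "(\<integral>\<^sup>+s. ennreal (exp (len s)) \<partial>\<nu>) < \<infinity>"
  shows "integrable \<nu> len"
proof (rule integrableI_bounded)
  have "(\<integral>\<^sup>+s. ennreal (norm (len s)) \<partial>\<nu>) \<le> (\<integral>\<^sup>+s. ennreal (exp (len s)) \<partial>\<nu>)"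
  proof (intro nn_integral_mono ennreal_leI)
    fix s
    have "norm (len s) = len s" by simp
    then show "norm (len s) \<le> exp (len s)" using exp_ge_add_one_self[of "len s"] by linarith
  qed
  then show "(\<integral>\<^sup>+s. ennreal (norm (len s)) \<partial>\<nu>) < \<infinity>" using assms by simp
qed measurable

lemma Lipschitz_integrable:
  fixes F :: "'g \<Rightarrow> real"
  assumes len: "integrable \<nu> len" and "\<And>s t. \<bar>F s - F t\<bar> \<le> a * d s t"
  shows "integrable \<nu> F"
proof (rule Bochner_Integration.integrable_bound)
  show "integrable \<nu> (\<lambda>s. \<bar>F 0\<bar> + a * len s)" using len by simp
  show "F \<in> borel_measurable \<nu>" using Lipschitz_measurable[OF assms(2)] by simp
  have "\<bar>F s\<bar> \<le> \<bar>F 0\<bar> + a * len s" for s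
    using assms(2)[of s 0] by (simp add: commute[of s] flip: len_def)
  then show "AE s in \<nu>. norm (F s) \<le> norm (\<bar>F 0\<bar> + a * len s)"
    by (auto simp: a_nonneg)
qed

text \<open>An invariant mean is only finitely additive and cannot be exchanged with an integral; a
  finite sum can. Nodes and weights are the same for all \<open>F\<close> with the given Lipschitz
  constant. Close to the nodes the Lipschitz bound suffices, and the rest is controlled by a small
  tail of the first moment of \<open>len\<close>.\<close>

lemma quadrature:
  assumes len: "integrable \<nu> len" and "e > 0"
  shows "\<exists>T p. finite T \<and> (\<forall>F :: 'g \<Rightarrow> real. F 0 = 0 \<longrightarrow> (\<forall>s t. \<bar>F s - F t\<bar> \<le> a * d s t) \<longrightarrow>
       \<bar>(\<integral>s. F s \<partial>\<nu>) - (\<Sum>t\<in>T. p t * F t)\<bar> \<le> e)"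
proof -
  \<comment> \<open>\<open>r\<close> is both the mesh of the net and the bound for the tail of the
    moment; each of the two contributes at most e/2.\<close>
  define r where "r = e / (2 * (a + 1))"
  have r: "r > 0" "a * r \<le> e / 2" using \<open>e > 0\<close> a_nonneg by (auto simp: r_def field_simps)
  obtain z :: "nat \<Rightarrow> 'g" where z: "\<forall>x. \<exists>n. d (z n) x < r" using ex_countable_net[OF r(1)] by auto
  define U where "U N = (\<Union>n<N. B (z n) r)" for N :: nat
  have [measurable]: "U N \<in> sets borel" for N unfolding U_def by measurable
  have "(\<lambda>N. \<integral>s. len s * indicator (- U N) s \<partial>\<nu>) \<longlonglongrightarrow> (\<integral>s. 0 \<partial>\<nu>)"
  proof (rule integral_dominated_convergence[where w = len])
    have "(\<lambda>N. len s * indicator (- U N) s) \<longlonglongrightarrow> 0" for s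
    proof -
      obtain n where "d (z n) s < r" using z by blast
      then have "s \<in> U N" if "N > n" for N using that by (auto simp: U_def)
      then have "\<forall>\<^sub>F N in sequentially. len s * indicator (- U N) s = 0"
        by (intro eventually_sequentiallyI[of "Suc n"]) (auto simp: Suc_le_eq)
      then show ?thesis by (rule tendsto_eventually)
    qed
    then show "AE s in \<nu>. (\<lambda>N. len s * indicator (- U N) s) \<longlonglongrightarrow> 0" by simp
  qed (use len in \<open>auto split: split_indicator\<close>)
  then have "\<forall>\<^sub>F N in sequentially. (\<integral>s. len s * indicator (- U N) s \<partial>\<nu>) < r"
    using r by (intro order_tendstoD) auto
  then obtain N where N: "(\<integral>s. len s * indicator (- U N) s \<partial>\<nu>) < r"
    by (auto simp: eventually_sequentially)
  have tail: "a * (\<integral>s. len s * indicator (- U N) s \<partial>\<nu>) \<le> e / 2"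
  proof -
    have "a * (\<integral>s. len s * indicator (- U N) s \<partial>\<nu>) \<le> a * r"
      using N a_nonneg by (intro mult_left_mono) auto
    then show ?thesis using r by simp
  qed
  \<comment> \<open>The first close centre gives a measurable choice. The tail is sent to 0, where
    \<open>F\<close> vanishes, which is why 0 is added to the nodes.\<close>
  define \<pi> where "\<pi> s = (if s \<in> U N then z (LEAST n. d (z n) s < r) else 0)" for s
  define T where "T = insert 0 (z ` {..<N})"
  have finT: "finite T" by (simp add: T_def)
  have pi_close: "d s (\<pi> s) < r" if "s \<in> U N" for s
    using that LeastI_ex[of "\<lambda>n. d (z n) s < r"] z by (auto simp: \<pi>_def commute)
  have pi_T: "\<pi> s \<in> T" for s
  proof (cases "s \<in> U N")
    case True
    then obtain n where "n < N" "d (z n) s < r" by (auto simp: U_def)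
    then have "(LEAST n. d (z n) s < r) < N" by (metis (mono_tags, lifting) Least_le order_le_less_trans)
    then show ?thesis using True by (auto simp: \<pi>_def T_def)
  qed (simp add: \<pi>_def T_def)
  have [measurable]: "\<pi> \<in> borel_measurable borel" unfolding \<pi>_def by measurable
  have [measurable]: "{s. \<pi> s = t} \<in> sets borel" for t
    using measurable_sets[OF \<open>\<pi> \<in> borel_measurable borel\<close>, of "{t}"] by (simp add: vimage_def)
  have F: "F (\<pi> s) = (\<Sum>t\<in>T. F t * indicator {s. \<pi> s = t} s)" for s and F :: "'g \<Rightarrow> real"
  proof -
    have "(\<Sum>t\<in>T. F t * indicator {s. \<pi> s = t} s) = (\<Sum>t\<in>T. if t = \<pi> s then F t else 0)"
      by (intro sum.cong) (auto split: split_indicator)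
    also have "\<dots> = F (\<pi> s)" using pi_T finT by simp
    finally show ?thesis by simp
  qed
  have *: "integrable \<nu> (\<lambda>s. F t * indicator {s. \<pi> s = t} s)" for t and F :: "'g \<Rightarrow> real"
    by (intro integrable_mult_right integrable_real_indicator) (auto simp: less_top[symmetric])
  have int: "integrable \<nu> (\<lambda>s. F (\<pi> s))" for F :: "'g \<Rightarrow> real"
    unfolding F using * by (intro Bochner_Integration.integrable_sum)
  have quad: "(\<integral>s. F (\<pi> s) \<partial>\<nu>) = (\<Sum>t\<in>T. measure \<nu> {s. \<pi> s = t} * F t)" for F :: "'g \<Rightarrow> real"
  proof -
    have "(\<integral>s. F (\<pi> s) \<partial>\<nu>) = (\<Sum>t\<in>T. \<integral>s. F t * indicator {s. \<pi> s = t} s \<partial>\<nu>)"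
      unfolding F using * by (intro Bochner_Integration.integral_sum)
    then show ?thesis by (simp add: mult.commute)
  qed
  have "\<bar>(\<integral>s. F s \<partial>\<nu>) - (\<Sum>t\<in>T. measure \<nu> {s. \<pi> s = t} * F t)\<bar> \<le> e"
    if F: "F 0 = 0" "\<And>s t. \<bar>F s - F t\<bar> \<le> a * d s t" for F :: "'g \<Rightarrow> real"
  proof -
    have intF: "integrable \<nu> F" by (rule Lipschitz_integrable[OF len F(2)])
    have intt: "integrable \<nu> (\<lambda>s. len s * indicator (- U N) s)"
      by (rule Bochner_Integration.integrable_bound[OF len]) (auto split: split_indicator)
    have le: "\<bar>F s - F (\<pi> s)\<bar> \<le> a * r + a * (len s * indicator (- U N) s)" for s
    proof (cases "s \<in> U N")
      case True
      have "\<bar>F s - F (\<pi> s)\<bar> \<le> a * d s (\<pi> s)" by (rule F)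
      also have "\<dots> \<le> a * r" using pi_close[OF True] a_nonneg by (intro mult_left_mono) auto
      finally show ?thesis using True by simp
    next
      case False
      then have "\<bar>F s - F (\<pi> s)\<bar> \<le> a * len s"
        using F(2)[of s 0] by (simp add: \<pi>_def F(1) commute[of s] flip: len_def)
      then show ?thesis using False a_nonneg r by (simp add: add_increasing)
    qed
    have "\<bar>(\<integral>s. F s \<partial>\<nu>) - (\<integral>s. F (\<pi> s) \<partial>\<nu>)\<bar> = \<bar>\<integral>s. F s - F (\<pi> s) \<partial>\<nu>\<bar>"
      using intF int by simp
    also have "\<dots> \<le> (\<integral>s. \<bar>F s - F (\<pi> s)\<bar> \<partial>\<nu>)" by (rule integral_abs_bound)
    also have "\<dots> \<le> (\<integral>s. a * r + a * (len s * indicator (- U N) s) \<partial>\<nu>)"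
      using intF int[of F] intt le by (intro integral_mono) auto
    also have "\<dots> = a * r + a * (\<integral>s. len s * indicator (- U N) s \<partial>\<nu>)"
      using intt by (simp add: nu.prob_space[simplified])
    also have "\<dots> \<le> e" using r tail by simp
    finally show ?thesis by (simp add: quad)
  qed
  then show ?thesis
    using finT by (intro exI[of _ T] exI[of _ "\<lambda>t. measure \<nu> {s. \<pi> s = t}"] conjI allI impI) simp_all
qed

text \<open>The increments of \<open>v\<close> have means \<open>\<xi> s\<close>, and \<open>\<xi>\<close> is odd, hence has integral zero
  against the symmetric kernel. This is incompatible with a uniform drift of \<open>v\<close>.\<close>

lemma invariant_mean_no_drift:
  fixes v :: "'g \<Rightarrow> real"
  assumes mean: "left_invariant_mean \<mu> M" and len: "integrable \<nu> len"
    and Lip: "\<And>x y. \<bar>v x - v y\<bar> \<le> a * d x y"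
    and drift: "\<And>h. \<delta> \<le> (\<integral>s. v h - v (h + s) \<partial>\<nu>)"
  shows "\<delta> \<le> 0"
proof (rule ccontr)
  assume "\<not> \<delta> \<le> 0"
  \<comment> \<open>A bound at every point survives composition with inversion, whereas an essential
    bound would require inversion to preserve null sets.\<close>
  define bdd where "bdd F \<longleftrightarrow> F \<in> borel_measurable borel \<and> (\<exists>c. \<forall>x. \<bar>F x\<bar> \<le> c)" for F :: "'g \<Rightarrow> real"
  \<comment> \<open>Composition with inversion turns the left invariant mean into a right invariant
    one, which suits increments of the form \<open>v (h + s)\<close>.\<close>
  define m where "m F = M (\<lambda>x. F (- x))" for F
  have bddD: "(\<lambda>x. F (- x)) \<in> ess_bounded \<mu>" if "bdd F" for F
  proof -
    have [measurable]: "F \<in> borel_measurable borel" using that by (simp add: bdd_def)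
    have "(\<lambda>x. F (- x)) \<in> borel_measurable borel" by measurable
    then show ?thesis using that by (auto simp: ess_bounded_def bdd_def)
  qed
  have bdd_add: "bdd (\<lambda>x. F x + G x)" if FG: "bdd F" "bdd G" for F G
  proof -
    obtain c c' where c: "\<And>x. \<bar>F x\<bar> \<le> c" "\<And>x. \<bar>G x\<bar> \<le> c'"
      using FG unfolding bdd_def by blast
    have "\<bar>F x + G x\<bar> \<le> c + c'" for x using c(1)[of x] c(2)[of x] by linarith
    then show ?thesis using that unfolding bdd_def by (auto intro!: borel_measurable_add)
  qed
  have bdd_mult: "bdd (\<lambda>x. k * F x)" if F: "bdd F" for F k
  proof -
    obtain c where c: "\<And>x. \<bar>F x\<bar> \<le> c" using F unfolding bdd_def by blast
    have "\<bar>k * F x\<bar> \<le> \<bar>k\<bar> * c" for x using c[of x] by (simp add: abs_mult mult_left_mono)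
    then show ?thesis using that unfolding bdd_def by (auto intro!: borel_measurable_times)
  qed
  have bdd_const: "bdd (\<lambda>x. k)" for k by (auto simp: bdd_def)
  have bdd_sum: "bdd (\<lambda>x. \<Sum>t\<in>T. F t x)" if "finite T" "\<And>t. bdd (F t)" for T :: "'g set" and F
    using that by (induction T) (auto intro: bdd_add bdd_const)
  have m_add: "m (\<lambda>x. F x + G x) = m F + m G" if "bdd F" "bdd G" for F G
    using mean bddD[OF that(1)] bddD[OF that(2)] by (simp add: left_invariant_mean_def m_def)
  have m_mult: "m (\<lambda>x. k * F x) = k * m F" if "bdd F" for F k
    using mean bddD[OF that] by (simp add: left_invariant_mean_def m_def)
  have m_pos: "0 \<le> m F" if "bdd F" "\<And>x. 0 \<le> F x" for F
    using mean bddD[OF that(1)] that(2) by (simp add: left_invariant_mean_def m_def)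
  have m_one: "m (\<lambda>x. 1) = 1" using mean by (simp add: left_invariant_mean_def m_def)
  have m_const: "m (\<lambda>x. k) = k" for k using m_mult[OF bdd_const[of 1], of k] by (simp add: m_one)
  have m_right: "m (\<lambda>x. F (x + g)) = m F" if "bdd F" for F g
  proof -
    define F' where "F' x = F (- x)" for x
    have "F' \<in> ess_bounded \<mu>" using bddD[OF that] by (simp add: F'_def[abs_def])
    then have "M (\<lambda>x. F' (- g + x)) = M F'" using mean by (simp add: left_invariant_mean_def)
    then show ?thesis by (simp add: m_def F'_def[abs_def] minus_add)
  qed
  have m_mono: "m F \<le> m G" if "bdd F" "bdd G" "\<And>x. F x \<le> G x" for F G
  proof -
    have b: "bdd (\<lambda>x. G x + (- 1) * F x)" by (intro bdd_add bdd_mult that)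
    have "m G = m (\<lambda>x. F x + (G x + (- 1) * F x))" by simp
    also have "\<dots> = m F + m (\<lambda>x. G x + (- 1) * F x)" by (rule m_add[OF that(1) b])
    finally have "m G = m F + m (\<lambda>x. G x + (- 1) * F x)" .
    moreover have "0 \<le> m (\<lambda>x. G x + (- 1) * F x)" using that(3) by (intro m_pos b) simp
    ultimately show ?thesis by linarith
  qed
  have m_abs: "\<bar>m F\<bar> \<le> k" if "bdd F" "\<And>x. \<bar>F x\<bar> \<le> k" for F k
  proof -
    have "m F \<le> m (\<lambda>x. k)" using that by (intro m_mono bdd_const) (auto simp: abs_le_iff)
    moreover have "m (\<lambda>x. - k) \<le> m F" using that by (intro m_mono bdd_const) (auto simp: abs_le_iff minus_le_iff)
    ultimately show ?thesis by (simp add: m_const)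
  qed
  have m_sum: "m (\<lambda>x. \<Sum>t\<in>T. F t x) = (\<Sum>t\<in>T. m (F t))" if "finite T" "\<And>t. bdd (F t)" for T :: "'g set" and F
    using that by (induction T) (auto simp: m_const m_add bdd_sum)
  \<comment> \<open>\<open>v\<close> may be unbounded; the mean is applied only to its increments,
    which are bounded by the Lipschitz property.\<close>
  define \<theta> where "\<theta> s h = v h - v (h + s)" for s h
  have [measurable]: "v \<in> borel_measurable borel" by (rule Lipschitz_measurable[OF Lip])
  have Lip2: "\<bar>v (h + s) - v (h + t)\<bar> \<le> a * d s t" for h s t
    using Lip[of "h + s" "h + t"] by (simp add: dist_left)
  have bdd_diff: "bdd (\<lambda>h. v (h + s) - v (h + t))" for s t
    unfolding bdd_def using Lip2[of _ s t] by (auto intro!: exI[of _ "a * d s t"])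
  have bdd_theta: "bdd (\<theta> s)" for s
    using bdd_diff[of 0 s] by (simp add: \<theta>_def[abs_def])
  define \<xi> where "\<xi> s = m (\<theta> s)" for s
  have chi_Lip: "\<bar>\<xi> s - \<xi> t\<bar> \<le> a * d s t" for s t
  proof -
    have "m (\<theta> t) = m (\<lambda>h. \<theta> s h + (v (h + s) - v (h + t)))" by (simp add: \<theta>_def[abs_def])
    also have "\<dots> = m (\<theta> s) + m (\<lambda>h. v (h + s) - v (h + t))"
      by (rule m_add[OF bdd_theta bdd_diff])
    finally have "\<xi> s - \<xi> t = - m (\<lambda>h. v (h + s) - v (h + t))" by (simp add: \<xi>_def)
    then show ?thesis using m_abs[OF bdd_diff Lip2, of s t] by simp
  qed
  have chi_odd: "\<xi> (- s) = - \<xi> s" for s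
  proof -
    have "\<xi> (- s) = m (\<lambda>h. \<theta> (- s) (h + s))" unfolding \<xi>_def by (rule m_right[OF bdd_theta, symmetric])
    also have "(\<lambda>h. \<theta> (- s) (h + s)) = (\<lambda>h. (- 1) * \<theta> s h)" by (simp add: \<theta>_def fun_eq_iff)
    also have "m \<dots> = - \<xi> s" using m_mult[OF bdd_theta, of "- 1" s] by (simp add: \<xi>_def)
    finally show ?thesis .
  qed
  have chi0: "\<xi> 0 = 0" using chi_odd[of 0] by simp
  \<comment> \<open>Quadrature is used twice, for the increments at each \<open>h\<close> and for
    their means; two errors of \<delta>/3 leave a contradiction.\<close>
  have "\<delta> / 3 > 0" using \<open>\<not> \<delta> \<le> 0\<close> by simp
  from quadrature[OF len this] obtain T p where T: "finite T"
    and quad: "\<And>F :: 'g \<Rightarrow> real. F 0 = 0 \<Longrightarrow> (\<And>s t. \<bar>F s - F t\<bar> \<le> a * d s t) \<Longrightarrow>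
       \<bar>(\<integral>s. F s \<partial>\<nu>) - (\<Sum>t\<in>T. p t * F t)\<bar> \<le> \<delta> / 3"
    by blast
  have "2 * \<delta> / 3 \<le> (\<Sum>t\<in>T. p t * \<theta> t h)" for h
  proof -
    have "\<bar>(\<integral>s. \<theta> s h \<partial>\<nu>) - (\<Sum>t\<in>T. p t * \<theta> t h)\<bar> \<le> \<delta> / 3"
      using Lip2[of h] by (intro quad) (auto simp: \<theta>_def abs_minus_commute)
    then show ?thesis using drift[of h] unfolding \<theta>_def by linarith
  qed
  then have "m (\<lambda>h. 2 * \<delta> / 3) \<le> m (\<lambda>h. \<Sum>t\<in>T. p t * \<theta> t h)"
    by (intro m_mono bdd_const bdd_sum T bdd_mult bdd_theta)
  also have "\<dots> = (\<Sum>t\<in>T. p t * \<xi> t)"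
    by (subst m_sum[OF T(1)]) (auto simp: \<xi>_def m_mult bdd_theta intro: bdd_mult)
  finally have "2 * \<delta> / 3 \<le> (\<Sum>t\<in>T. p t * \<xi> t)" by (simp add: m_const)
  moreover have "\<bar>(\<integral>s. \<xi> s \<partial>\<nu>) - (\<Sum>t\<in>T. p t * \<xi> t)\<bar> \<le> \<delta> / 3"
    by (rule quad[OF chi0 chi_Lip])
  moreover have "(\<integral>s. \<xi> s \<partial>\<nu>) = 0" by (rule integral_odd[OF Lipschitz_measurable[OF chi_Lip] chi_odd])
  ultimately show False using \<open>\<not> \<delta> \<le> 0\<close> by linarith
qed

end

lemma pw_2: "pw 2 x = ennreal (x\<^sup>2)"
  by (simp add: pw_def)

section \<open>Averaging has no spectral gap in the presence of an invariant mean\<close>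

context smoothing
begin

lemma integrable_bounded_shift:
  fixes f :: "'g \<Rightarrow> real"
  assumes [measurable]: "f \<in> borel_measurable borel" and "\<And>x. 0 < f x \<and> f x \<le> 1"
  shows "integrable \<nu> (\<lambda>s. f (g + s))"
proof (rule nu.integrable_const_bound[where B = 1])
  have "\<bar>f y\<bar> \<le> 1" for y using assms(2)[of y] by linarith
  then show "AE s in \<nu>. norm (f (g + s)) \<le> 1" by simp
qed measurable

lemma avg_bounds:
  fixes f :: "'g \<Rightarrow> real"
  assumes [measurable]: "f \<in> borel_measurable borel" and f: "\<And>x. 0 < f x \<and> f x \<le> 1"
  shows "0 < avg f x \<and> avg f x \<le> 1"
  unfolding avg_def using f integrable_bounded_shift[OF assms]
  by (intro conjI nu.expectation_greater nu.integral_le_const) auto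

lemma nn_integral_eq_avg:
  fixes f :: "'g \<Rightarrow> real"
  assumes [measurable]: "f \<in> borel_measurable borel" and f: "\<And>x. 0 < f x \<and> f x \<le> 1"
  shows "(\<integral>\<^sup>+s. ennreal (f (x + s)) \<partial>\<nu>) = ennreal (avg f x)"
  unfolding avg_def using f integrable_bounded_shift[OF assms]
  by (intro nn_integral_eq_integral) (auto intro: less_imp_le)

lemma avg_Harnack:
  fixes f :: "'g \<Rightarrow> real"
  assumes [measurable]: "f \<in> borel_measurable borel" and f: "\<And>x. 0 < f x \<and> f x \<le> 1"
  shows "avg f (h + x) \<le> exp (a * len x) * avg f h"
proof -
  have "ennreal (avg f (h + x)) = (\<integral>\<^sup>+s. ennreal (f (h + (x + s))) \<partial>\<nu>)"
    by (simp add: nn_integral_eq_avg[OF assms, symmetric] add.assoc)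
  also have "\<dots> \<le> ennreal (exp (a * len x)) * (\<integral>\<^sup>+s. ennreal (f (h + s)) \<partial>\<nu>)"
    by (rule quasi_invariant) measurable
  also have "\<dots> = ennreal (exp (a * len x) * avg f h)"
    by (simp add: nn_integral_eq_avg[OF assms] ennreal_mult')
  finally show ?thesis using avg_bounds[OF assms, of h] by (simp add: less_imp_le)
qed

text \<open>If averaging were a strict contraction of \<open>L\<^sup>2\<close>, a Neumann series would give a
  positive function \<open>w\<close> with \<open>avg w \<le> w / r\<close> for some \<open>r > 1\<close>. The Harnack inequality makes
  \<open>ln w\<close> Lipschitz, and by Jensen's inequality \<open>ln w\<close> drifts by at least \<open>ln r\<close>, which an
  invariant mean forbids.\<close>

lemma no_spectral_gap:
  assumes mean: "left_invariant_mean \<mu> M" and mom: "(\<integral>\<^sup>+s. ennreal (exp (len s)) \<partial>\<nu>) < \<infinity>"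
    and \<theta>: "0 < \<theta>" "\<theta> < 1"
  shows "\<exists>f. f \<in> borel_measurable borel \<and> (\<forall>x. 0 < f x \<and> f x \<le> 1) \<and> (\<integral>\<^sup>+x. pw 2 (f x) \<partial>\<mu>) < \<infinity> \<and>
     \<not> (\<integral>\<^sup>+x. pw 2 (avg f x) \<partial>\<mu>) \<le> ennreal \<theta> * (\<integral>\<^sup>+x. pw 2 (f x) \<partial>\<mu>)"
proof (rule ccontr)
  assume neg: "\<not> ?thesis"
  \<comment> \<open>This class is stable under averaging, and its members are integrable along all
    shifts of \<nu>, so all iterates are treated alike.\<close>
  define good where "good f \<longleftrightarrow> f \<in> borel_measurable borel \<and> (\<forall>x. 0 < f x \<and> f x \<le> 1)" for f :: "'g \<Rightarrow> real"
  have gap: "(\<integral>\<^sup>+x. pw 2 (avg f x) \<partial>\<mu>) \<le> ennreal \<theta> * (\<integral>\<^sup>+x. pw 2 (f x) \<partial>\<mu>)"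
    if "good f" "(\<integral>\<^sup>+x. pw 2 (f x) \<partial>\<mu>) < \<infinity>" for f
    using neg that unfolding good_def by blast
  have good_avg: "good (avg f)" if "good f" for f
    using that avg_bounds[of f] unfolding good_def by auto
  obtain b where b: "b \<ge> 0" "\<And>a. a \<ge> b \<Longrightarrow> (\<integral>\<^sup>+x. ennreal (exp (- a * len x)) \<partial>\<mu>) < \<infinity>"
    by (rule exp_len_integrable) blast
  \<comment> \<open>A start that is square integrable and positive everywhere, so that the logarithm
    of the series below makes sense.\<close>
  define f\<^sub>0 where "f\<^sub>0 x = exp (- b * len x)" for x
  have good0: "good f\<^sub>0" using b by (auto simp: good_def f\<^sub>0_def[abs_def])
  have "(\<integral>\<^sup>+x. pw 2 (f\<^sub>0 x) \<partial>\<mu>) \<le> (\<integral>\<^sup>+x. ennreal (exp (- b * len x)) \<partial>\<mu>)"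
    unfolding pw_2 using good0
    by (intro nn_integral_mono ennreal_leI) (auto simp: good_def f\<^sub>0_def power2_eq_square intro!: mult_left_le)
  also have "\<dots> < \<infinity>" using b by auto
  finally obtain i\<^sub>0 where i0: "i\<^sub>0 \<ge> 0" "(\<integral>\<^sup>+x. pw 2 (f\<^sub>0 x) \<partial>\<mu>) = ennreal i\<^sub>0"
    by (cases "\<integral>\<^sup>+x. pw 2 (f\<^sub>0 x) \<partial>\<mu>") auto
  define g where "g k = (avg ^^ k) f\<^sub>0" for k
  have g_Suc: "g (Suc k) = avg (g k)" for k by (simp add: g_def)
  have good_g: "good (g k)" for k
    by (induction k) (auto simp: g_def good0 intro: good_avg)
  have [measurable]: "g k \<in> borel_measurable borel" for k using good_g by (simp add: good_def)
  have g_bd: "0 < g k x \<and> g k x \<le> 1" for k x using good_g by (simp add: good_def)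
  have norm_g: "(\<integral>\<^sup>+x. pw 2 (g k x) \<partial>\<mu>) \<le> ennreal (\<theta> ^ k * i\<^sub>0)" for k
  proof (induction k)
    case (Suc k)
    have "(\<integral>\<^sup>+x. pw 2 (g (Suc k) x) \<partial>\<mu>) \<le> ennreal \<theta> * (\<integral>\<^sup>+x. pw 2 (g k x) \<partial>\<mu>)"
      unfolding g_Suc using Suc by (intro gap good_g) (auto simp: order_le_less_trans)
    also have "\<dots> \<le> ennreal \<theta> * ennreal (\<theta> ^ k * i\<^sub>0)" by (intro mult_left_mono Suc) auto
    also have "\<dots> = ennreal (\<theta> ^ Suc k * i\<^sub>0)"
      using \<theta> i0 by (subst ennreal_mult[symmetric]) (auto simp: mult.assoc)
    finally show ?case .
  qed (simp add: g_def i0)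
  \<comment> \<open>\<open>pw 2\<close> measures squared norms, so norms decay with the square root
    of the ratio.\<close>
  define q where "q = sqrt \<theta>"
  have q: "0 < q" "q < 1" "q\<^sup>2 = \<theta>" using \<theta> by (auto simp: q_def)
  define D where "D = sqrt (c * i\<^sub>0)"
  have D: "0 \<le> D" "D\<^sup>2 = c * i\<^sub>0" using c_nonneg i0 by (auto simp: D_def)
  \<comment> \<open>One further averaging turns decay in the square norm into uniform decay, by
    Jensen's inequality and \<open>dominated\<close>.\<close>
  have decay: "g (Suc k) h \<le> D * q ^ k" for k h
  proof -
    have "pw 2 (g (Suc k) h) \<le> (\<integral>\<^sup>+s. pw 2 (g k (h + s)) \<partial>\<nu>)"
      unfolding g_Suc avg_def using integrable_bounded_shift[of "g k" h] g_bd
      by (intro nu.pw_integral_le) auto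
    also have "\<dots> \<le> ennreal c * (\<integral>\<^sup>+s. pw 2 (g k s) \<partial>\<mu>)" by (rule dominated) measurable
    also have "\<dots> \<le> ennreal c * ennreal (\<theta> ^ k * i\<^sub>0)" by (intro mult_left_mono norm_g) auto
    also have "\<dots> = ennreal (c * (\<theta> ^ k * i\<^sub>0))"
      using c_nonneg i0 \<theta> by (subst ennreal_mult) auto
    finally have "(g (Suc k) h)\<^sup>2 \<le> c * (\<theta> ^ k * i\<^sub>0)"
      unfolding pw_2 using c_nonneg i0 \<theta> by (subst (asm) ennreal_le_iff) auto
    also have "\<dots> = D\<^sup>2 * (q\<^sup>2) ^ k" by (simp add: D(2) q(3))
    also have "\<dots> = (D * q ^ k)\<^sup>2" by (simp add: power_mult_distrib mult.commute flip: power_mult)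
    finally show ?thesis by (rule power2_le_imp_le) (use D(1) q(1) in simp)
  qed
  \<comment> \<open>The midpoint of 1 and 1/q: larger than 1 for the drift, with
    \<open>r * q < 1\<close> for convergence.\<close>
  define r where "r = (1 + 1 / q) / 2"
  have r: "r > 1" "r * q < 1" "r \<ge> 0" using q by (auto simp: r_def field_simps)
  have rg: "0 \<le> r ^ k * g j x" for k j x using r(3) g_bd[of j x] by (intro mult_nonneg_nonneg) auto
  have summ: "summable (\<lambda>k. r ^ k * g (Suc k) h)" for h
  proof (rule summable_comparison_test')
    show "summable (\<lambda>k. D * (r * q) ^ k)" using r q by (intro summable_mult summable_geometric) auto
    show "norm (r ^ k * g (Suc k) h) \<le> D * (r * q) ^ k" if "k \<ge> 0" for k
      using mult_left_mono[OF decay[of k h], of "r ^ k"] r g_bd[of "Suc k" h]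
      by (simp add: power_mult_distrib mult_ac abs_mult)
  qed
  \<comment> \<open>The series starts with \<open>g 1\<close>, so that every term is an average and
    obeys the Harnack inequality. Averaging shifts the index: \<open>w\<close> is \<open>g 1\<close>
    plus \<open>r\<close> times the average of \<open>w\<close>.\<close>
  define w where "w h = (\<Sum>k. r ^ k * g (Suc k) h)" for h
  have [measurable]: "w \<in> borel_measurable borel" unfolding w_def by measurable
  have w_split: "w h = g 1 h + r * (\<Sum>k. r ^ k * g (Suc (Suc k)) h)"
    and summ2: "summable (\<lambda>k. r ^ k * g (Suc (Suc k)) h)" for h
  proof -
    have "summable (\<lambda>k. r ^ Suc k * g (Suc (Suc k)) h)"
      using summ[of h] by (subst summable_Suc_iff[where f = "\<lambda>k. r ^ k * g (Suc k) h"])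
    then have "summable (\<lambda>k. r * (r ^ k * g (Suc (Suc k)) h))" by (simp add: mult.assoc)
    then show 1: "summable (\<lambda>k. r ^ k * g (Suc (Suc k)) h)" using r by (subst (asm) summable_cmult_iff) auto
    show "w h = g 1 h + r * (\<Sum>k. r ^ k * g (Suc (Suc k)) h)"
      using suminf_split_head[OF summ[of h]] suminf_mult[OF 1, of r] by (simp add: w_def mult.assoc)
  qed
  have w_pos: "w h > 0" for h
    unfolding w_def using g_bd r by (intro suminf_pos summ) auto
  have w_nn: "0 \<le> w h" for h using w_pos[of h] by simp
  have w_avg: "(\<integral>\<^sup>+s. ennreal (w (h + s)) \<partial>\<nu>) \<le> ennreal (w h / r)" for h
  proof -
    have "(\<integral>\<^sup>+s. ennreal (w (h + s)) \<partial>\<nu>) = (\<integral>\<^sup>+s. (\<Sum>k. ennreal (r ^ k * g (Suc k) (h + s))) \<partial>\<nu>)"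
      unfolding w_def using rg by (intro nn_integral_cong suminf_ennreal2[symmetric] summ) auto
    also have "\<dots> = (\<Sum>k. \<integral>\<^sup>+s. ennreal (r ^ k * g (Suc k) (h + s)) \<partial>\<nu>)"
      by (rule nn_integral_suminf) measurable
    also have "\<dots> = (\<Sum>k. ennreal (r ^ k * g (Suc (Suc k)) h))"
    proof (intro suminf_cong)
      fix k
      have "(\<integral>\<^sup>+s. ennreal (r ^ k * g (Suc k) (h + s)) \<partial>\<nu>) = (\<integral>\<^sup>+s. ennreal (r ^ k) * ennreal (g (Suc k) (h + s)) \<partial>\<nu>)"
        using r by (simp add: ennreal_mult')
      also have "\<dots> = ennreal (r ^ k) * ennreal (avg (g (Suc k)) h)"
        using nn_integral_eq_avg[of "g (Suc k)" h] g_bd by (subst nn_integral_cmult) auto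
      also have "\<dots> = ennreal (r ^ k * g (Suc (Suc k)) h)"
        using r by (simp add: g_Suc[of "Suc k"] ennreal_mult')
      finally show "(\<integral>\<^sup>+s. ennreal (r ^ k * g (Suc k) (h + s)) \<partial>\<nu>) = ennreal (r ^ k * g (Suc (Suc k)) h)" .
    qed
    also have "\<dots> = ennreal (\<Sum>k. r ^ k * g (Suc (Suc k)) h)"
      using rg by (intro suminf_ennreal2 summ2) auto
    also have "\<dots> \<le> ennreal (w h / r)"
      using w_split[of h] g_bd[of 1 h] r by (intro ennreal_leI) (simp add: field_simps)
    finally show ?thesis .
  qed
  have w_Harnack: "w (h + x) \<le> exp (a * len x) * w h" for h x
  proof -
    have "w (h + x) \<le> (\<Sum>k. exp (a * len x) * (r ^ k * g (Suc k) h))"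
      unfolding w_def
    proof (intro suminf_le summ summable_mult)
      fix k
      have "r ^ k * g (Suc k) (h + x) \<le> r ^ k * (exp (a * len x) * g (Suc k) h)"
        unfolding g_Suc using r by (intro mult_left_mono avg_Harnack g_bd) auto
      then show "r ^ k * g (Suc k) (h + x) \<le> exp (a * len x) * (r ^ k * g (Suc k) h)" by (simp add: mult_ac)
    qed
    also have "\<dots> = exp (a * len x) * w h" unfolding w_def by (rule suminf_mult[OF summ])
    finally show ?thesis .
  qed
  define v where "v h = ln (w h)" for h
  have v_step: "v (h + x) \<le> v h + a * len x" for h x
  proof -
    have "v (h + x) \<le> ln (exp (a * len x) * w h)"
      unfolding v_def using w_Harnack[of h x] w_pos by (intro ln_mono) auto
    then show ?thesis using w_pos[of h] by (simp add: v_def ln_mult)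
  qed
  have Lip: "\<bar>v x - v y\<bar> \<le> a * d x y" for x y
    using v_step[of x "- x + y"] v_step[of y "- y + x"] dist_len[of x y] dist_len[of y x] commute[of x y]
    by (simp add: abs_le_iff flip: add.assoc)
  have len: "integrable \<nu> len" by (rule integrable_len[OF mom])
  have "ln r \<le> (\<integral>s. v h - v (h + s) \<partial>\<nu>)" for h
  proof -
    have iw: "integrable \<nu> (\<lambda>s. w (h + s))"
      using w_avg[of h] w_nn by (intro integrableI_nonneg) (auto simp: order_le_less_trans)
    have "ennreal (\<integral>s. w (h + s) \<partial>\<nu>) \<le> ennreal (w h / r)"
      using w_avg[of h] nn_integral_eq_integral[OF iw] w_nn by auto
    then have le: "(\<integral>s. w (h + s) \<partial>\<nu>) \<le> w h / r"
      using w_pos[of h] r by (subst (asm) ennreal_le_iff) auto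
    \<comment> \<open>Jensen's inequality through the tangent of \<open>ln\<close> at 1; the
      argument \<open>r / w h * w (h + s)\<close> has mean at most 1.\<close>
    have "ln r + 1 - r / w h * w (h + s) \<le> v h - v (h + s)" for s
    proof -
      have "ln (r / w h * w (h + s)) \<le> r / w h * w (h + s) - 1"
        using r w_pos[of h] w_pos[of "h + s"] by (intro ln_le_minus_one) auto
      moreover have "ln (r / w h * w (h + s)) = ln r - v h + v (h + s)"
        using r w_pos[of h] w_pos[of "h + s"] by (simp add: v_def ln_mult ln_div)
      ultimately show ?thesis by simp
    qed
    moreover have "integrable \<nu> (\<lambda>s. v (h + s))"
      using Lip[of "h + _" "h + _"] by (intro Lipschitz_integrable[OF len]) (simp add: dist_left)
    ultimately have "(\<integral>s. ln r + 1 - r / w h * w (h + s) \<partial>\<nu>) \<le> (\<integral>s. v h - v (h + s) \<partial>\<nu>)"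
      using iw by (intro integral_mono) auto
    moreover have "(\<integral>s. ln r + 1 - r / w h * w (h + s) \<partial>\<nu>) = ln r + 1 - r / w h * (\<integral>s. w (h + s) \<partial>\<nu>)"
      using iw by (simp add: nu.prob_space[simplified])
    moreover have "r / w h * (\<integral>s. w (h + s) \<partial>\<nu>) \<le> 1"
      using r w_pos[of h] le by (simp add: field_simps)
    ultimately show ?thesis by linarith
  qed
  then have "ln r \<le> 0" by (rule invariant_mean_no_drift[OF mean len Lip])
  then show False using r by simp
qed

end

context haar_group
begin

text \<open>\<open>k\<close> is the square of the average \<open>W\<close> of an almost preserved
  \<open>f\<close>. The integral of the square of \<open>f\<close> splits into those of
  \<open>k\<close> and of the local variance, so the variance is small relative to \<open>k\<close>.
  The oscillation of \<open>W\<close> is bounded by the mean deviation, hence by the root of the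
  variance. \<open>C\<close> is a Harnack constant independent of \<eta>; this is essential, as it
  multiplies the gradient in the transfer.\<close>

lemma almost_invariant_density:
  assumes mean: "left_invariant_mean \<mu> M" and R: "0 \<le> R"
  shows "\<exists>C>0. \<forall>\<eta>>0. \<exists>k E. k \<in> borel_measurable borel \<and> E \<in> borel_measurable borel \<and>
     (\<forall>h. 0 \<le> k h \<and> 0 \<le> E h) \<and>
     0 < (\<integral>\<^sup>+h. ennreal (k h) \<partial>\<mu>) \<and> (\<integral>\<^sup>+h. ennreal (k h) \<partial>\<mu>) < \<infinity> \<and>
     (\<forall>h x. len x \<le> R \<longrightarrow> k (h + x) \<le> C * k h \<and> \<bar>k h - k (h + x)\<bar> \<le> E h) \<and>
     (\<integral>\<^sup>+h. ennreal (E h) \<partial>\<mu>) \<le> ennreal \<eta> * (\<integral>\<^sup>+h. ennreal (k h) \<partial>\<mu>)"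
proof -
  obtain \<nu> a c where sm: "smoothing S d \<mu> \<nu> a c" and mom: "(\<integral>\<^sup>+s. ennreal (exp (1 * len s)) \<partial>\<nu>) < \<infinity>"
    by (rule ex_smoothing)
  interpret smoothing S d \<mu> \<nu> a c by (rule sm)
  define G where "G = exp (a * R)"
  have G: "G \<ge> 1" "G > 0" using a_nonneg R by (auto simp: G_def)
  have Gl: "exp (a * len x) \<le> G" if "len x \<le> R" for x
    using that a_nonneg by (auto simp: G_def intro: mult_left_mono)
  define D where "D = G * (1 + G)"
  have D: "D > 0" using G by (simp add: D_def)
  show ?thesis
  proof (intro exI[of _ "G\<^sup>2"] conjI allI impI)
    show "G\<^sup>2 > 0" using G by simp
    fix \<eta> :: real assume "\<eta> > 0"
    \<comment> \<open>Both terms of \<open>E\<close> integrate to at most D t times the integral of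
      \<open>k\<close>, in total \<eta> times it.\<close>
    define t where "t = \<eta> / (2 * D)"
    have t: "t > 0" using \<open>\<eta> > 0\<close> D by (simp add: t_def)
    \<comment> \<open>With this ratio the integral of \<open>V\<close> is at most t squared times
      that of \<open>k\<close>.\<close>
    define \<theta> where "\<theta> = 1 / (1 + t\<^sup>2)"
    have "1 + t\<^sup>2 > 1" using t by simp
    then have pos: "1 + t\<^sup>2 > 0" by linarith
    have \<theta>: "0 < \<theta>" using pos by (simp add: \<theta>_def)
    have \<theta>1: "\<theta> < 1"
      unfolding \<theta>_def by (rule iffD2[OF divide_less_eq_1_pos[OF pos]]) fact
    obtain f where [measurable]: "f \<in> borel_measurable borel" and f: "\<And>x. 0 < f x \<and> f x \<le> 1"
      and fin: "(\<integral>\<^sup>+x. pw 2 (f x) \<partial>\<mu>) < \<infinity>"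
      and gap: "\<not> (\<integral>\<^sup>+x. pw 2 (avg f x) \<partial>\<mu>) \<le> ennreal \<theta> * (\<integral>\<^sup>+x. pw 2 (f x) \<partial>\<mu>)"
      using no_spectral_gap[OF mean _ \<theta> \<theta>1] mom by auto
    note int = integrable_bounded_shift[OF \<open>f \<in> borel_measurable borel\<close> f]
    define W where "W = avg f"
    have [measurable]: "W \<in> borel_measurable borel" unfolding W_def by measurable
    have W: "0 < W h" "W h \<le> 1" for h using avg_bounds[of f h] f by (auto simp: W_def)
    define V where "V h = (\<integral>s. (f (h + s) - W h)\<^sup>2 \<partial>\<nu>)" for h
    have [measurable]: "V \<in> borel_measurable borel" unfolding V_def by measurable
    have V0: "0 \<le> V h" for h by (simp add: V_def)
    have dev1: "\<bar>f (h + s) - W h\<bar> \<le> 1" for h s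
      using f[of "h + s"] W[of h] by (auto simp: abs_le_iff)
    have int2: "integrable \<nu> (\<lambda>s. (f (h + s))\<^sup>2)" for h
      using f by (intro nu.integrable_const_bound[where B = 1]) (auto simp: abs_square_le_1 abs_le_iff less_imp_le intro: order_trans[of _ 0])
    have V_eq: "V h + (W h)\<^sup>2 = (\<integral>s. (f (h + s))\<^sup>2 \<partial>\<nu>)" for h
    proof -
      have "V h = (\<integral>s. (f (h + s))\<^sup>2 - 2 * W h * f (h + s) + (W h)\<^sup>2 \<partial>\<nu>)"
        unfolding V_def by (intro Bochner_Integration.integral_cong) (auto simp: power2_eq_square algebra_simps)
      also have "\<dots> = (\<integral>s. (f (h + s))\<^sup>2 \<partial>\<nu>) - 2 * W h * W h + (W h)\<^sup>2"
        using int[of h] int2[of h] by (simp add: W_def avg_def nu.prob_space[simplified])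
      finally show ?thesis by (simp add: power2_eq_square)
    qed
    have J: "(\<integral>s. \<bar>f (h + s) - W h\<bar> \<partial>\<nu>)\<^sup>2 \<le> V h" for h
    proof -
      have i: "integrable \<nu> (\<lambda>s. (f (h + s) - W h)\<^sup>2)"
        using dev1 by (intro nu.integrable_const_bound[where B = 1]) (auto simp: abs_square_le_1)
      have "pw 2 (\<integral>s. \<bar>f (h + s) - W h\<bar> \<partial>\<nu>) \<le> (\<integral>\<^sup>+s. pw 2 \<bar>f (h + s) - W h\<bar> \<partial>\<nu>)"
        using int[of h] by (intro nu.pw_integral_le) auto
      also have "\<dots> = ennreal (V h)"
        unfolding pw_2 V_def power2_abs using i by (intro nn_integral_eq_integral) auto
      finally show ?thesis unfolding pw_2 using V0[of h] by simp
    qed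
    define k where "k h = (W h)\<^sup>2" for h
    define E where "E h = D * (t * k h + V h / t)" for h
    have kE: "0 \<le> k h \<and> 0 \<le> E h" for h
      using D t V0[of h] by (auto simp: k_def E_def)
    have [measurable]: "k \<in> borel_measurable borel" "E \<in> borel_measurable borel"
      unfolding k_def E_def by measurable
    define I where "I = (\<integral>\<^sup>+h. ennreal (k h) \<partial>\<mu>)"
    have I_pw: "I = (\<integral>\<^sup>+x. pw 2 (avg f x) \<partial>\<mu>)" by (simp add: I_def k_def pw_2 W_def)
    have sumI: "(\<integral>\<^sup>+h. ennreal (V h) \<partial>\<mu>) + I = (\<integral>\<^sup>+x. pw 2 (f x) \<partial>\<mu>)"
    proof -
      have "(\<integral>\<^sup>+h. ennreal (V h) \<partial>\<mu>) + I = (\<integral>\<^sup>+h. ennreal (V h + k h) \<partial>\<mu>)"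
        unfolding I_def using V0 kE by (subst nn_integral_add[symmetric]) (auto simp: ennreal_plus)
      also have "\<dots> = (\<integral>\<^sup>+h. \<integral>\<^sup>+s. ennreal ((f (h + s))\<^sup>2) \<partial>\<nu> \<partial>\<mu>)"
        unfolding k_def V_eq using int2 by (intro nn_integral_cong nn_integral_eq_integral[symmetric]) auto
      also have "\<dots> = (\<integral>\<^sup>+x. pw 2 (f x) \<partial>\<mu>)"
        unfolding pw_2 by (rule nn_integral_avg) measurable
      finally show ?thesis .
    qed
    have "I \<le> (\<integral>\<^sup>+x. pw 2 (f x) \<partial>\<mu>)" unfolding sumI[symmetric] by simp
    then have I_fin: "I < \<infinity>" using fin by simp
    have I_pos: "0 < I" using gap unfolding I_pw by (metis not_gr_zero zero_le)
    have IV: "(\<integral>\<^sup>+h. ennreal (V h) \<partial>\<mu>) \<le> ennreal (t\<^sup>2) * I"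
    proof -
      have "ennreal \<theta> * (\<integral>\<^sup>+x. pw 2 (f x) \<partial>\<mu>) \<le> I" using gap I_pw by simp
      then have "ennreal (1 + t\<^sup>2) * (ennreal \<theta> * (\<integral>\<^sup>+x. pw 2 (f x) \<partial>\<mu>)) \<le> ennreal (1 + t\<^sup>2) * I"
        by (rule mult_left_mono) simp
      moreover have "ennreal (1 + t\<^sup>2) * ennreal \<theta> = 1"
        using \<open>1 + t\<^sup>2 > 1\<close> \<theta> by (subst ennreal_mult[symmetric]) (auto simp: \<theta>_def)
      ultimately have "(\<integral>\<^sup>+x. pw 2 (f x) \<partial>\<mu>) \<le> ennreal (1 + t\<^sup>2) * I"
        by (simp only: mult.assoc[symmetric] mult_1_left)
      also have "\<dots> = ennreal (t\<^sup>2) * I + I" by (simp add: distrib_right add.commute)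
      finally have "(\<integral>\<^sup>+h. ennreal (V h) \<partial>\<mu>) + I \<le> ennreal (t\<^sup>2) * I + I" unfolding sumI[symmetric] .
      then show ?thesis using I_fin by (auto simp: ennreal_add_left_cancel_le add.commute[of _ I])
    qed
    have near: "k (h + x) \<le> G\<^sup>2 * k h \<and> \<bar>k h - k (h + x)\<bar> \<le> E h" if x: "len x \<le> R" for h x
    proof
      have "W (h + x) \<le> exp (a * len x) * W h"
        unfolding W_def by (rule avg_Harnack[OF _ f]) measurable
      also have "\<dots> \<le> G * W h" using Gl[OF x] W[of h] by (intro mult_right_mono) auto
      finally have W1: "W (h + x) \<le> G * W h" .
      then have "(W (h + x))\<^sup>2 \<le> (G * W h)\<^sup>2" using W[of "h + x"] by (intro power_mono) auto
      then show "k (h + x) \<le> G\<^sup>2 * k h" by (simp add: k_def power_mult_distrib)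
      let ?J = "\<integral>s. \<bar>f (h + s) - W h\<bar> \<partial>\<nu>"
      have "\<bar>W (h + x) - W h\<bar> \<le> exp (a * len x) * ?J"
        unfolding W_def by (rule avg_oscillation[OF _ int]) measurable
      also have "\<dots> \<le> G * ?J" using Gl[OF x] by (intro mult_right_mono) auto
      finally have W2: "\<bar>W h - W (h + x)\<bar> \<le> G * ?J" by (simp add: abs_minus_commute)
      have "\<bar>k h - k (h + x)\<bar> = \<bar>W h - W (h + x)\<bar> * (W h + W (h + x))"
        using W[of h] W[of "h + x"] by (simp add: k_def power2_eq_square square_diff_square_factored abs_mult)
      also have "\<dots> \<le> (G * ?J) * ((1 + G) * W h)"
        using W1 W2 W[of h] W[of "h + x"] by (intro mult_mono) (auto simp: algebra_simps)
      also have "\<dots> = D * (?J * W h)" by (simp add: D_def mult_ac)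
      \<comment> \<open>The inequality of arithmetic and geometric means, weighted by
        \<open>t\<close> because the variance is of order t squared relative to
        \<open>k\<close>.\<close>
      also have "?J * W h \<le> t * k h + V h / t"
      proof -
        have "0 \<le> (t * W h - ?J)\<^sup>2" by simp
        then have "2 * (t * (?J * W h)) \<le> t\<^sup>2 * k h + ?J\<^sup>2"
          by (simp add: k_def power2_diff power_mult_distrib mult_ac)
        also have "\<dots> \<le> t\<^sup>2 * k h + V h" using J[of h] by simp
        finally have "2 * (t * (?J * W h)) \<le> t\<^sup>2 * k h + V h" .
        moreover have "0 \<le> t * (?J * W h)"
          using t W[of h] by (intro mult_nonneg_nonneg) auto
        ultimately have "t * (?J * W h) \<le> t\<^sup>2 * k h + V h" by linarith
        then show ?thesis using t by (simp add: field_simps power2_eq_square)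
      qed
      finally show "\<bar>k h - k (h + x)\<bar> \<le> E h" using D by (simp add: E_def)
    qed
    have IE: "(\<integral>\<^sup>+h. ennreal (E h) \<partial>\<mu>) \<le> ennreal \<eta> * I"
    proof -
      have "(\<integral>\<^sup>+h. ennreal (E h) \<partial>\<mu>) = (\<integral>\<^sup>+h. ennreal (D * t) * ennreal (k h) + ennreal (D / t) * ennreal (V h) \<partial>\<mu>)"
        using D t kE V0 by (intro nn_integral_cong)
          (simp add: E_def distrib_left ennreal_plus[symmetric] ennreal_mult[symmetric] del: ennreal_plus)
      also have "\<dots> = ennreal (D * t) * I + ennreal (D / t) * (\<integral>\<^sup>+h. ennreal (V h) \<partial>\<mu>)"
        unfolding I_def by (subst nn_integral_add) (auto simp: nn_integral_cmult)
      also have "\<dots> \<le> ennreal (D * t) * I + ennreal (D / t) * (ennreal (t\<^sup>2) * I)"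
        by (intro add_left_mono mult_left_mono IV) auto
      also have "\<dots> = (ennreal (D * t) + ennreal (D / t) * ennreal (t\<^sup>2)) * I"
        by (simp add: distrib_right mult.assoc)
      also have "ennreal (D * t) + ennreal (D / t) * ennreal (t\<^sup>2) = ennreal (D * t + D / t * t\<^sup>2)"
        using D t by (simp add: ennreal_mult[symmetric] ennreal_plus[symmetric] del: ennreal_plus)
      also have "D * t + D / t * t\<^sup>2 = \<eta>" using D t by (simp add: t_def power2_eq_square field_simps)
      finally show ?thesis .
    qed
    show "\<exists>k E. k \<in> borel_measurable borel \<and> E \<in> borel_measurable borel \<and>
     (\<forall>h. 0 \<le> k h \<and> 0 \<le> E h) \<and>
     0 < (\<integral>\<^sup>+h. ennreal (k h) \<partial>\<mu>) \<and> (\<integral>\<^sup>+h. ennreal (k h) \<partial>\<mu>) < \<infinity> \<and>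
     (\<forall>h x. len x \<le> R \<longrightarrow> k (h + x) \<le> G\<^sup>2 * k h \<and> \<bar>k h - k (h + x)\<bar> \<le> E h) \<and>
     (\<integral>\<^sup>+h. ennreal (E h) \<partial>\<mu>) \<le> ennreal \<eta> * (\<integral>\<^sup>+h. ennreal (k h) \<partial>\<mu>)"
      using kE I_pos I_fin near IE \<open>k \<in> borel_measurable borel\<close> \<open>E \<in> borel_measurable borel\<close>
      unfolding I_def by blast
  qed
qed

end

section \<open>Transfer along a regular embedding\<close>

locale haar_pair = H: haar_group S\<^sub>H d\<^sub>H \<mu>\<^sub>H + G: haar_group S\<^sub>G d\<^sub>G \<mu>\<^sub>G
  for S\<^sub>H :: "'h::{topological_group_add, t2_space, second_countable_topology} set"
    and d\<^sub>H :: "'h \<Rightarrow> 'h \<Rightarrow> real" and \<mu>\<^sub>H :: "'h measure"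
    and S\<^sub>G :: "'g::{topological_group_add, t2_space, second_countable_topology} set"
    and d\<^sub>G :: "'g \<Rightarrow> 'g \<Rightarrow> real" and \<mu>\<^sub>G :: "'g measure"
begin

sublocale HG: pair_sigma_finite \<mu>\<^sub>H \<mu>\<^sub>G ..

text \<open>A regular embedding need not be measurable. Composing it with the choice of the first
  close point of a countable net moves points by less than 1, which enlarges the Lipschitz constants
  to 3L and the covering radius to r' + 1. Coverings by \<open>N\<close> balls then become bounds in
  measure.\<close>

lemma measurable_regular_embedding:
  assumes "regular_embedding d\<^sub>H d\<^sub>G f"
  shows "\<exists>\<phi> r L M. \<phi> \<in> borel_measurable borel \<and> 0 < r \<and> 0 < L \<and> 0 \<le> M \<and>
     (\<forall>x y. d\<^sub>G (\<phi> x) (\<phi> y) \<le> L * d\<^sub>H x y + L) \<and>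
     (\<forall>y. emeasure \<mu>\<^sub>H {x. d\<^sub>G y (\<phi> x) < r} \<le> ennreal M)"
proof -
  obtain r r' L N where rL: "r > 0" "r' > 0" "L > 0"
    and Lip: "\<And>x x'. d\<^sub>G (f x) (f x') \<le> L * d\<^sub>H x x' + L"
    and cov: "\<And>y. covered_by_balls d\<^sub>H N r' (f -` G.mball y r)"
    using assms unfolding regular_embedding_def by blast
  obtain z :: "nat \<Rightarrow> 'h" where z: "\<forall>x. \<exists>n. d\<^sub>H (z n) x < 1" using H.ex_countable_net[of 1] by auto
  define i where "i x = (LEAST n. d\<^sub>H (z n) x < 1)" for x
  have i [measurable]: "i \<in> measurable borel (count_space UNIV)" unfolding i_def by measurable
  have near: "d\<^sub>H (z (i x)) x < 1" for x
    unfolding i_def by (rule LeastI_ex) (use z in blast)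
  define \<phi> where "\<phi> x = f (z (i x))" for x
  have [measurable]: "\<phi> \<in> borel_measurable borel" unfolding \<phi>_def
    by (rule measurable_compose[OF i]) simp
  have "d\<^sub>G (\<phi> x) (\<phi> y) \<le> (3 * L) * d\<^sub>H x y + 3 * L" for x y
  proof -
    have "d\<^sub>H (z (i x)) (z (i y)) \<le> d\<^sub>H (z (i x)) x + (d\<^sub>H x y + d\<^sub>H y (z (i y)))"
      using H.triangle[of "z (i x)" x "z (i y)"] H.triangle[of x y "z (i y)"] by simp
    also have "\<dots> \<le> d\<^sub>H x y + 2" using near[of x] near[of y] H.commute[of y "z (i y)"] by simp
    finally have "L * d\<^sub>H (z (i x)) (z (i y)) \<le> L * (d\<^sub>H x y + 2)" using rL by (intro mult_left_mono) auto
    moreover have "L * d\<^sub>H x y \<ge> 0" using rL by simp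
    ultimately show ?thesis using Lip[of "z (i x)" "z (i y)"] by (simp add: \<phi>_def algebra_simps)
  qed
  moreover define M where "M = real N * measure \<mu>\<^sub>H (H.B 0 (r' + 1))"
  moreover have "emeasure \<mu>\<^sub>H {x. d\<^sub>G y (\<phi> x) < r} \<le> ennreal M" for y
  proof -
    obtain C where C: "finite C" "card C \<le> N" "f -` G.mball y r \<subseteq> (\<Union>c\<in>C. H.mball c r')"
      using cov[of y] by (auto simp: covered_by_balls_def)
    have "{x. d\<^sub>G y (\<phi> x) < r} \<subseteq> (\<Union>c\<in>C. H.mball c (r' + 1))"
    proof
      fix x assume "x \<in> {x. d\<^sub>G y (\<phi> x) < r}"
      then have "z (i x) \<in> f -` G.mball y r" by (simp add: \<phi>_def)
      then obtain c where "c \<in> C" "d\<^sub>H c (z (i x)) < r'" using C(3) by auto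
      moreover have "d\<^sub>H c x \<le> d\<^sub>H c (z (i x)) + d\<^sub>H (z (i x)) x" by (simp add: H.triangle)
      ultimately show "x \<in> (\<Union>c\<in>C. H.mball c (r' + 1))" using near[of x] by force
    qed
    then have "emeasure \<mu>\<^sub>H {x. d\<^sub>G y (\<phi> x) < r} \<le> emeasure \<mu>\<^sub>H (\<Union>c\<in>C. H.mball c (r' + 1))"
      using C(1) by (intro emeasure_mono sets.finite_UN) auto
    also have "\<dots> \<le> (\<Sum>c\<in>C. emeasure \<mu>\<^sub>H (H.mball c (r' + 1)))"
      using C(1) by (intro emeasure_subadditive_finite) auto
    also have "\<dots> = (\<Sum>c\<in>C. emeasure \<mu>\<^sub>H (H.mball 0 (r' + 1)))" by (intro sum.cong refl H.emeasure_ball)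
    also have "\<dots> = ennreal (real (card C) * measure \<mu>\<^sub>H (H.B 0 (r' + 1)))"
      using H.emeasure_ball_finite[of 0 "r' + 1"]
      by (simp add: emeasure_eq_ennreal_measure ennreal_of_nat_eq_real_of_nat ennreal_mult')
    also have "\<dots> \<le> ennreal M" unfolding M_def using C(2) by (intro ennreal_leI mult_right_mono) auto
    finally show ?thesis .
  qed
  ultimately show ?thesis
    using rL \<open>\<phi> \<in> borel_measurable borel\<close> by (intro exI[of _ \<phi>] exI[of _ r] exI[of _ "3 * L"] exI[of _ M]) auto
qed

text \<open>Double counting of the pairs of \<open>h\<close> in the support and \<open>g\<close> in
  \<open>A\<close> at distance less than \<open>r\<close> from \<open>y + \<phi> h\<close>. Every
  such \<open>h\<close> sees a full ball inside \<open>A\<close>, and every \<open>g\<close> is seen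
  by a set of measure at most \<open>M\<close>.\<close>

lemma support_transfer:
  assumes [measurable]: "\<phi> \<in> borel_measurable borel" "u \<in> borel_measurable borel" "A \<in> sets borel"
    and M: "\<And>y. emeasure \<mu>\<^sub>H {x. d\<^sub>G y (\<phi> x) < r} \<le> ennreal M"
    and A: "\<And>g x. u g \<noteq> (0 :: real) \<Longrightarrow> G.len x \<le> r \<Longrightarrow> g + x \<in> A"
  shows "emeasure \<mu>\<^sub>H {h. u (y + \<phi> h) \<noteq> 0} * emeasure \<mu>\<^sub>G (G.B 0 r) \<le> ennreal M * emeasure \<mu>\<^sub>G A"
proof -
  define T where "T h g = (if d\<^sub>G (y + \<phi> h) g < r \<and> g \<in> A then 1 else 0 :: ennreal)" for h g
  have [measurable]: "(\<lambda>(h, g). T h g) \<in> borel_measurable (\<mu>\<^sub>H \<Otimes>\<^sub>M \<mu>\<^sub>G)" unfolding T_def by measurable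
  have [measurable]: "{h. u (y + \<phi> h) \<noteq> 0} \<in> sets borel" by measurable
  have "emeasure \<mu>\<^sub>H {h. u (y + \<phi> h) \<noteq> 0} * emeasure \<mu>\<^sub>G (G.B 0 r)
      = (\<integral>\<^sup>+h. emeasure \<mu>\<^sub>G (G.B 0 r) * indicator {h. u (y + \<phi> h) \<noteq> 0} h \<partial>\<mu>\<^sub>H)"
    by (subst nn_integral_cmult_indicator) (auto simp: mult.commute)
  also have "\<dots> \<le> (\<integral>\<^sup>+h. \<integral>\<^sup>+g. T h g \<partial>\<mu>\<^sub>G \<partial>\<mu>\<^sub>H)"
  proof (intro nn_integral_mono)
    fix h
    show "emeasure \<mu>\<^sub>G (G.B 0 r) * indicator {h. u (y + \<phi> h) \<noteq> 0} h \<le> (\<integral>\<^sup>+g. T h g \<partial>\<mu>\<^sub>G)"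
    proof (cases "u (y + \<phi> h) = 0")
      case False
      have "g \<in> A" if "d\<^sub>G (y + \<phi> h) g < r" for g
        using A[OF False, of "- (y + \<phi> h) + g"] that G.dist_len[of "y + \<phi> h" g] by (simp flip: add.assoc)
      then have "(\<integral>\<^sup>+g. T h g \<partial>\<mu>\<^sub>G) = (\<integral>\<^sup>+g. indicator (G.B (y + \<phi> h) r) g \<partial>\<mu>\<^sub>G)"
        by (intro nn_integral_cong) (auto simp: T_def split: split_indicator)
      then show ?thesis using False G.emeasure_ball[of "y + \<phi> h" r] by simp
    qed simp
  qed
  also have "\<dots> = (\<integral>\<^sup>+g. \<integral>\<^sup>+h. T h g \<partial>\<mu>\<^sub>H \<partial>\<mu>\<^sub>G)" by (rule HG.Fubini'[symmetric]) measurable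
  also have "\<dots> \<le> (\<integral>\<^sup>+g. ennreal M * indicator A g \<partial>\<mu>\<^sub>G)"
  proof (intro nn_integral_mono)
    fix g
    have eq: "d\<^sub>G (y + \<phi> h) g = d\<^sub>G (- y + g) (\<phi> h)" for h
      using G.dist_left[of "- y" "y + \<phi> h" g] G.commute by (simp flip: add.assoc)
    have [measurable]: "{h. d\<^sub>G (- y + g) (\<phi> h) < r} \<in> sets borel" by measurable
    have "(\<integral>\<^sup>+h. T h g \<partial>\<mu>\<^sub>H) = (\<integral>\<^sup>+h. indicator A g * indicator {h. d\<^sub>G (- y + g) (\<phi> h) < r} h \<partial>\<mu>\<^sub>H)"
      by (intro nn_integral_cong) (auto simp: T_def eq split: split_indicator)
    also have "\<dots> = indicator A g * emeasure \<mu>\<^sub>H {h. d\<^sub>G (- y + g) (\<phi> h) < r}"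
      by (rule nn_integral_cmult_indicator) simp
    also have "\<dots> \<le> indicator A g * ennreal M" by (intro mult_left_mono M) auto
    finally show "(\<integral>\<^sup>+h. T h g \<partial>\<mu>\<^sub>H) \<le> ennreal M * indicator A g" by (simp add: mult.commute)
  qed
  also have "\<dots> = ennreal M * emeasure \<mu>\<^sub>G A" by (rule nn_integral_cmult_indicator) simp
  finally show ?thesis .
qed

text \<open>Product rule and averaging over \<open>y\<close>. The bound \<open>Q y\<close> for the
  gradient contains no generator, so a single \<open>y\<close> serves all of them at once. The
  strict inequality for \<open>B\<close> is what makes such a \<open>y\<close> exist.\<close>

lemma transfer_function:
  assumes [measurable]: "\<phi> \<in> borel_measurable borel" "u \<in> borel_measurable borel"
      "V \<in> borel_measurable borel" "k \<in> borel_measurable borel" "E \<in> borel_measurable borel"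
    and p: "1 \<le> p" and C: "0 \<le> C" and kE: "\<And>h. 0 \<le> k h" "\<And>h. 0 \<le> E h"
    and near: "\<And>h t. t \<in> S\<^sub>H \<Longrightarrow> k (h + t) \<le> C * k h \<and> \<bar>k h - k (h + t)\<bar> \<le> E h"
    and osc: "\<And>y h t. t \<in> S\<^sub>H \<Longrightarrow> pw p (u (y + \<phi> h) - u (y + \<phi> (h + t))) \<le> V (y + \<phi> h)"
    and Ik: "(\<integral>\<^sup>+h. ennreal (k h) \<partial>\<mu>\<^sub>H) = ennreal I" "0 < I"
    and Iu: "(\<integral>\<^sup>+g. pw p (u g) \<partial>\<mu>\<^sub>G) = ennreal U" "0 < U"
    and IV: "(\<integral>\<^sup>+g. V g \<partial>\<mu>\<^sub>G) \<le> ennreal W" "0 \<le> W"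
    and IE: "(\<integral>\<^sup>+h. ennreal (E h) \<partial>\<mu>\<^sub>H) \<le> ennreal (\<eta> * I)" "0 \<le> \<eta>"
    and B: "2 powr p * (C * W / U + \<eta>) < B"
  shows "\<exists>y F n. F \<in> borel_measurable borel \<and> (\<forall>h. u (y + \<phi> h) = 0 \<longrightarrow> F h = 0) \<and> 0 < n \<and>
    (\<integral>\<^sup>+h. pw p (F h) \<partial>\<mu>\<^sub>H) = ennreal n \<and>
    (\<forall>t\<in>S\<^sub>H. (\<integral>\<^sup>+h. pw p (F h - F (h + t)) \<partial>\<mu>\<^sub>H) \<le> ennreal (B * n))"
proof -
  define c2 where "c2 = 2 powr p"
  have c2: "c2 > 0" by (simp add: c2_def)
  \<comment> \<open>The quotient of the integrals of \<open>Q\<close> and \<open>N\<close>, up to an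
    upper bound.\<close>
  define B\<^sub>0 where "B\<^sub>0 = c2 * (C * W / U + \<eta>)"
  have B0: "0 \<le> B\<^sub>0" "B\<^sub>0 < B" using c2 C IV IE Iu B by (auto simp: B\<^sub>0_def c2_def)
  define \<psi> where "\<psi> h = k h powr (1 / p)" for h
  have [measurable]: "\<psi> \<in> borel_measurable borel" unfolding \<psi>_def by measurable
  have \<psi>_p: "\<psi> h powr p = k h" and \<psi>0: "0 \<le> \<psi> h" for h using kE(1)[of h] p by (auto simp: \<psi>_def powr_powr)
  have pw_\<psi>: "pw p (\<psi> h) = ennreal (k h)" for h using \<psi>_p \<psi>0 by (simp add: pw_def)
  define N where "N y = (\<integral>\<^sup>+h. ennreal (k h) * pw p (u (y + \<phi> h)) \<partial>\<mu>\<^sub>H)" for y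
  define Q where "Q y = (\<integral>\<^sup>+h. ennreal c2 * (ennreal (C * k h) * V (y + \<phi> h) + pw p (u (y + \<phi> h)) * ennreal (E h)) \<partial>\<mu>\<^sub>H)" for y
  have [measurable]: "N \<in> borel_measurable borel" "Q \<in> borel_measurable borel" unfolding N_def Q_def by measurable
  have swap: "(\<integral>\<^sup>+y. \<integral>\<^sup>+h. \<kappa> h * G (y + \<phi> h) \<partial>\<mu>\<^sub>H \<partial>\<mu>\<^sub>G) = (\<integral>\<^sup>+h. \<kappa> h \<partial>\<mu>\<^sub>H) * (\<integral>\<^sup>+g. G g \<partial>\<mu>\<^sub>G)"
    if [measurable]: "\<kappa> \<in> borel_measurable borel" "G \<in> borel_measurable borel" for \<kappa> G
  proof -
    have "(\<integral>\<^sup>+y. \<integral>\<^sup>+h. \<kappa> h * G (y + \<phi> h) \<partial>\<mu>\<^sub>H \<partial>\<mu>\<^sub>G) = (\<integral>\<^sup>+h. \<integral>\<^sup>+y. \<kappa> h * G (y + \<phi> h) \<partial>\<mu>\<^sub>G \<partial>\<mu>\<^sub>H)"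
      by (rule HG.Fubini') measurable
    also have "\<dots> = (\<integral>\<^sup>+h. \<kappa> h * (\<integral>\<^sup>+g. G g \<partial>\<mu>\<^sub>G) \<partial>\<mu>\<^sub>H)"
      by (intro nn_integral_cong) (simp add: nn_integral_cmult G.nn_integral_right)
    also have "\<dots> = (\<integral>\<^sup>+h. \<kappa> h \<partial>\<mu>\<^sub>H) * (\<integral>\<^sup>+g. G g \<partial>\<mu>\<^sub>G)" by (rule nn_integral_multc) measurable
    finally show ?thesis .
  qed
  have IN: "(\<integral>\<^sup>+y. N y \<partial>\<mu>\<^sub>G) = ennreal (I * U)"
    unfolding N_def using Ik Iu swap[of "\<lambda>h. ennreal (k h)" "\<lambda>g. pw p (u g)"] by (simp add: ennreal_mult)
  have IQ: "(\<integral>\<^sup>+y. Q y \<partial>\<mu>\<^sub>G) \<le> ennreal (B\<^sub>0 * (I * U))"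
  proof -
    have "Q y = ennreal c2 * (ennreal C * (\<integral>\<^sup>+h. ennreal (k h) * V (y + \<phi> h) \<partial>\<mu>\<^sub>H)
        + (\<integral>\<^sup>+h. ennreal (E h) * pw p (u (y + \<phi> h)) \<partial>\<mu>\<^sub>H))" for y
      unfolding Q_def using C kE
      by (simp add: nn_integral_cmult nn_integral_add ennreal_mult mult.assoc mult.commute[of "pw p _"])
    then have "(\<integral>\<^sup>+y. Q y \<partial>\<mu>\<^sub>G) = ennreal c2 * (ennreal C * (ennreal I * (\<integral>\<^sup>+g. V g \<partial>\<mu>\<^sub>G))
        + (\<integral>\<^sup>+h. ennreal (E h) \<partial>\<mu>\<^sub>H) * ennreal U)"
      using swap[of "\<lambda>h. ennreal (k h)" V] swap[of "\<lambda>h. ennreal (E h)" "\<lambda>g. pw p (u g)"] Ik Iu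
      by (simp add: nn_integral_cmult nn_integral_add)
    also have "\<dots> \<le> ennreal c2 * (ennreal C * (ennreal I * ennreal W) + ennreal (\<eta> * I) * ennreal U)"
      using IV IE by (intro mult_left_mono add_mono mult_right_mono) auto
    also have "\<dots> = ennreal (c2 * (C * (I * W) + \<eta> * I * U))"
      using c2 C Ik Iu IV IE by (simp add: ennreal_mult ennreal_plus)
    also have "c2 * (C * (I * W) + \<eta> * I * U) = B\<^sub>0 * (I * U)"
      using Iu by (simp add: B\<^sub>0_def field_simps)
    finally show ?thesis .
  qed
  have "\<exists>y. 0 < N y \<and> N y < \<infinity> \<and> Q y \<le> ennreal B * N y"
  \<comment> \<open>Otherwise \<open>Q\<close> is at least \<open>B * N\<close> almost everywhere,
    since \<open>N\<close> has a finite integral; integration contradicts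
    \<open>B\<^sub>0 < B\<close>.\<close>
  proof (rule ccontr)
    assume "\<nexists>y. 0 < N y \<and> N y < \<infinity> \<and> Q y \<le> ennreal B * N y"
    then have *: "N y = 0 \<or> N y = \<infinity> \<or> ennreal B * N y \<le> Q y" for y
      by (metis infinity_ennreal_def less_top linear not_gr_zero)
    have "AE y in \<mu>\<^sub>G. N y \<noteq> \<infinity>" by (rule nn_integral_noteq_infinite) (auto simp: IN)
    then have "AE y in \<mu>\<^sub>G. ennreal B * N y \<le> Q y" using * by (auto elim!: eventually_mono) (metis mult_zero_right zero_le)
    then have "(\<integral>\<^sup>+y. ennreal B * N y \<partial>\<mu>\<^sub>G) \<le> (\<integral>\<^sup>+y. Q y \<partial>\<mu>\<^sub>G)" by (rule nn_integral_mono_AE)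
    also have "\<dots> \<le> ennreal (B\<^sub>0 * (I * U))" by (rule IQ)
    also have "(\<integral>\<^sup>+y. ennreal B * N y \<partial>\<mu>\<^sub>G) = ennreal (B * (I * U))"
      using B0 Ik Iu by (simp add: nn_integral_cmult IN ennreal_mult)
    finally have "B * (I * U) \<le> B\<^sub>0 * (I * U)" using B0 Ik Iu by (subst (asm) ennreal_le_iff) auto
    then show False using B0 Ik Iu by simp
  qed
  then obtain y where y: "0 < N y" "N y < \<infinity>" "Q y \<le> ennreal B * N y" by blast
  define n where "n = enn2real (N y)"
  have n: "N y = ennreal n" "0 < n" using y by (auto simp: n_def enn2real_positive_iff less_top)
  define F where "F h = \<psi> h * u (y + \<phi> h)" for h
  have [measurable]: "F \<in> borel_measurable borel" unfolding F_def by measurable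
  have "(\<integral>\<^sup>+h. pw p (F h) \<partial>\<mu>\<^sub>H) = ennreal n"
    unfolding F_def pw_mult pw_\<psi> using n by (simp add: N_def)
  moreover have "(\<integral>\<^sup>+h. pw p (F h - F (h + t)) \<partial>\<mu>\<^sub>H) \<le> ennreal (B * n)" if t: "t \<in> S\<^sub>H" for t
  proof -
    have "pw p (F h - F (h + t)) \<le> ennreal c2 * (ennreal (C * k h) * V (y + \<phi> h) + pw p (u (y + \<phi> h)) * ennreal (E h))" for h
    proof -
      let ?u = "u (y + \<phi> h)" and ?u' = "u (y + \<phi> (h + t))"
      have "F h - F (h + t) = \<psi> (h + t) * (?u - ?u') + ?u * (\<psi> h - \<psi> (h + t))"
        by (simp add: F_def algebra_simps)
      then have "pw p (F h - F (h + t)) \<le> ennreal c2 * (pw p (\<psi> (h + t)) * pw p (?u - ?u') + pw p ?u * pw p (\<psi> h - \<psi> (h + t)))"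
        unfolding c2_def using pw_add_le[of p "\<psi> (h + t) * (?u - ?u')" "?u * (\<psi> h - \<psi> (h + t))"] p by (simp add: pw_mult)
      also have "\<dots> \<le> ennreal c2 * (ennreal (C * k h) * V (y + \<phi> h) + pw p ?u * ennreal (E h))"
      proof (intro mult_left_mono add_mono mult_mono)
        show "pw p (\<psi> (h + t)) \<le> ennreal (C * k h)" unfolding pw_\<psi> using near[OF t] by (intro ennreal_leI) auto
        show "pw p (?u - ?u') \<le> V (y + \<phi> h)" by (rule osc[OF t])
        have "\<bar>\<psi> h - \<psi> (h + t)\<bar> powr p \<le> \<bar>k h - k (h + t)\<bar>"
          using powr_diff_le[OF \<psi>0 \<psi>0 p, of h "h + t"] by (simp add: \<psi>_p)
        also have "\<dots> \<le> E h" using near[OF t] by auto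
        finally show "pw p (\<psi> h - \<psi> (h + t)) \<le> ennreal (E h)" unfolding pw_def by (rule ennreal_leI)
      qed auto
      finally show ?thesis .
    qed
    then have "(\<integral>\<^sup>+h. pw p (F h - F (h + t)) \<partial>\<mu>\<^sub>H) \<le> Q y" unfolding Q_def by (rule nn_integral_mono)
    also have "\<dots> \<le> ennreal (B * n)" using y n B0 by (simp add: ennreal_mult)
    finally show ?thesis .
  qed
  ultimately show ?thesis
    using n \<open>F \<in> borel_measurable borel\<close> by (intro exI[of _ y] exI[of _ F] exI[of _ n]) (auto simp: F_def)
qed

end

section \<open>Lower bounds for the profile from test functions\<close>

context haar_group
begin

lemma Lp_norm_eq:
  assumes [measurable]: "g \<in> borel_measurable borel"
    and "(\<integral>\<^sup>+x. pw p (g x) \<partial>\<mu>) = ennreal m" "0 \<le> m"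
  shows "Lp_norm \<mu> p g = m powr (1 / p)"
proof -
  have "(\<integral>x. \<bar>g x\<bar> powr p \<partial>\<mu>) = enn2real (\<integral>\<^sup>+x. pw p (g x) \<partial>\<mu>)"
    unfolding pw_def by (rule integral_eq_nn_integral) auto
  then show ?thesis using assms by (simp add: Lp_norm_def)
qed

lemma profile_ge:
  assumes [measurable]: "F \<in> borel_measurable borel" "A \<in> sets borel"
    and supp: "\<And>x. x \<notin> A \<Longrightarrow> F x = 0" and A: "emeasure \<mu> A \<le> ennreal w" and p: "1 \<le> p"
    and n: "(\<integral>\<^sup>+x. pw p (F x) \<partial>\<mu>) = ennreal n" "0 < n" and b: "0 < b"
    and grad: "\<And>t. t \<in> S \<Longrightarrow> (\<integral>\<^sup>+x. pw p (F x - F (x + t)) \<partial>\<mu>) \<le> ennreal (b * n)"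
  shows "ennreal (b powr (- 1 / p)) \<le> isoperimetric_profile \<mu> S p w"
proof -
  let ?\<Gamma> = "right_gradient_norm \<mu> S p F"
  have Lp: "in_Lp \<mu> p F"
    unfolding in_Lp_def using n by (auto simp: pw_def intro!: integrableI_bounded)
  have ne: "\<not> (AE x in \<mu>. F x = 0)"
  proof
    assume "AE x in \<mu>. F x = 0"
    then have "(\<integral>\<^sup>+x. pw p (F x) \<partial>\<mu>) = (\<integral>\<^sup>+x. 0 \<partial>\<mu>)" by (intro nn_integral_cong_AE) auto
    then show False using n by simp
  qed
  have N: "Lp_norm \<mu> p F = n powr (1 / p)" using n by (intro Lp_norm_eq) auto
  have "Lp_norm \<mu> p (\<lambda>x. F x - F (x + t)) \<le> (b * n) powr (1 / p)" if t: "t \<in> S" for t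
  proof -
    obtain m where m: "0 \<le> m" "(\<integral>\<^sup>+x. pw p (F x - F (x + t)) \<partial>\<mu>) = ennreal m" "m \<le> b * n"
      using grad[OF t] b n by (cases "\<integral>\<^sup>+x. pw p (F x - F (x + t)) \<partial>\<mu>") (auto simp: top_unique)
    then have "Lp_norm \<mu> p (\<lambda>x. F x - F (x + t)) = m powr (1 / p)" by (intro Lp_norm_eq) auto
    then show ?thesis using m p by (simp add: powr_mono2)
  qed
  then have \<Gamma>: "?\<Gamma> \<le> ennreal ((b * n) powr (1 / p))"
    unfolding right_gradient_norm_def by (intro SUP_least ennreal_leI)
  have "ennreal (b powr (- 1 / p)) \<le> ennreal (Lp_norm \<mu> p F) / ?\<Gamma>"
  \<comment> \<open>Division of a positive number by 0 gives infinity, as the definition of the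
    profile demands.\<close>
  proof (cases "?\<Gamma> = 0")
    case True
    then show ?thesis using n by (simp add: N)
  next
    case False
    then obtain s where s: "?\<Gamma> = ennreal s" "0 < s" "s \<le> (b * n) powr (1 / p)"
      using \<Gamma> by (cases ?\<Gamma>) (auto simp: top_unique less_le)
    have "b powr (- 1 / p) = n powr (1 / p) / (b * n) powr (1 / p)"
      using b n by (simp add: powr_mult powr_minus_divide)
    also have "\<dots> \<le> n powr (1 / p) / s" using s b n by (intro divide_left_mono) auto
    finally show ?thesis using s by (simp add: N divide_ennreal ennreal_leI)
  qed
  also have "\<dots> \<le> J_set \<mu> S p A" unfolding J_set_def using Lp ne supp by (intro SUP_upper) auto
  also have "\<dots> \<le> isoperimetric_profile \<mu> S p w"
    unfolding isoperimetric_profile_def using A by (intro SUP_upper) auto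
  finally show ?thesis .
qed

text \<open>The indicator of a unit ball is a test function whose gradient has p-th power at most
  twice that of its norm. This constant absorbs functions with a bounded quotient.\<close>

lemma profile_ge_const:
  assumes p: "1 \<le> p" and w: "measure \<mu> (B 0 1) \<le> w"
  shows "ennreal (2 powr (- 1 / p)) \<le> isoperimetric_profile \<mu> S p w"
proof -
  define b where "b = measure \<mu> (B 0 1)"
  have b: "emeasure \<mu> (B 0 1) = ennreal b"
    using emeasure_ball_finite[of 0 1] by (simp add: b_def emeasure_eq_ennreal_measure)
  have b0: "0 < b" using emeasure_ball_pos[of 1 0] b by simp
  have n: "(\<integral>\<^sup>+x. pw p (indicator (B 0 1) x) \<partial>\<mu>) = ennreal b"
  proof -
    have "(\<integral>\<^sup>+x. pw p (indicator (B 0 1) x) \<partial>\<mu>) = (\<integral>\<^sup>+x. indicator (B 0 1) x \<partial>\<mu>)"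
      by (intro nn_integral_cong) (auto simp: pw_def split: split_indicator)
    then show ?thesis using b by simp
  qed
  show ?thesis
  proof (rule profile_ge[where F = "indicator (B 0 1)" and A = "B 0 1" and n = b])
    fix t
    have "(\<integral>\<^sup>+x. pw p (indicator (B 0 1) x - indicator (B 0 1) (x + t)) \<partial>\<mu>)
        \<le> (\<integral>\<^sup>+x. pw p (indicator (B 0 1) x) + pw p (indicator (B 0 1) (x + t)) \<partial>\<mu>)"
      by (intro nn_integral_mono) (auto simp: pw_def split: split_indicator)
    also have "\<dots> = ennreal b + ennreal b"
      using n nn_integral_right[of "\<lambda>x. pw p (indicator (B 0 1) x)" t] by (subst nn_integral_add) auto
    also have "\<dots> = ennreal (2 * b)" using b0 by (simp flip: ennreal_plus)
    finally show "(\<integral>\<^sup>+x. pw p (indicator (B 0 1) x - indicator (B 0 1) (x + t)) \<partial>\<mu>) \<le> ennreal (2 * b)" .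
  qed (use b b0 n p w in \<open>auto simp: b_def ennreal_leI\<close>)
qed

end

section \<open>Comparison of the two profiles\<close>

context haar_pair
begin

text \<open>\<open>K\<close> precedes all data of \<open>f\<close>. The condition
  \<open>2 * K * \<gamma> \<le> n\<close> ensures that truncation does not destroy \<open>f\<close>,
  and \<epsilon> pays for the density being only almost invariant.\<close>

lemma transfer_profile:
  assumes emb: "regular_embedding d\<^sub>H d\<^sub>G f\<^sub>0" and mean: "left_invariant_mean \<mu>\<^sub>H M\<^sub>0" and p: "1 \<le> p"
  shows "\<exists>K>0. \<forall>f A \<gamma> n \<epsilon> v. f \<in> borel_measurable borel \<longrightarrow> A \<in> sets borel \<longrightarrow> (\<forall>x. x \<notin> A \<longrightarrow> f x = 0) \<longrightarrow>
     (\<integral>\<^sup>+x. pw p (f x) \<partial>\<mu>\<^sub>G) = ennreal n \<longrightarrow> 0 < n \<longrightarrow> 0 \<le> \<gamma> \<longrightarrow>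
     (\<forall>t\<in>S\<^sub>G. (\<integral>\<^sup>+x. pw p (f x - f (x + t)) \<partial>\<mu>\<^sub>G) \<le> ennreal \<gamma>) \<longrightarrow> 2 * K * \<gamma> \<le> n \<longrightarrow> 0 < \<epsilon> \<longrightarrow>
     emeasure \<mu>\<^sub>G A \<le> ennreal v \<longrightarrow> 0 \<le> v \<longrightarrow>
     ennreal ((K * \<gamma> / n + \<epsilon>) powr (- 1 / p)) \<le> isoperimetric_profile \<mu>\<^sub>H S\<^sub>H p (K * v)"
proof -
  obtain \<phi> r L M where \<phi> [measurable]: "\<phi> \<in> borel_measurable borel" and r: "0 < r" "0 < L" "0 \<le> M"
    and Lip: "\<And>x y. d\<^sub>G (\<phi> x) (\<phi> y) \<le> L * d\<^sub>H x y + L"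
    and pre: "\<And>y. emeasure \<mu>\<^sub>H {x. d\<^sub>G y (\<phi> x) < r} \<le> ennreal M"
    using measurable_regular_embedding[OF emb] by auto
  obtain R\<^sub>H where RH: "R\<^sub>H > 0" "\<And>t. t \<in> S\<^sub>H \<Longrightarrow> H.len t \<le> R\<^sub>H" using H.generators_bounded by auto
  \<comment> \<open>\<open>r\<close> is needed for the support estimate,
    \<open>L * R\<^sub>H + L\<close> for the displacement of \<open>\<phi>\<close> along a
    generator.\<close>
  define R where "R = max r (L * R\<^sub>H + L)"
  have R: "0 \<le> R" "r \<le> R" "L * R\<^sub>H + L \<le> R" using r by (auto simp: R_def)
  obtain K\<^sub>1 where K1: "0 < K\<^sub>1" and trunc: "\<And>f A \<gamma>. f \<in> borel_measurable borel \<Longrightarrow> A \<in> sets borel \<Longrightarrow> (\<integral>\<^sup>+x. pw p (f x) \<partial>\<mu>\<^sub>G) < \<infinity> \<Longrightarrow>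
      (\<And>x. x \<notin> A \<Longrightarrow> f x = 0) \<Longrightarrow> 0 \<le> \<gamma> \<Longrightarrow>
      (\<And>t. t \<in> S\<^sub>G \<Longrightarrow> (\<integral>\<^sup>+g. pw p (f g - f (g + t)) \<partial>\<mu>\<^sub>G) \<le> ennreal \<gamma>) \<Longrightarrow>
      \<exists>u V A'. u \<in> borel_measurable borel \<and> V \<in> borel_measurable borel \<and> A' \<in> sets borel \<and>
        (\<forall>g x. G.len x \<le> R \<longrightarrow> pw p (u g - u (g + x)) \<le> V g) \<and>
        (\<integral>\<^sup>+x. V x \<partial>\<mu>\<^sub>G) \<le> ennreal (K\<^sub>1 * \<gamma>) \<and>
        (\<integral>\<^sup>+x. pw p (f x) \<partial>\<mu>\<^sub>G) \<le> ennreal K\<^sub>1 * ((\<integral>\<^sup>+x. pw p (u x) \<partial>\<mu>\<^sub>G) + ennreal \<gamma>) \<and>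
        (\<integral>\<^sup>+x. pw p (u x) \<partial>\<mu>\<^sub>G) \<le> (\<integral>\<^sup>+x. pw p (f x) \<partial>\<mu>\<^sub>G) \<and>
        (\<forall>g x. u g \<noteq> 0 \<longrightarrow> G.len x \<le> R \<longrightarrow> g + x \<in> A') \<and>
        emeasure \<mu>\<^sub>G A' \<le> ennreal K\<^sub>1 * emeasure \<mu>\<^sub>G A"
    by (rule G.smooth_truncation[OF p R(1)]) blast
  obtain C where C: "C > 0" and folner: "\<forall>\<eta>>0. \<exists>k E. k \<in> borel_measurable borel \<and> E \<in> borel_measurable borel \<and>
     (\<forall>h. 0 \<le> k h \<and> 0 \<le> E h) \<and>
     0 < (\<integral>\<^sup>+h. ennreal (k h) \<partial>\<mu>\<^sub>H) \<and> (\<integral>\<^sup>+h. ennreal (k h) \<partial>\<mu>\<^sub>H) < \<infinity> \<and>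
     (\<forall>h x. H.len x \<le> R\<^sub>H \<longrightarrow> k (h + x) \<le> C * k h \<and> \<bar>k h - k (h + x)\<bar> \<le> E h) \<and>
     (\<integral>\<^sup>+h. ennreal (E h) \<partial>\<mu>\<^sub>H) \<le> ennreal \<eta> * (\<integral>\<^sup>+h. ennreal (k h) \<partial>\<mu>\<^sub>H)"
    using H.almost_invariant_density[OF mean less_imp_le[OF RH(1)]] by (elim exE conjE) (rule that)
  define \<beta> where "\<beta> = measure \<mu>\<^sub>G (G.B 0 r)"
  have \<beta>: "emeasure \<mu>\<^sub>G (G.B 0 r) = ennreal \<beta>"
    using G.emeasure_ball_finite[of 0 r] by (simp add: \<beta>_def emeasure_eq_ennreal_measure)
  have \<beta>0: "0 < \<beta>" using G.emeasure_ball_pos[OF r(1), of 0] \<beta> by simp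
  define c2 where "c2 = 2 powr p"
  have c2: "c2 > 0" by (simp add: c2_def)
  \<comment> \<open>The summands serve the norm of \<open>u\<close>, the gradient and the volume of
    the support, respectively.\<close>
  define K where "K = K\<^sub>1 + c2 * (C * (2 * K\<^sub>1\<^sup>2)) + M * K\<^sub>1 / \<beta>"
  have Kparts: "0 \<le> c2 * (C * (2 * K\<^sub>1\<^sup>2))" "0 \<le> M * K\<^sub>1 / \<beta>" using c2 C K1 r \<beta>0 by auto
  then have K: "K\<^sub>1 \<le> K" "c2 * (C * (2 * K\<^sub>1\<^sup>2)) \<le> K" "M * K\<^sub>1 / \<beta> \<le> K" "0 < K"
    using K1 unfolding K_def by linarith+
  show ?thesis
  proof (intro exI[of _ K] conjI allI impI)
    fix f :: "'g \<Rightarrow> real" and A and \<gamma> n \<epsilon> v :: real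
    assume [measurable]: "f \<in> borel_measurable borel" "A \<in> sets borel"
      and supp: "\<forall>x. x \<notin> A \<longrightarrow> f x = 0" and n: "(\<integral>\<^sup>+x. pw p (f x) \<partial>\<mu>\<^sub>G) = ennreal n" "0 < n"
      and \<gamma>: "0 \<le> \<gamma>" and grad: "\<forall>t\<in>S\<^sub>G. (\<integral>\<^sup>+x. pw p (f x - f (x + t)) \<partial>\<mu>\<^sub>G) \<le> ennreal \<gamma>"
      and small: "2 * K * \<gamma> \<le> n" and \<epsilon>: "0 < \<epsilon>" and v: "emeasure \<mu>\<^sub>G A \<le> ennreal v" "0 \<le> v"
    obtain u V A' where [measurable]: "u \<in> borel_measurable borel" "V \<in> borel_measurable borel" "A' \<in> sets borel"
      and osc: "\<And>g x. G.len x \<le> R \<Longrightarrow> pw p (u g - u (g + x)) \<le> V g"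
      and IV: "(\<integral>\<^sup>+x. V x \<partial>\<mu>\<^sub>G) \<le> ennreal (K\<^sub>1 * \<gamma>)"
      and fu: "(\<integral>\<^sup>+x. pw p (f x) \<partial>\<mu>\<^sub>G) \<le> ennreal K\<^sub>1 * ((\<integral>\<^sup>+x. pw p (u x) \<partial>\<mu>\<^sub>G) + ennreal \<gamma>)"
      and uf: "(\<integral>\<^sup>+x. pw p (u x) \<partial>\<mu>\<^sub>G) \<le> (\<integral>\<^sup>+x. pw p (f x) \<partial>\<mu>\<^sub>G)"
      and A': "\<And>g x. u g \<noteq> 0 \<Longrightarrow> G.len x \<le> R \<Longrightarrow> g + x \<in> A'"
      and mA': "emeasure \<mu>\<^sub>G A' \<le> ennreal K\<^sub>1 * emeasure \<mu>\<^sub>G A"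
      using trunc[of f A \<gamma>] supp grad n \<gamma> by (auto simp: \<gamma>)
    obtain U where U: "0 \<le> U" "(\<integral>\<^sup>+x. pw p (u x) \<partial>\<mu>\<^sub>G) = ennreal U"
      using uf n by (cases "\<integral>\<^sup>+x. pw p (u x) \<partial>\<mu>\<^sub>G") (auto simp: top_unique)
    have "ennreal n \<le> ennreal (K\<^sub>1 * (U + \<gamma>))"
      using fu n U K1 \<gamma> by (simp add: ennreal_mult')
    then have "n \<le> K\<^sub>1 * (U + \<gamma>)" using K1 U \<gamma> by (subst (asm) ennreal_le_iff) auto
    \<comment> \<open>The gradient term takes at most half of \<open>n\<close>, so the other half is
      bounded by \<open>K\<^sub>1 * U\<close>.\<close>
    moreover have "2 * (K\<^sub>1 * \<gamma>) \<le> n" using small mult_right_mono[OF K(1) \<gamma>] by simp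
    ultimately have nU: "n \<le> 2 * K\<^sub>1 * U" by (simp add: distrib_left)
    then have U0: "0 < U" using n K1 U(1) by (cases "U = 0") auto
    define \<eta> where "\<eta> = \<epsilon> / (c2 + 1)"
    have \<eta>: "0 < \<eta>" "c2 * \<eta> < \<epsilon>" using \<epsilon> c2 by (auto simp: \<eta>_def field_simps)
    obtain k E where [measurable]: "k \<in> borel_measurable borel" "E \<in> borel_measurable borel"
      and kE: "\<And>h. 0 \<le> k h" "\<And>h. 0 \<le> E h"
      and Ik: "0 < (\<integral>\<^sup>+h. ennreal (k h) \<partial>\<mu>\<^sub>H)" "(\<integral>\<^sup>+h. ennreal (k h) \<partial>\<mu>\<^sub>H) < \<infinity>"
      and near: "\<And>h x. H.len x \<le> R\<^sub>H \<Longrightarrow> k (h + x) \<le> C * k h \<and> \<bar>k h - k (h + x)\<bar> \<le> E h"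
      and IE: "(\<integral>\<^sup>+h. ennreal (E h) \<partial>\<mu>\<^sub>H) \<le> ennreal \<eta> * (\<integral>\<^sup>+h. ennreal (k h) \<partial>\<mu>\<^sub>H)"
      using folner[rule_format, OF \<eta>(1)] by (elim exE conjE) blast
    obtain I where I: "(\<integral>\<^sup>+h. ennreal (k h) \<partial>\<mu>\<^sub>H) = ennreal I" "0 < I"
      using Ik by (cases "\<integral>\<^sup>+h. ennreal (k h) \<partial>\<mu>\<^sub>H") auto
    have osc': "pw p (u (y + \<phi> h) - u (y + \<phi> (h + t))) \<le> V (y + \<phi> h)" if t: "t \<in> S\<^sub>H" for y h t
    proof -
      have "d\<^sub>H h (h + t) = H.len t" using H.dist_len[of h "h + t"] by (simp flip: add.assoc)
      then have "d\<^sub>G (\<phi> h) (\<phi> (h + t)) \<le> L * H.len t + L" using Lip[of h "h + t"] by simp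
      also have "\<dots> \<le> R" using R(3) mult_left_mono[OF RH(2)[OF t] less_imp_le[OF r(2)]] by linarith
      finally have "G.len (- \<phi> h + \<phi> (h + t)) \<le> R" using G.dist_len by metis
      from osc[OF this, of "y + \<phi> h"] show ?thesis by (simp add: add.assoc flip: add.assoc[of "\<phi> h"])
    qed
    have B: "c2 * (C * (K\<^sub>1 * \<gamma>) / U + \<eta>) < K * \<gamma> / n + \<epsilon>"
    proof -
      have "C * (K\<^sub>1 * \<gamma>) / U \<le> C * (K\<^sub>1 * \<gamma>) / (n / (2 * K\<^sub>1))"
        using nU n K1 U0 C \<gamma> by (intro divide_left_mono) (auto simp: field_simps)
      then have "c2 * (C * (K\<^sub>1 * \<gamma>) / U) \<le> c2 * (C * (K\<^sub>1 * \<gamma>) / (n / (2 * K\<^sub>1)))"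
        using c2 by (intro mult_left_mono) auto
      also have "\<dots> = c2 * (C * (2 * K\<^sub>1\<^sup>2)) * (\<gamma> / n)"
        using K1 n by (simp add: field_simps power2_eq_square)
      also have "\<dots> \<le> K * (\<gamma> / n)" using K(2) \<gamma> n by (intro mult_right_mono) auto
      finally show ?thesis using \<eta>(2) by (simp add: distrib_left)
    qed
    have "\<exists>y F n'. F \<in> borel_measurable borel \<and> (\<forall>h. u (y + \<phi> h) = 0 \<longrightarrow> F h = 0) \<and> 0 < n' \<and>
      (\<integral>\<^sup>+h. pw p (F h) \<partial>\<mu>\<^sub>H) = ennreal n' \<and>
      (\<forall>t\<in>S\<^sub>H. (\<integral>\<^sup>+h. pw p (F h - F (h + t)) \<partial>\<mu>\<^sub>H) \<le> ennreal ((K * \<gamma> / n + \<epsilon>) * n'))"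
    proof (rule transfer_function[where V = V and k = k and E = E and C = C and I = I and U = U
          and W = "K\<^sub>1 * \<gamma>" and \<eta> = \<eta>])
      show "(\<integral>\<^sup>+h. ennreal (E h) \<partial>\<mu>\<^sub>H) \<le> ennreal (\<eta> * I)"
        using IE I \<eta> by (simp add: ennreal_mult)
      show "2 powr p * (C * (K\<^sub>1 * \<gamma>) / U + \<eta>) < K * \<gamma> / n + \<epsilon>" using B by (simp add: c2_def)
      show "k (h + t) \<le> C * k h \<and> \<bar>k h - k (h + t)\<bar> \<le> E h" if "t \<in> S\<^sub>H" for h t
        using near RH(2)[OF that] by blast
    qed (use p C kE osc' I U U0 IV K1 \<gamma> \<eta> in \<open>auto simp: less_imp_le\<close>)
    then obtain y F n' where [measurable]: "F \<in> borel_measurable borel"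
      and F: "\<And>h. u (y + \<phi> h) = 0 \<Longrightarrow> F h = 0" "0 < n'" "(\<integral>\<^sup>+h. pw p (F h) \<partial>\<mu>\<^sub>H) = ennreal n'"
        "\<And>t. t \<in> S\<^sub>H \<Longrightarrow> (\<integral>\<^sup>+h. pw p (F h - F (h + t)) \<partial>\<mu>\<^sub>H) \<le> ennreal ((K * \<gamma> / n + \<epsilon>) * n')"
      by blast
    define Q where "Q = {h. u (y + \<phi> h) \<noteq> 0}"
    have [measurable]: "Q \<in> sets borel" unfolding Q_def by measurable
    have "emeasure \<mu>\<^sub>H Q * ennreal \<beta> \<le> ennreal M * emeasure \<mu>\<^sub>G A'"
      unfolding Q_def \<beta>[symmetric] using A' R(2) by (intro support_transfer pre) auto
    also have "\<dots> \<le> ennreal M * (ennreal K\<^sub>1 * ennreal v)"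
      using order_trans[OF mA' mult_left_mono[OF v(1)]] by (intro mult_left_mono) auto
    also have "\<dots> = ennreal (M * K\<^sub>1 * v)" using r K1 v by (simp add: ennreal_mult mult.assoc)
    finally have "emeasure \<mu>\<^sub>H Q * ennreal \<beta> * ennreal (1 / \<beta>) \<le> ennreal (M * K\<^sub>1 * v) * ennreal (1 / \<beta>)"
      by (rule mult_right_mono) simp
    also have "emeasure \<mu>\<^sub>H Q * ennreal \<beta> * ennreal (1 / \<beta>) = emeasure \<mu>\<^sub>H Q"
      using \<beta>0 by (simp add: mult.assoc ennreal_mult[symmetric])
    also have "ennreal (M * K\<^sub>1 * v) * ennreal (1 / \<beta>) = ennreal (M * K\<^sub>1 / \<beta> * v)"
      using \<beta>0 r K1 v by (subst ennreal_mult[symmetric]) auto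
    also have "\<dots> \<le> ennreal (K * v)" using K(3) v by (intro ennreal_leI mult_right_mono)
    finally have Q: "emeasure \<mu>\<^sub>H Q \<le> ennreal (K * v)" .
    have Bpos: "0 < K * \<gamma> / n + \<epsilon>" using K \<gamma> n \<epsilon> by (intro add_nonneg_pos) auto
    show "ennreal ((K * \<gamma> / n + \<epsilon>) powr (- 1 / p)) \<le> isoperimetric_profile \<mu>\<^sub>H S\<^sub>H p (K * v)"
      by (rule H.profile_ge[OF _ _ _ Q p F(3,2) Bpos F(4)]) (use F(1) in \<open>auto simp: Q_def\<close>)
  qed (use K in auto)
qed

lemma profile_dominated:
  assumes emb: "regular_embedding d\<^sub>H d\<^sub>G f\<^sub>0" and mean: "left_invariant_mean \<mu>\<^sub>H M\<^sub>0" and p: "1 \<le> p"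
  shows "isoperimetric_profile \<mu>\<^sub>G S\<^sub>G p \<preceq>\<^sub>a isoperimetric_profile \<mu>\<^sub>H S\<^sub>H p"
proof -
  let ?j = "isoperimetric_profile \<mu>\<^sub>H S\<^sub>H p"
  obtain K where K: "K > 0" and transfer: "\<And>f A \<gamma> n \<epsilon> v. f \<in> borel_measurable borel \<Longrightarrow> A \<in> sets borel \<Longrightarrow> \<forall>x. x \<notin> A \<longrightarrow> f x = 0 \<Longrightarrow>
     (\<integral>\<^sup>+x. pw p (f x) \<partial>\<mu>\<^sub>G) = ennreal n \<Longrightarrow> 0 < n \<Longrightarrow> 0 \<le> \<gamma> \<Longrightarrow>
     \<forall>t\<in>S\<^sub>G. (\<integral>\<^sup>+x. pw p (f x - f (x + t)) \<partial>\<mu>\<^sub>G) \<le> ennreal \<gamma> \<Longrightarrow> 2 * K * \<gamma> \<le> n \<Longrightarrow> 0 < \<epsilon> \<Longrightarrow>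
     emeasure \<mu>\<^sub>G A \<le> ennreal v \<Longrightarrow> 0 \<le> v \<Longrightarrow>
     ennreal ((K * \<gamma> / n + \<epsilon>) powr (- 1 / p)) \<le> ?j (K * v)"
    using transfer_profile[OF assms] by (elim exE conjE) simp
  \<comment> \<open>(2K)^(1/p) would do when truncation succeeds; the extra 2^(1/p) cancels the
    constant of the unit ball in the other case.\<close>
  define D where "D = (4 * K) powr (1 / p)"
  have D: "D > 0" using K by (simp add: D_def)
  have main: "ennreal (Lp_norm \<mu>\<^sub>G p f) / right_gradient_norm \<mu>\<^sub>G S\<^sub>G p f \<le> ennreal D * ?j (K * v)"
    if big: "measure \<mu>\<^sub>H (H.B 0 1) \<le> K * v" and v: "0 \<le> v" and A [measurable]: "A \<in> sets borel"
      and Av: "emeasure \<mu>\<^sub>G A \<le> ennreal v" and Lp: "in_Lp \<mu>\<^sub>G p f" and ne: "\<not> (AE x in \<mu>\<^sub>G. f x = 0)"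
      and supp: "\<forall>x. x \<notin> A \<longrightarrow> f x = 0" for v A f
  proof (cases "right_gradient_norm \<mu>\<^sub>G S\<^sub>G p f = \<infinity>")
    case False
    then obtain s where s: "right_gradient_norm \<mu>\<^sub>G S\<^sub>G p f = ennreal s" "0 \<le> s"
      by (cases "right_gradient_norm \<mu>\<^sub>G S\<^sub>G p f") auto
    have [measurable]: "f \<in> borel_measurable borel"
      using Lp by (simp add: in_Lp_def measurable_cong_sets[OF G.sets_mu refl])
    define n where "n = (\<integral>x. \<bar>f x\<bar> powr p \<partial>\<mu>\<^sub>G)"
    have n: "0 \<le> n" "(\<integral>\<^sup>+x. pw p (f x) \<partial>\<mu>\<^sub>G) = ennreal n"
      using Lp by (auto simp: n_def pw_def in_Lp_def intro!: nn_integral_eq_integral)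
    have n0: "0 < n"
    proof (rule ccontr)
      assume "\<not> 0 < n"
      then have "(\<integral>\<^sup>+x. pw p (f x) \<partial>\<mu>\<^sub>G) = 0" using n by simp
      then have "AE x in \<mu>\<^sub>G. pw p (f x) = 0" by (subst (asm) nn_integral_0_iff_AE) auto
      then have "AE x in \<mu>\<^sub>G. f x = 0" by (auto elim!: eventually_mono simp: pw_def)
      then show False using ne by simp
    qed
    have N: "Lp_norm \<mu>\<^sub>G p f = n powr (1 / p)" using n by (intro G.Lp_norm_eq) auto
    define \<gamma> where "\<gamma> = s powr p"
    have \<gamma>: "0 \<le> \<gamma>" by (simp add: \<gamma>_def)
    have grad: "(\<integral>\<^sup>+x. pw p (f x - f (x + t)) \<partial>\<mu>\<^sub>G) \<le> ennreal \<gamma>" if t: "t \<in> S\<^sub>G" for t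
    proof -
      have "(\<integral>\<^sup>+x. pw p (f x - f (x + t)) \<partial>\<mu>\<^sub>G) \<le> (\<integral>\<^sup>+x. ennreal (2 powr p) * (pw p (f x) + pw p (f (x + t))) \<partial>\<mu>\<^sub>G)"
        using p by (intro nn_integral_mono pw_sub_le) auto
      also have "\<dots> = ennreal (2 powr p) * (ennreal n + ennreal n)"
        using n G.nn_integral_right[of "\<lambda>x. pw p (f x)" t] by (simp add: nn_integral_cmult nn_integral_add)
      also have "\<dots> < \<infinity>" by (auto simp: ennreal_mult_less_top)
      finally obtain m where m: "0 \<le> m" "(\<integral>\<^sup>+x. pw p (f x - f (x + t)) \<partial>\<mu>\<^sub>G) = ennreal m"
        by (cases "\<integral>\<^sup>+x. pw p (f x - f (x + t)) \<partial>\<mu>\<^sub>G") auto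
      have "ennreal (m powr (1 / p)) = ennreal (Lp_norm \<mu>\<^sub>G p (\<lambda>x. f x - f (x + t)))"
        using m by (subst G.Lp_norm_eq) auto
      also have "\<dots> \<le> ennreal s"
        unfolding s(1)[symmetric] right_gradient_norm_def using t by (rule SUP_upper)
      finally have "m powr (1 / p) \<le> s" using s by simp
      then have "(m powr (1 / p)) powr p \<le> s powr p" using p by (intro powr_mono2) auto
      then have "m \<le> \<gamma>" using m p by (simp add: \<gamma>_def powr_powr)
      then show ?thesis using m by (simp add: ennreal_leI)
    qed
    show ?thesis
    proof (cases "2 * K * \<gamma> \<le> n")
      case True
      have ge: "ennreal ((K * \<gamma> / n + \<epsilon>) powr (- 1 / p)) \<le> ?j (K * v)" if "0 < \<epsilon>" for \<epsilon>
        using transfer[OF _ A supp n(2) n0 \<gamma> _ True that Av v] grad by auto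
      show ?thesis
      proof (cases "s = 0")
        case True
        have "?j (K * v) = \<infinity>"
        proof (rule ccontr)
          assume "?j (K * v) \<noteq> \<infinity>"
          then obtain q where q: "0 \<le> q" "?j (K * v) = ennreal q" by (cases "?j (K * v)") auto
          \<comment> \<open>With vanishing gradient \<epsilon> is arbitrary; this value makes the
            lower bound \<open>q + 1\<close>.\<close>
          have "ennreal (((q + 1) powr (- p)) powr (- 1 / p)) \<le> ennreal q"
            using ge[of "(q + 1) powr (- p)"] q True by (simp add: \<gamma>_def)
          then have "ennreal (q + 1) \<le> ennreal q" using q p by (simp add: powr_powr)
          then show False using q by simp
        qed
        then show ?thesis using D by (simp add: ennreal_mult_top)
      next
        case False
        then have s0: "s > 0" using s by simp
        have \<gamma>0: "\<gamma> > 0" using s0 by (simp add: \<gamma>_def)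
        have sg: "s = \<gamma> powr (1 / p)" using s0 p by (simp add: \<gamma>_def powr_powr)
        \<comment> \<open>For a positive gradient \<epsilon> is taken equal to the main term, which
          costs only a factor 2.\<close>
        have "n powr (1 / p) / s = (2 * K) powr (1 / p) * (K * \<gamma> / n + K * \<gamma> / n) powr (- 1 / p)"
          using K \<gamma>0 n0 by (simp add: sg powr_mult powr_divide powr_minus_divide flip: mult_2)
        also have "\<dots> \<le> D * (K * \<gamma> / n + K * \<gamma> / n) powr (- 1 / p)"
          unfolding D_def using K p by (intro mult_right_mono powr_mono2) auto
        finally have "ennreal (n powr (1 / p) / s) \<le> ennreal D * ennreal ((K * \<gamma> / n + K * \<gamma> / n) powr (- 1 / p))"
          using D by (simp add: ennreal_leI flip: ennreal_mult)
        also have "\<dots> \<le> ennreal D * ?j (K * v)"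
          using K \<gamma>0 n0 by (intro mult_left_mono ge) auto
        finally show ?thesis using s s0 N by (simp add: divide_ennreal)
      qed
    next
      case False
      then have \<gamma>0: "\<gamma> > 0" using \<gamma> n0 by (cases "\<gamma> = 0") auto
      then have s0: "s > 0" using s p by (cases "s = 0") (auto simp: \<gamma>_def)
      have sg: "s = \<gamma> powr (1 / p)" using s0 p by (simp add: \<gamma>_def powr_powr)
      have "n powr (1 / p) / s = (n / \<gamma>) powr (1 / p)" using \<gamma>0 n0 by (simp add: sg powr_divide)
      also have "\<dots> \<le> (2 * K) powr (1 / p)"
        using False \<gamma>0 n0 p by (intro powr_mono2) (auto simp: field_simps)
      also have "\<dots> = (4 * K / 2) powr (1 / p)" by simp
      also have "\<dots> = D / 2 powr (1 / p)" using K by (subst powr_divide) (auto simp: D_def)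
      also have "\<dots> = D * 2 powr (- 1 / p)" by (simp add: powr_minus_divide)
      finally have "ennreal (n powr (1 / p) / s) \<le> ennreal D * ennreal (2 powr (- 1 / p))"
        using D by (simp add: ennreal_leI flip: ennreal_mult)
      also have "\<dots> \<le> ennreal D * ?j (K * v)" by (intro mult_left_mono H.profile_ge_const p big) auto
      finally show ?thesis using s s0 N by (simp add: divide_ennreal)
    qed
  qed simp
  \<comment> \<open>The lower bound on \<open>v\<close> makes room for the unit ball of
    \<open>H\<close> within volume \<open>K * v\<close>.\<close>
  have "isoperimetric_profile \<mu>\<^sub>G S\<^sub>G p v \<le> ennreal D * ?j (K * v)"
    if v: "v \<ge> measure \<mu>\<^sub>H (H.B 0 1) / K" for v
  proof -
    have "0 \<le> measure \<mu>\<^sub>H (H.B 0 1) / K" using K by simp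
    then have v0: "0 \<le> v" using v by linarith
    have big: "measure \<mu>\<^sub>H (H.B 0 1) \<le> K * v" using v K by (simp add: field_simps)
    show ?thesis
      unfolding isoperimetric_profile_def[of \<mu>\<^sub>G] J_set_def[of \<mu>\<^sub>G]
      by (intro SUP_least main[OF big v0]) auto
  qed
  then have "eventually (\<lambda>v. isoperimetric_profile \<mu>\<^sub>G S\<^sub>G p v \<le> ennreal D * ?j (K * v)) at_top"
    by (auto simp: eventually_at_top_linorder)
  then show ?thesis unfolding asymp_dominated_def using K D by blast
qed

end

theorem corollary1:
  fixes S\<^sub>H :: "'h::{topological_group_add, t2_space, second_countable_topology} set"
    and S\<^sub>G :: "'g::{topological_group_add, t2_space, second_countable_topology} set"
    and d\<^sub>H :: "'h \<Rightarrow> 'h \<Rightarrow> real" and d\<^sub>G :: "'g \<Rightarrow> 'g \<Rightarrow> real"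
    and \<mu>\<^sub>H :: "'h measure" and \<mu>\<^sub>G :: "'g measure"
    and p :: real
  assumes "locally compact (UNIV :: 'h set)" and "locally compact (UNIV :: 'g set)"
    and "compact_symmetric_generating S\<^sub>H" and "compact_symmetric_generating S\<^sub>G"
    and "admissible_metric S\<^sub>H d\<^sub>H" and "admissible_metric S\<^sub>G d\<^sub>G"
    and "left_haar_measure \<mu>\<^sub>H" and "left_haar_measure \<mu>\<^sub>G"
    and "unimodular TYPE('h)" and "unimodular TYPE('g)"
    and "amenable TYPE('h)" and "amenable TYPE('g)"
    and "\<exists>f. regular_embedding d\<^sub>H d\<^sub>G f"
    and "1 \<le> p"
  shows "isoperimetric_profile \<mu>\<^sub>G S\<^sub>G p \<preceq>\<^sub>a isoperimetric_profile \<mu>\<^sub>H S\<^sub>H p"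
proof -
  have "haar_group S\<^sub>H d\<^sub>H \<mu>\<^sub>H" "haar_group S\<^sub>G d\<^sub>G \<mu>\<^sub>G"
    using assms by (auto simp: haar_group_def unimodular_def)
  then interpret haar_pair S\<^sub>H d\<^sub>H \<mu>\<^sub>H S\<^sub>G d\<^sub>G \<mu>\<^sub>G by (rule haar_pair.intro)
  obtain f M where "regular_embedding d\<^sub>H d\<^sub>G f" "left_invariant_mean \<mu>\<^sub>H M"
    using assms unfolding amenable_def by blast
  then show ?thesis using \<open>1 \<le> p\<close> by (rule profile_dominated)
qed

end
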